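(* Let $n\ge 1$ and $N\ge 0$ be integers, let $p\in\mathbb{C}$ with $|p|<1$, and let $q,t,a_1,\ldots,a_6\in\mathbb{C}^\ast$ satisfy $$a_1a_2a_3a_4a_5a_6\,t^{2n-2}=q\qquad\text{and}\qquad a_1a_6\,t^{n-1}=q^{-N},$$ the parameters being generic in the sense that no denominator in the formula below vanishes. Put $\xi_i=a_1t^{n-i}$ for $i=1,\ldots,n$. Then $$ \begin{aligned} &\sum_{N\ge\nu_1\ge\cdots\ge\nu_n\ge 0}\Bigg[\prod_{i=1}^{n}(qt^{2(i-1)})^{\nu_i}\frac{\theta(q^{2\nu_i}\xi_i^{2};p)}{\theta(\xi_i^{2};p)}\prod_{1\le j<k\le n}\frac{\theta(q^{\nu_j-\nu_k}\xi_j/\xi_k;p)\,\theta(q^{\nu_j+\nu_k}\xi_j\xi_k;p)}{\theta(\xi_j/\xi_k;p)\,\theta(\xi_j\xi_k;p)}\\ &\qquad\times\prod_{i=1}^{n}\prod_{m=1}^{6}\frac{\theta(a_m\xi_i;p;q)_{\nu_i}}{\theta(qa_m^{-1}\xi_i;p;q)_{\nu_i}}\prod_{1\le j<k\le n}\frac{\theta(t\xi_j/\xi_k;p;q)_{\nu_j-\nu_k}\,\theta(t\xi_j\xi_k;p;q)_{\nu_j+\nu_k}}{\theta(qt^{-1}\xi_j/\xi_k;p;q)_{\nu_j-\nu_k}\,\theta(qt^{-1}\xi_j\xi_k;p;q)_{\nu_j+\nu_k}}\Bigg]\\ &=\prod_{i=1}^{n}\frac{\theta(qa_1^2t^{n+i-2};p;q)_N\prod_{2\le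 j<k\le 4}\theta(qa_j^{-1}a_k^{-1}t^{1-i};p;q)_N}{\theta(qa_1^{-1}a_2^{-1}a_3^{-1}a_4^{-1}t^{2-n-i};p;q)_N\prod_{m=2}^{4}\theta(qa_m^{-1}a_1t^{i-1};p;q)_N}, \end{aligned} $$ where the sum runs over all integer tuples $(\nu_1,\ldots,\nu_n)$ with $N\ge\nu_1\ge\nu_2\ge\cdots\ge\nu_n\ge0$.
   Context: For $|p|<1$ and $x\in\mathbb{C}^\ast$: $(x;p)_\infty=\prod_{i=0}^{\infty}(1-p^ix)$ and $\theta(x;p)=(x;p)_\infty(p/x;p)_\infty$. For an integer $k\ge0$: $\theta(x;p;q)_k=\theta(x;p)\,\theta(qx;p)\cdots\theta(q^{k-1}x;p)$ (equal to $1$ for $k=0$). *)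

theory Defs
  imports "HOL-Analysis.Analysis"
begin

definition qpoch_inf :: "complex \<Rightarrow> complex \<Rightarrow> complex" where
  "qpoch_inf x p = (\<Prod>i. 1 - p ^ i * x)"

definition theta :: "complex \<Rightarrow> complex \<Rightarrow> complex" where
  "theta x p = qpoch_inf x p * qpoch_inf (p / x) p"

definition theta_fact :: "complex \<Rightarrow> complex \<Rightarrow> complex \<Rightarrow> nat \<Rightarrow> complex" where
  "theta_fact x p q k = (\<Prod>i<k. theta (q ^ i * x) p)"

text \<open>Tuples are functions on \<open>{1..n}\<close>, extensional outside, so that each tuple is counted once.\<close>

definition partition_tuples :: "nat \<Rightarrow> nat \<Rightarrow> (nat \<Rightarrow> nat) set" where
  "partition_tuples n N =
     {\<nu> \<in> {1..n} \<rightarrow>\<^sub>E {0..N}. \<forall>j\<in>{1..n}. \<forall>k\<in>{1..n}. j \<le> k \<longrightarrow> \<nu> k \<le> \<nu> j}"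

definition index_pairs :: "nat \<Rightarrow> nat \<Rightarrow> (nat \<times> nat) set" where
  "index_pairs l n = {(j, k). l \<le> j \<and> j < k \<and> k \<le> n}"

lemma finite_partition_tuples: "finite (partition_tuples n N)"
  unfolding partition_tuples_def
  by (rule finite_subset[of _ "{1..n} \<rightarrow>\<^sub>E {0..N}"]) (auto intro: finite_PiE)

lemma finite_index_pairs: "finite (index_pairs l n)"
  by (rule finite_subset[of _ "{..n} \<times> {..n}"]) (auto simp: index_pairs_def)

lemma convergent_qpoch_inf:
  fixes p x :: complex
  assumes "norm p < 1"
  shows "convergent_prod (\<lambda>i. 1 - p ^ i * x)"
proof -
  have "summable (\<lambda>i. norm (p ^ i * x))"
    using assms by (simp add: norm_mult norm_power summable_mult2)
  then have "abs_convergent_prod (\<lambda>i. 1 - p ^ i * x)"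
    by (subst abs_convergent_prod_conv_summable) simp
  then show ?thesis
    by (rule abs_convergent_prod_imp_convergent_prod)
qed

end

theory Submission
  imports Defs "HOL-Complex_Analysis.Complex_Analysis"
begin

text \<open>
This is the multivariable elliptic Jackson summation of type \<open>C\<close>.  The idea is a discrete integration
by parts that relates the sum of length \<open>N\<close> to a sum of length \<open>N - 1\<close> with shifted parameters.

Write all parameters as exponentials, \<open>q = exp (2 * \<eta>)\<close>, \<open>t = exp \<tau>\<close>, \<open>a m = exp (\<alpha> m)\<close>, and use the
odd entire function \<open>E w = exp (- w / 2) * theta (exp w) p\<close>, whose zeros form the lattice spanned by
\<open>2 * pi * \<i>\<close> and \<open>L = Ln p\<close>.  The summand becomes a product of a weight for each site
\<open>x\<^sub>i = \<alpha> 1 + (n - i) * \<tau> + \<nu>\<^sub>i * 2 * \<eta>\<close> and a weight for each pair of sites.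

The engine is the identity \<open>signed_sum\<close>: a sum over the \<open>2 ^ n\<close> choices of signs \<open>s\<close> of a product of
factors depending on \<open>s\<^sub>i * x\<^sub>i\<close> is independent of the positions \<open>x\<close> and has a closed form.  It is
used twice: on the lattice of points \<open>x\<close> belonging to length \<open>N\<close>, with the parameters
\<open>\<alpha> 5, \<alpha> 1, \<alpha> 6\<close>, and on the lattice of points \<open>y\<close> belonging to length \<open>N - 1\<close>, with the parameters
\<open>\<alpha> 2 - \<eta>, \<alpha> 3 - \<eta>, \<alpha> 4 - \<eta>\<close>.  For \<open>x = y + s * \<eta>\<close> the weight of \<open>x\<close> times the term of the first
sign sum is a constant multiple of the weight of \<open>y\<close> times the term of the second one
(\<open>detailed_balance\<close>).  Terms in which only one of the two points belongs to its lattice vanish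
(\<open>lower_term_eq_0\<close>, \<open>upper_term_eq_0\<close>).  Hence the two sums are proportional (\<open>sum_exchange\<close>), the
factor agrees with that of the closed forms (\<open>step_identity\<close>), and induction on \<open>N\<close> finishes the
argument for parameters in general position (\<open>jackson_sum_eq_prod\<close>).

The identity \<open>signed_sum\<close> itself is proved by counting zeros.  After clearing denominators, the
difference of its two sides is, as a function of one position, a theta function whose degree is
smaller than the number of zeros that symmetry and induction on \<open>n\<close> provide; such a function
vanishes by Liouville's theorem (\<open>quasi_periodic_eq_0\<close>).

The last step removes the assumption of general position.  Generic parameters are dense because a
countable set of values has to be avoided, and theta functions are jointly continuous in argument
and nome.
\<close>

section \<open>The infinite product as a function of both variables\<close>

lemma qpoch_inf_LIMSEQ:
  assumes "norm p < 1"
  shows "(\<lambda>n. \<Prod>i<n. 1 - p ^ i * x) \<longlonglongrightarrow> qpoch_inf x p"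
proof -
  have "(\<lambda>n. \<Prod>i\<le>n. 1 - p ^ i * x) \<longlonglongrightarrow> qpoch_inf x p"
    unfolding qpoch_inf_def by (rule convergent_prod_LIMSEQ[OF convergent_qpoch_inf[OF assms]])
  then show ?thesis
    by (subst (asm) lessThan_Suc_atMost[symmetric]) (rule LIMSEQ_imp_Suc)
qed

lemma qpoch_inf_step:
  assumes "norm p < 1"
  shows "qpoch_inf x p = (1 - x) * qpoch_inf (p * x) p"
proof (rule LIMSEQ_unique)
  show "(\<lambda>n. \<Prod>i<Suc n. 1 - p ^ i * x) \<longlonglongrightarrow> qpoch_inf x p"
    by (rule LIMSEQ_Suc[OF qpoch_inf_LIMSEQ[OF assms]])
  have "(\<lambda>n. (1 - x) * (\<Prod>i<n. 1 - p ^ i * (p * x))) \<longlonglongrightarrow> (1 - x) * qpoch_inf (p * x) p"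
    by (intro tendsto_intros qpoch_inf_LIMSEQ[OF assms])
  then show "(\<lambda>n. \<Prod>i<Suc n. 1 - p ^ i * x) \<longlonglongrightarrow> (1 - x) * qpoch_inf (p * x) p"
    by (simp add: prod.lessThan_Suc_shift mult_ac del: prod.lessThan_Suc)
qed

lemma qpoch_inf_eq_0D:
  assumes "norm p < 1" and "qpoch_inf x p = 0"
  shows "\<exists>i. p ^ i * x = 1"
proof (rule ccontr)
  assume "\<nexists>i. p ^ i * x = 1"
  then have "\<And>i. 1 - p ^ i * x \<noteq> 0"
    by (metis eq_iff_diff_eq_0)
  then have "qpoch_inf x p \<noteq> 0"
    unfolding qpoch_inf_def by (intro prodinf_nonzero convergent_qpoch_inf assms)
  with assms show False by simp
qed

text \<open>The partial products converge uniformly on products of closed discs in \<open>x\<close> and \<open>p\<close> together.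
Holomorphy in \<open>x\<close> feeds the Liouville argument; continuity in the pair \<open>(x, p)\<close> is what allows
the nome to be perturbed as well, so that \<open>p = 0\<close> is reached as a limit.\<close>

lemma uniform_limit_qpoch_inf:
  assumes "0 \<le> \<rho>" "\<rho> < 1"
  shows "uniform_limit (cball 0 R \<times> cball 0 \<rho>)
           (\<lambda>n z. \<Prod>i<n. 1 - snd z ^ i * fst z) (\<lambda>z. qpoch_inf (fst z) (snd z)) sequentially"
proof -
  let ?A = "cball 0 R \<times> cball 0 \<rho> :: (complex \<times> complex) set"
  have "uniformly_convergent_on ?A (\<lambda>N z. \<Prod>n<N. 1 - snd z ^ n * fst z)"
  proof (rule uniformly_convergent_on_prod')
    show "uniformly_convergent_on ?A (\<lambda>N z. \<Sum>n<N. norm (1 - snd z ^ n * fst z - 1))"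
    proof (rule Weierstrass_m_test')
      fix n and z :: "complex \<times> complex" assume z: "z \<in> ?A"
      have "norm (snd z) ^ n * norm (fst z) \<le> \<rho> ^ n * R"
        using z assms by (intro mult_mono power_mono) auto
      then show "norm (norm (1 - snd z ^ n * fst z - 1)) \<le> \<rho> ^ n * R"
        by (simp add: norm_mult norm_power)
    qed (use assms in \<open>auto intro!: summable_mult2 summable_geometric\<close>)
  qed (auto intro!: continuous_intros compact_Times)
  then have "uniform_limit ?A (\<lambda>N z. \<Prod>n<N. 1 - snd z ^ n * fst z)
               (\<lambda>z. lim (\<lambda>N. \<Prod>n<N. 1 - snd z ^ n * fst z)) sequentially"
    by (simp add: uniformly_convergent_uniform_limit_iff)
  moreover have "lim (\<lambda>N. \<Prod>n<N. 1 - snd z ^ n * fst z) = qpoch_inf (fst z) (snd z)"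
    if "z \<in> ?A" for z
    using that assms by (intro limI qpoch_inf_LIMSEQ) auto
  ultimately show ?thesis
    by (metis (mono_tags, lifting) uniform_limit_cong')
qed

lemma tendsto_qpoch_inf:
  assumes X: "X \<longlonglongrightarrow> x" and P: "P \<longlonglongrightarrow> p" and p: "norm p < 1"
  shows "(\<lambda>r. qpoch_inf (X r) (P r)) \<longlonglongrightarrow> qpoch_inf x p"
proof -
  define R where "R = norm x + 1"
  define \<rho> where "\<rho> = (norm p + 1) / 2"
  have \<rho>: "0 \<le> \<rho>" "\<rho> < 1" "norm p < \<rho>"
    using p by (auto simp: \<rho>_def)
  let ?A = "cball 0 R \<times> cball 0 \<rho> :: (complex \<times> complex) set"
  have "continuous_on ?A (\<lambda>z. qpoch_inf (fst z) (snd z))"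
    by (rule uniform_limit_theorem[OF _ uniform_limit_qpoch_inf[OF \<rho>(1,2)]])
       (auto intro!: continuous_intros always_eventually)
  then have "continuous_on (ball 0 R \<times> ball 0 \<rho>) (\<lambda>z. qpoch_inf (fst z) (snd z))"
    by (rule continuous_on_subset) auto
  moreover have "(x, p) \<in> ball 0 R \<times> ball 0 \<rho>"
    using \<rho> by (auto simp: R_def)
  ultimately have "isCont (\<lambda>z. qpoch_inf (fst z) (snd z)) (x, p)"
    by (simp add: continuous_on_eq_continuous_at open_Times)
  from isCont_tendsto_compose[OF this tendsto_Pair[OF X P]] show ?thesis
    by simp
qed

lemma tendsto_theta:
  assumes "X \<longlonglongrightarrow> x" "P \<longlonglongrightarrow> p" "norm p < 1" "x \<noteq> 0"
  shows "(\<lambda>r. theta (X r) (P r)) \<longlonglongrightarrow> theta x p"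
  unfolding theta_def using assms by (intro tendsto_intros tendsto_qpoch_inf) auto

lemma holomorphic_qpoch_inf:
  assumes "norm p < 1"
  shows "(\<lambda>x. qpoch_inf x p) holomorphic_on A"
proof -
  have "(\<lambda>x. qpoch_inf x p) holomorphic_on UNIV"
  proof (rule holomorphic_uniform_sequence[where f = "\<lambda>n x. \<Prod>i<n. 1 - p ^ i * x"])
    fix x :: complex
    have ul: "uniform_limit (cball 0 (norm x + 1) \<times> cball 0 (norm p))
            (\<lambda>n z. \<Prod>i<n. 1 - snd z ^ i * fst z) (\<lambda>z. qpoch_inf (fst z) (snd z)) sequentially"
      using assms by (intro uniform_limit_qpoch_inf) auto
    have "uniform_limit (cball x 1) (\<lambda>n y. \<Prod>i<n. 1 - p ^ i * y) (\<lambda>y. qpoch_inf y p) sequentially"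
    proof (rule uniform_limitI)
      fix e :: real assume "e > 0"
      from uniform_limitD[OF ul this]
      show "\<forall>\<^sub>F n in sequentially. \<forall>y\<in>cball x 1. dist (\<Prod>i<n. 1 - p ^ i * y) (qpoch_inf y p) < e"
      proof eventually_elim
        case (elim n)
        show ?case
        proof
          fix y assume "y \<in> cball x 1"
          then have "norm y \<le> norm x + 1"
            by (metis add.commute add_left_mono dist_norm mem_cball norm_minus_commute norm_triangle_sub order_trans)
          then have "(y, p) \<in> cball 0 (norm x + 1) \<times> cball 0 (norm p)"
            by auto
          from bspec[OF elim this] show "dist (\<Prod>i<n. 1 - p ^ i * y) (qpoch_inf y p) < e"
            by simp
        qed
      qed
    qed
    then show "\<exists>d>0. cball x d \<subseteq> UNIV \<and> uniform_limit (cball x d) (\<lambda>n y. \<Prod>i<n. 1 - p ^ i * y)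
                 (\<lambda>x. qpoch_inf x p) sequentially"
      by (intro exI[of _ 1]) auto
  qed (auto intro!: holomorphic_intros)
  then show ?thesis
    by (rule holomorphic_on_subset) auto
qed

section \<open>The odd theta function\<close>

text \<open>For \<open>p \<noteq> 0\<close>, set \<open>E w = exp (- w / 2) * theta (exp w) p\<close>.  The exponential prefactor makes the
theta function odd, so that the reflections \<open>x \<mapsto> 1 / x\<close> produce signs only.  All monomial factors
in the summation formula disappear in this normalisation, and multiplicative relations between
parameters become linear.\<close>

locale theta_lattice =
  fixes p :: complex
  assumes p0: "p \<noteq> 0" and p1: "norm p < 1"
begin

definition L :: complex where "L = Ln p"

definition E :: "complex \<Rightarrow> complex" where
  "E w = exp (- (w / 2)) * theta (exp w) p"

definition lattice :: "complex set" where
  "lattice = {of_int j * L + of_int k * (2 * of_real pi * \<i>) | j k. True}"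

lemma exp_L: "exp L = p"
  using p0 by (simp add: L_def)

lemma Re_L: "Re L < 0"
  using p0 p1 by (simp add: L_def)

lemma theta_exp: "theta (exp w) p = exp (w / 2) * E w"
  by (simp add: E_def exp_minus field_simps)

lemma E_eq: "E w = exp (- (w / 2)) * qpoch_inf (exp w) p * qpoch_inf (p * exp (- w)) p"
  by (simp add: E_def theta_def exp_minus field_simps)

lemma E_eq': "E w = (exp (- (w / 2)) - exp (w / 2)) * qpoch_inf (p * exp w) p * qpoch_inf (p * exp (- w)) p"
proof -
  have "exp (- (w / 2)) * (1 - exp w) = exp (- (w / 2)) - exp (w / 2)"
    by (simp add: algebra_simps flip: exp_add)
  then show ?thesis
    by (simp add: E_eq qpoch_inf_step[OF p1, of "exp w"] mult_ac)
qed

lemma E_minus: "E (- w) = - E w"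
  by (simp add: E_eq' algebra_simps)

lemma E_0 [simp]: "E 0 = 0"
  by (simp add: E_eq')

lemma holomorphic_E: "E holomorphic_on A"
proof -
  have holq: "(\<lambda>w. qpoch_inf (f w) p) holomorphic_on A" if "f holomorphic_on A" for f
    using holomorphic_on_compose[OF that holomorphic_qpoch_inf[OF p1]] by (simp add: o_def)
  have "(\<lambda>w. (exp (- (w / 2)) - exp (w / 2)) * qpoch_inf (p * exp w) p
               * qpoch_inf (p * exp (- w)) p) holomorphic_on A"
    by (intro holomorphic_intros holq) simp_all
  then show ?thesis
    by (simp add: E_eq'[abs_def])
qed

lemma holomorphic_E_comp [holomorphic_intros]:
  "f holomorphic_on A \<Longrightarrow> (\<lambda>w. E (f w)) holomorphic_on A"
  using holomorphic_on_compose[OF _ holomorphic_E, of f A] by (simp add: o_def)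

lemma E_period_2pi: "E (w + 2 * of_real pi * \<i>) = - E w"
proof -
  have "exp (- ((w + 2 * of_real pi * \<i>) / 2)) = - exp (- (w / 2))"
    by (simp add: add_divide_distrib exp_diff exp_minus)
  then show ?thesis
    by (simp add: E_def exp_add)
qed

lemma E_period_L: "E (w + L) = - exp (- (L / 2) - w) * E w"
proof -
  have p: "p * exp (- (w + L)) = exp (- w)"
    by (simp add: exp_diff exp_minus exp_add exp_L p0 field_simps)
  have "E (w + L) = exp (- ((w + L) / 2)) * (1 - exp (- w)) * qpoch_inf (p * exp w) p
                     * qpoch_inf (p * exp (- w)) p"
    unfolding E_eq p using qpoch_inf_step[OF p1, of "exp (- w)"]
    by (simp add: exp_add exp_L mult_ac)
  also have "exp (- ((w + L) / 2)) * (1 - exp (- w)) =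
       - exp (- (L / 2) - w) * (exp (- (w / 2)) - exp (w / 2))"
  proof -
    have "- (L / 2) - w + - (w / 2) = - ((w + L) / 2) + - w" "- (L / 2) - w + w / 2 = - ((w + L) / 2)"
      by (simp_all add: field_simps)
    then show ?thesis
      by (simp only: right_diff_distrib mult_minus_left flip: exp_add) simp
  qed
  finally show ?thesis
    by (simp add: E_eq' mult_ac)
qed

lemma latticeI: "of_int j * L + of_int k * (2 * of_real pi * \<i>) \<in> lattice"
  unfolding lattice_def by blast

lemma zero_in_lattice [simp]: "0 \<in> lattice"
  using latticeI[of 0 0] by simp

lemma lattice_add: "a \<in> lattice \<Longrightarrow> b \<in> lattice \<Longrightarrow> a + b \<in> lattice"
  unfolding lattice_def
proof safe
  fix j k j' k' :: int
  show "\<exists>j'' k''. of_int j * L + of_int k * (2 * of_real pi * \<i>) +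
            (of_int j' * L + of_int k' * (2 * of_real pi * \<i>)) =
            of_int j'' * L + of_int k'' * (2 * of_real pi * \<i>) \<and> True"
    by (intro exI[of _ "j + j'"] exI[of _ "k + k'"]) (simp add: algebra_simps)
qed

lemma lattice_minus: "a \<in> lattice \<Longrightarrow> - a \<in> lattice"
  unfolding lattice_def
proof safe
  fix j k :: int
  show "\<exists>j' k'. - (of_int j * L + of_int k * (2 * of_real pi * \<i>)) =
            of_int j' * L + of_int k' * (2 * of_real pi * \<i>) \<and> True"
    by (intro exI[of _ "- j"] exI[of _ "- k"]) (simp add: algebra_simps)
qed

lemma lattice_minus_iff: "- a \<in> lattice \<longleftrightarrow> a \<in> lattice"
  using lattice_minus[of a] lattice_minus[of "- a"] by auto

lemma lattice_diff: "a \<in> lattice \<Longrightarrow> b \<in> lattice \<Longrightarrow> a - b \<in> lattice"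
  using lattice_add[of a "- b"] lattice_minus[of b] by simp

lemma countable_lattice: "countable lattice"
proof -
  have "lattice = (\<lambda>(j, k). of_int j * L + of_int k * (2 * of_real pi * \<i>)) ` UNIV"
    by (auto simp: lattice_def)
  then show ?thesis
    by (metis countableI_type countable_image)
qed

lemma exp_eq_1_lattice:
  assumes "exp (w + of_int j * L) = 1"
  shows "w \<in> lattice"
proof -
  obtain k :: int where "Re (w + of_int j * L) = 0" "Im (w + of_int j * L) = of_int (2 * k) * pi"
    using assms unfolding exp_eq_1 by blast
  then have "w + of_int j * L = of_int k * (2 * of_real pi * \<i>)"
    by (intro complex_eqI) (simp_all add: mult_ac)
  then have "w = of_int (- j) * L + of_int k * (2 * of_real pi * \<i>)"
    by (simp add: algebra_simps eq_neg_iff_add_eq_0)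
  then show ?thesis
    using latticeI by metis
qed

lemma E_eq_0D:
  assumes "E w = 0"
  shows "w \<in> lattice"
proof -
  have "qpoch_inf (exp w) p = 0 \<or> qpoch_inf (p * exp (- w)) p = 0"
    using assms by (simp add: E_eq)
  then show ?thesis
  proof
    assume "qpoch_inf (exp w) p = 0"
    then obtain i where "p ^ i * exp w = 1"
      using qpoch_inf_eq_0D[OF p1] by blast
    then have "exp (w + of_int (int i) * L) = 1"
      by (simp add: exp_add exp_of_nat_mult exp_L mult.commute)
    then show ?thesis by (rule exp_eq_1_lattice)
  next
    assume "qpoch_inf (p * exp (- w)) p = 0"
    then obtain i where "p ^ i * (p * exp (- w)) = 1"
      using qpoch_inf_eq_0D[OF p1] by blast
    then have "exp (- w + of_int (int (Suc i)) * L) = 1"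
      by (simp add: exp_add exp_diff exp_of_nat_mult exp_L algebra_simps exp_minus divide_simps)
    then have "- w \<in> lattice" by (rule exp_eq_1_lattice)
    then show ?thesis by (simp add: lattice_minus_iff)
  qed
qed

text \<open>Translation by any lattice vector multiplies \<open>E\<close> by a nowhere vanishing function, so every zero
looks like the zero at the origin.  This reduces simplicity of all zeros to that of the zero \<open>0\<close>,
where the factor \<open>exp (- w / 2) - exp (w / 2)\<close> can be split off.\<close>

lemma E_quasi_period:
  assumes "l \<in> lattice"
  shows "\<exists>a b. \<forall>w. E (w + l) = exp (a * w + b) * E w"
proof -
  define Q where "Q l \<longleftrightarrow> (\<exists>a b. \<forall>w. E (w + l) = exp (a * w + b) * E w)" for l
  have add: "Q (l + l')" if "Q l" "Q l'" for l l'
  proof -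
    from that obtain a b a' b' where "\<And>w. E (w + l) = exp (a * w + b) * E w"
      "\<And>w. E (w + l') = exp (a' * w + b') * E w"
      unfolding Q_def by metis
    then have "E (w + l + l') = exp (a' * (w + l) + b') * (exp (a * w + b) * E w)" for w
      by simp
    moreover have "a' * (w + l) + b' + (a * w + b) = (a + a') * w + (a' * l + b + b')" for w
      by (simp add: algebra_simps)
    ultimately have "E (w + (l + l')) = exp ((a + a') * w + (a' * l + b + b')) * E w" for w
      by (metis (no_types, lifting) add.assoc exp_add mult.assoc)
    then show ?thesis unfolding Q_def by blast
  qed
  have minus: "Q (- l)" if "Q l" for l
  proof -
    from that obtain a b where ab: "\<And>w. E (w + l) = exp (a * w + b) * E w"
      unfolding Q_def by metis
    have "E (w + (- l)) = exp (- a * w + (a * l - b)) * E w" for w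
      using ab[of "w - l"] by (simp add: algebra_simps exp_add exp_diff exp_minus field_simps)
    then show ?thesis unfolding Q_def by blast
  qed
  have mult: "Q (of_int k * l)" if "Q l" for k l
  proof (induction k rule: int_induct[of _ 0])
    case base
    show ?case unfolding Q_def by (auto intro!: exI[of _ 0])
  next
    case (step1 i)
    then show ?case using add[OF step1(2) that] by (simp add: algebra_simps)
  next
    case (step2 i)
    then show ?case using add[OF step2(2) minus[OF that]] by (simp add: algebra_simps)
  qed
  have "Q L"
  proof -
    have "E (w + L) = exp ((-1) * w + (- (L / 2) + of_real pi * \<i>)) * E w" for w
    proof -
      have "exp ((-1) * w + (- (L / 2) + of_real pi * \<i>)) = exp (- (L / 2) - w + of_real pi * \<i>)"
        by (rule arg_cong[of _ _ exp]) simp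
      also have "\<dots> = - exp (- (L / 2) - w)"
        by (subst exp_add) simp
      finally show ?thesis by (simp add: E_period_L)
    qed
    then show ?thesis unfolding Q_def by blast
  qed
  moreover have "Q (2 * of_real pi * \<i>)"
  proof -
    have "E (w + 2 * of_real pi * \<i>) = exp (0 * w + of_real pi * \<i>) * E w" for w
      by (simp add: E_period_2pi)
    then show ?thesis unfolding Q_def by blast
  qed
  ultimately show ?thesis
    using assms add mult unfolding lattice_def Q_def[symmetric] by blast
qed

lemma E_eq_0_iff: "E w = 0 \<longleftrightarrow> w \<in> lattice"
  using E_eq_0D E_quasi_period[of w] E_0 by (metis add_0 mult_zero_right)

lemma deriv_E_0: "deriv E 0 \<noteq> 0"
proof -
  have holq: "(\<lambda>w. qpoch_inf (f w) p) holomorphic_on UNIV" if "f holomorphic_on UNIV" for f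
    using holomorphic_on_compose[OF that holomorphic_qpoch_inf[OF p1]] by (simp add: o_def)
  define h where "h w = qpoch_inf (p * exp w) p * qpoch_inf (p * exp (- w)) p" for w
  have "h holomorphic_on UNIV"
    unfolding h_def by (intro holomorphic_intros holq)
  then have h: "(h has_field_derivative deriv h 0) (at 0)"
    by (simp add: holomorphic_derivI)
  have "E = (\<lambda>w. (exp (- (w / 2)) - exp (w / 2)) * h w)"
    by (auto simp: E_eq' h_def)
  moreover have "((\<lambda>w. (exp (- (w / 2)) - exp (w / 2)) * h w) has_field_derivative - h 0) (at 0)"
    by (rule derivative_eq_intros h refl | simp)+
  ultimately have "deriv E 0 = - h 0"
    using DERIV_imp_deriv by metis
  moreover have "h 0 \<noteq> 0"
  proof
    assume "h 0 = 0"
    then obtain i where "p ^ i * p = 1"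
      using qpoch_inf_eq_0D[OF p1] by (auto simp: h_def)
    then have "norm p ^ Suc i = 1"
      by (metis mult.commute norm_one norm_power power_Suc)
    moreover have "norm p ^ Suc i < 1"
      using p0 p1 by (intro power_Suc_less_one) auto
    ultimately show False by simp
  qed
  ultimately show ?thesis by simp
qed

lemma deriv_E_lattice:
  assumes "l \<in> lattice"
  shows "deriv E l \<noteq> 0"
proof -
  obtain a b where ab: "\<And>w. E (w + l) = exp (a * w + b) * E w"
    using E_quasi_period[OF assms] by blast
  have dE: "(E has_field_derivative deriv E z) (at z)" for z
    using holomorphic_E[of UNIV] by (simp add: holomorphic_derivI)
  have "((\<lambda>w. exp (a * w + b) * E w) has_field_derivative exp b * deriv E 0) (at 0)"
    by (rule derivative_eq_intros dE refl | simp)+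
  moreover have "((\<lambda>w. E (w + l)) has_field_derivative deriv E l) (at 0)"
    using dE[of "0 + l"] DERIV_shift[of E "deriv E l" 0 l] by simp
  ultimately have "deriv E l = exp b * deriv E 0"
    using ab DERIV_unique by (metis (no_types, lifting) ext)
  then show ?thesis using deriv_E_0 by simp
qed

section \<open>Too many zeros force a theta function to vanish\<close>

lemma int_shift_invariant:
  fixes f :: "complex \<Rightarrow> 'b"
  assumes "\<And>w. f (w + a) = f w"
  shows "f (w + of_int k * a) = f w"
proof (induction k arbitrary: w rule: int_induct[of _ 0])
  case base
  show ?case by simp
next
  case (step1 i)
  then show ?case using assms[of "w + of_int i * a"] by (simp add: algebra_simps)
next
  case (step2 i)
  then show ?case using assms[of "w + of_int (i - 1) * a"] by (simp add: algebra_simps)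
qed

lemma lattice_shift_invariant:
  fixes f :: "complex \<Rightarrow> 'b"
  assumes "\<And>w. f (w + 2 * of_real pi * \<i>) = f w" and "\<And>w. f (w + L) = f w" and "l \<in> lattice"
  shows "f (w + l) = f w"
proof -
  obtain j k where "l = of_int j * L + of_int k * (2 * of_real pi * \<i>)"
    using assms(3) unfolding lattice_def by blast
  then show ?thesis
    using int_shift_invariant[of f, OF assms(1), of "w + of_int j * L" k]
      int_shift_invariant[of f, OF assms(2), of w j] by (simp add: add.assoc)
qed

text \<open>The modulus of \<open>h\<close> is determined by its values on a compact fundamental rectangle; the imaginary
part of \<open>L\<close> only tilts the fundamental domain, because it can be compensated by multiples of
\<open>2 * pi * \<i>\<close>.\<close>

lemma bounded_of_norm_lattice_invariant:
  assumes hol: "h holomorphic_on UNIV"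
    and per: "\<And>w. norm (h (w + 2 * of_real pi * \<i>)) = norm (h w)" "\<And>w. norm (h (w + L)) = norm (h w)"
  shows "bounded (range h)"
proof -
  let ?K = "cbox (Complex (Re L) 0) (Complex 0 (2 * pi))"
  have "compact (h ` ?K)"
    using hol by (intro compact_continuous_image compact_cbox)
      (auto intro: holomorphic_on_imp_continuous_on holomorphic_on_subset)
  then obtain B where B: "\<And>w. w \<in> ?K \<Longrightarrow> norm (h w) \<le> B"
    by (metis compact_imp_bounded bounded_iff imageI)
  have "norm (h w) \<le> B" for w
  proof -
    define j where "j = - \<lfloor>Re w / Re L\<rfloor>"
    define k where "k = - \<lfloor>Im (w + of_int j * L) / (2 * pi)\<rfloor>"
    define l where "l = of_int j * L + of_int k * (2 * of_real pi * \<i>)"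
    have 1: "Re w / Re L + of_int j \<ge> 0" "Re w / Re L + of_int j \<le> 1"
      unfolding j_def by linarith+
    have "Re w + of_int j * Re L = (Re w / Re L + of_int j) * Re L"
      using Re_L by (simp add: field_simps)
    then have Re: "Re w + of_int j * Re L \<le> 0" "Re L \<le> Re w + of_int j * Re L"
      using mult_right_mono_neg[of 0 _ "Re L"] mult_right_mono_neg[of _ 1 "Re L"] 1 Re_L
      by (simp_all add: mult_nonneg_nonpos)
    have 2: "Im (w + of_int j * L) / (2 * pi) + of_int k \<ge> 0" "Im (w + of_int j * L) / (2 * pi) + of_int k \<le> 1"
      unfolding k_def by linarith+
    have Im: "0 \<le> Im (w + of_int j * L) + of_int k * (2 * pi)" "Im (w + of_int j * L) + of_int k * (2 * pi) \<le> 2 * pi"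
      using 2 by (simp_all add: field_simps)
    have "w + l \<in> ?K"
      using Re Im by (simp add: in_cbox_complex_iff l_def algebra_simps)
    moreover have "norm (h (w + l)) = norm (h w)"
      by (rule lattice_shift_invariant[of "\<lambda>w. norm (h w)"]) (use per latticeI in \<open>auto simp: l_def\<close>)
    ultimately show ?thesis using B by metis
  qed
  then show ?thesis by (auto simp: bounded_iff)
qed

lemma continuous_eq_off_countable:
  fixes f g :: "complex \<Rightarrow> 'b::t2_space"
  assumes "continuous_on UNIV f" "continuous_on UNIV g" "countable C"
    and eq: "\<And>w. w \<notin> C \<Longrightarrow> f w = g w"
  shows "f w = g w"
proof (rule ccontr)
  assume "f w \<noteq> g w"
  moreover have "open {w. f w \<noteq> g w}"
    using assms(1,2) by (intro open_Collect_neq)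
  ultimately obtain e where "e > 0" "ball w e \<subseteq> {w. f w \<noteq> g w}"
    using openE[of "{w. f w \<noteq> g w}" w] by blast
  then have "ball w e \<subseteq> C" using eq by blast
  with assms(3) \<open>e > 0\<close> show False
    using countable_subset[of "ball w e" C] uncountable_ball[of e w] by simp
qed

text \<open>The zeros of \<open>E\<close> are simple, so all singularities of the quotient are removable.\<close>

lemma divide_by_E:
  assumes hol: "G holomorphic_on UNIV" and zero: "\<And>l. l \<in> lattice \<Longrightarrow> G (z + l) = 0"
  obtains H where "H holomorphic_on UNIV" "\<And>w. G w = E (w - z) * H w"
proof
  define f where "f w = G w / E (w - z)" for w
  have ana: "f analytic_on {w}" if "E (w - z) \<noteq> 0" for w
  proof -
    have "G analytic_on {w}" "(\<lambda>w. E (w - z)) analytic_on {w}"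
      using hol by (auto simp: analytic_on_holomorphic intro!: exI[of _ UNIV] holomorphic_intros)
    then show ?thesis
      unfolding f_def using that by (intro analytic_on_divide) auto
  qed
  have "remove_sings f analytic_on {w}" for w
  proof (cases "E (w - z) = 0")
    case False
    then show ?thesis using ana by (intro remove_sings_analytic_on)
  next
    case True
    have dE: "(E has_field_derivative deriv E u) (at u)" for u
      using holomorphic_E[of UNIV] by (simp add: holomorphic_derivI)
    have G: "G analytic_on {w}" "(\<lambda>w. E (w - z)) analytic_on {w}"
      using hol by (auto simp: analytic_on_holomorphic intro!: exI[of _ UNIV] holomorphic_intros)
    have "isolated_singularity_at f w"
      unfolding f_def using G
      by (intro isolated_singularity_at_divide isolated_singularity_at_analytic not_essential_analytic)
    moreover have "f \<midarrow>w\<rightarrow> deriv G w / deriv E (w - z)"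
      unfolding f_def
    proof (rule lhopital_complex_simple)
      show "(G has_field_derivative deriv G w) (at w)"
        using hol by (simp add: holomorphic_derivI)
      show "((\<lambda>w. E (w - z)) has_field_derivative deriv E (w - z)) (at w)"
        using DERIV_shift[of E _ w "- z"] dE[of "w - z"] by simp
      show "G w = 0" using zero[of "w - z"] True by (simp add: E_eq_0_iff)
      show "deriv E (w - z) \<noteq> 0" using True by (simp add: E_eq_0_iff deriv_E_lattice)
    qed (use True in auto)
    ultimately show ?thesis by (rule remove_sings_analytic_at)
  qed
  then show "remove_sings f holomorphic_on UNIV"
    using analytic_on_analytic_at analytic_imp_holomorphic by blast
  show "G w = E (w - z) * remove_sings f w" for w
  proof (cases "E (w - z) = 0")
    case True
    then show ?thesis using zero[of "w - z"] by (simp add: E_eq_0_iff)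
  next
    case False
    then show ?thesis using ana[OF False] by (simp add: f_def)
  qed
qed

text \<open>An entire function with the transformation behaviour of a product of \<open>D\<close> translates of \<open>E\<close> has
only \<open>D\<close> zeros modulo the lattice unless it vanishes.  Dividing by \<open>E (w - z)\<close> removes one zero and
lowers \<open>D\<close> by one.  For \<open>D = 0\<close>, multiplication by a suitable real exponential makes the modulus
doubly periodic, and Liouville's theorem applies.  Stating the hypotheses for moduli makes them
stable under the division, whatever signs and phases it introduces.\<close>

lemma quasi_periodic_eq_0:
  assumes "G holomorphic_on UNIV"
    and "\<And>w. norm (G (w + 2 * of_real pi * \<i>)) = norm (G w)"
    and "\<And>w. norm (G (w + L)) = norm (exp (c - of_nat D * w)) * norm (G w)"
    and "finite Z" "card Z = Suc D" "\<And>z. z \<in> Z \<Longrightarrow> G z = 0"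
    and "\<And>z z'. z \<in> Z \<Longrightarrow> z' \<in> Z \<Longrightarrow> z \<noteq> z' \<Longrightarrow> z - z' \<notin> lattice"
  shows "G w = 0"
  using assms
proof (induction D arbitrary: G c Z w)
  case 0
  \<comment> \<open>chosen so that the real exponential cancels the multiplier \<open>exp (Re c)\<close> of the period \<open>L\<close>\<close>
  define \<rho> where "\<rho> = Re c / Re L"
  define h where "h w = exp (- (of_real \<rho> * w)) * G w" for w
  have "\<rho> * Re L = Re c" using Re_L by (simp add: \<rho>_def)
  then have "exp (- \<rho> * Re (w + L)) * exp (Re c) = exp (- \<rho> * Re w)" for w
    by (simp add: algebra_simps flip: exp_add)
  then have "norm (h (w + L)) = norm (h w)" for w
    using 0(3)[of w] by (simp add: h_def norm_mult mult_ac)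
  moreover have "norm (h (w + 2 * of_real pi * \<i>)) = norm (h w)" for w
    using 0(2)[of w] by (simp add: h_def norm_mult)
  moreover have h: "h holomorphic_on UNIV"
    unfolding h_def by (intro holomorphic_intros 0(1))
  ultimately have "bounded (range h)"
    by (intro bounded_of_norm_lattice_invariant)
  then have "h constant_on UNIV"
    using h by (rule Liouville_theorem[rotated])
  moreover obtain z where "z \<in> Z" using 0(5) by (metis card.empty equals0I Zero_neq_Suc)
  then have "h z = 0" using 0(6) by (simp add: h_def)
  ultimately have "h w = 0" by (metis UNIV_I constant_on_def)
  then show ?case by (simp add: h_def)
next
  case (Suc D)
  obtain z where z: "z \<in> Z" using Suc(6) by (metis card.empty equals0I Zero_neq_Suc)
  have "(G (z + l) = 0) = (G z = 0)" if "l \<in> lattice" for l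
  proof (rule lattice_shift_invariant[of "\<lambda>w. G w = 0", OF _ _ that])
    show "(G (w + 2 * of_real pi * \<i>) = 0) = (G w = 0)" for w
      using Suc(3)[of w] by (metis norm_eq_zero)
    show "(G (w + L) = 0) = (G w = 0)" for w
      using Suc(4)[of w] by (metis exp_not_eq_zero mult_eq_0_iff norm_eq_zero)
  qed
  then have "G (z + l) = 0" if "l \<in> lattice" for l
    using that Suc(7)[OF z] by blast
  then obtain H where H: "H holomorphic_on UNIV" and GH: "\<And>w. G w = E (w - z) * H w"
    using divide_by_E[OF Suc(2)] by metis
  have cont: "continuous_on UNIV (\<lambda>w. norm (H (f w)))" if "continuous_on UNIV f" for f
    using continuous_on_compose2[OF holomorphic_on_imp_continuous_on[OF H] that]
    by (intro continuous_on_norm) auto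
  have cnt: "countable ((\<lambda>l. z + l) ` lattice)"
    using countable_lattice by simp
  have E0: "E (w - z) \<noteq> 0" if "w \<notin> (\<lambda>l. z + l) ` lattice" for w
    using that E_eq_0D[of "w - z"] by (metis add_diff_cancel_left' diff_add_cancel image_eqI add.commute)
  have "norm (H (w + 2 * of_real pi * \<i>)) = norm (H w)" for w
  proof (rule continuous_eq_off_countable[where w = w and C = "(\<lambda>l. z + l) ` lattice"
        and f = "\<lambda>w. norm (H (w + 2 * of_real pi * \<i>))", OF _ _ cnt])
    fix w assume "w \<notin> (\<lambda>l. z + l) ` lattice"
    moreover have "norm (E (w - z)) * norm (H (w + 2 * of_real pi * \<i>)) = norm (E (w - z)) * norm (H w)"
      using Suc(3)[of w] E_period_2pi[of "w - z"] by (simp add: GH norm_mult algebra_simps)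
    ultimately show "norm (H (w + 2 * of_real pi * \<i>)) = norm (H w)"
      using E0 by simp
  qed (intro cont continuous_intros)+
  moreover have "norm (H (w + L)) = norm (exp (c + L / 2 - z - of_nat D * w)) * norm (H w)" for w
  proof (rule continuous_eq_off_countable[where w = w and C = "(\<lambda>l. z + l) ` lattice"
        and f = "\<lambda>w. norm (H (w + L))", OF _ _ cnt])
    fix w assume w: "w \<notin> (\<lambda>l. z + l) ` lattice"
    have "norm (E (w + L - z)) * norm (H (w + L)) =
          norm (exp (c - of_nat (Suc D) * w)) * (norm (E (w - z)) * norm (H w))"
      using Suc(4)[of w] by (simp only: GH norm_mult)
    moreover have "E (w + L - z) = - exp (- (L / 2) - (w - z)) * E (w - z)"
      using E_period_L[of "w - z"] by (simp add: algebra_simps)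
    ultimately have "norm (exp (- (L / 2) - (w - z))) * norm (H (w + L)) =
          norm (exp (c - of_nat (Suc D) * w)) * norm (H w)"
      using E0[OF w] by (simp add: norm_mult)
    moreover have "exp (c - of_nat (Suc D) * w) =
        exp (- (L / 2) - (w - z)) * exp (c + L / 2 - z - of_nat D * w)"
      unfolding exp_add[symmetric] by (rule arg_cong[of _ _ exp]) (simp add: algebra_simps)
    ultimately show "norm (H (w + L)) = norm (exp (c + L / 2 - z - of_nat D * w)) * norm (H w)"
      by (simp only: norm_mult mult.assoc mult_cancel_left) simp
  qed (intro cont continuous_intros)+
  ultimately have "H w = 0"
  proof (rule Suc.IH[OF H])
    show "finite (Z - {z})" "card (Z - {z}) = Suc D" using Suc(5,6) z by auto
    show "H z' = 0" if "z' \<in> Z - {z}" for z'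
      using Suc(7)[of z'] Suc(8)[of z' z] that z by (auto simp: GH E_eq_0_iff)
  qed (use Suc(8) in auto)
  then show ?case by (simp add: GH)
qed

section \<open>Theta functions of higher degree\<close>

text \<open>These are the transformation rules of a product of \<open>D\<close> factors \<open>E (c\<^sub>i + z)\<close> with
\<open>c\<close> the sum of the \<open>c\<^sub>i\<close>.\<close>

definition quasi_periodic :: "nat \<Rightarrow> complex \<Rightarrow> (complex \<Rightarrow> complex) \<Rightarrow> bool" where
  "quasi_periodic D c f \<longleftrightarrow> f holomorphic_on UNIV \<and> (\<forall>z. f (z + 2 * of_real pi * \<i>) = (-1) ^ D * f z) \<and>
     (\<forall>z. f (z + L) = (-1) ^ D * exp (- c - of_nat D * (L / 2 + z)) * f z)"

lemma quasi_periodic_1: "quasi_periodic 0 0 (\<lambda>z. 1)"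
  by (simp add: quasi_periodic_def)

lemma quasi_periodic_E: "quasi_periodic 1 c (\<lambda>z. E (c + z))"
proof -
  have "E (c + (z + L)) = - exp (- c - (L / 2 + z)) * E (c + z)" for z
  proof -
    have "- (L / 2) - (c + z) = - c - (L / 2 + z)" by simp
    with E_period_L[of "c + z"] show ?thesis by (metis add.assoc)
  qed
  moreover have "E (c + (z + 2 * of_real pi * \<i>)) = - E (c + z)" for z
    using E_period_2pi[of "c + z"] by (simp add: algebra_simps)
  ultimately show ?thesis
    unfolding quasi_periodic_def by (auto intro!: holomorphic_intros)
qed

lemma quasi_periodic_E': "quasi_periodic 1 (- c) (\<lambda>z. E (z - c))"
  using quasi_periodic_E[of "- c"] by simp

lemma quasi_periodic_mult:
  assumes "quasi_periodic D c f" "quasi_periodic D' c' g"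
  shows "quasi_periodic (D + D') (c + c') (\<lambda>z. f z * g z)"
proof -
  have "exp (- (c + c') - of_nat (D + D') * (L / 2 + z)) =
          exp (- c - of_nat D * (L / 2 + z)) * exp (- c' - of_nat D' * (L / 2 + z))" for z
    unfolding exp_add[symmetric] by (rule arg_cong[of _ _ exp]) (simp add: algebra_simps)
  then show ?thesis
    using assms unfolding quasi_periodic_def
    by (auto intro!: holomorphic_intros simp: power_add mult_ac)
qed

lemma quasi_periodic_prod:
  assumes "finite A" "\<And>i. i \<in> A \<Longrightarrow> quasi_periodic D c (f i)"
  shows "quasi_periodic (card A * D) (of_nat (card A) * c) (\<lambda>z. \<Prod>i\<in>A. f i z)"
  using assms
proof (induction A rule: finite_induct)
  case empty
  show ?case by (simp add: quasi_periodic_1)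
next
  case (insert i A)
  have "quasi_periodic (D + card A * D) (c + of_nat (card A) * c) (\<lambda>z. f i z * (\<Prod>i\<in>A. f i z))"
    using insert by (intro quasi_periodic_mult) auto
  with insert show ?case by (simp add: algebra_simps)
qed

lemma quasi_periodic_add:
  assumes "quasi_periodic D c f" "quasi_periodic D c g"
  shows "quasi_periodic D c (\<lambda>z. f z + g z)"
  using assms unfolding quasi_periodic_def by (auto intro!: holomorphic_intros simp: algebra_simps)

lemma quasi_periodic_diff:
  assumes "quasi_periodic D c f" "quasi_periodic D c g"
  shows "quasi_periodic D c (\<lambda>z. f z - g z)"
  using assms unfolding quasi_periodic_def by (auto intro!: holomorphic_intros simp: algebra_simps)

lemma quasi_periodic_cmult:
  assumes "quasi_periodic D c f"
  shows "quasi_periodic D c (\<lambda>z. a * f z)"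
  using assms unfolding quasi_periodic_def by (auto intro!: holomorphic_intros simp: algebra_simps)

lemma quasi_periodic_sum:
  assumes "finite A" "\<And>i. i \<in> A \<Longrightarrow> quasi_periodic D c (f i)"
  shows "quasi_periodic D c (\<lambda>z. \<Sum>i\<in>A. f i z)"
  using assms
proof (induction A rule: finite_induct)
  case empty
  show ?case by (simp add: quasi_periodic_def)
next
  case (insert i A)
  then show ?case by (simp add: quasi_periodic_add)
qed

lemma quasi_periodic_reflect:
  assumes "quasi_periodic D 0 f" "even D"
  shows "quasi_periodic D 0 (\<lambda>z. f (- z))"
proof -
  have 1: "f (z + 2 * of_real pi * \<i>) = f z" "f (z + L) = exp (- of_nat D * (L / 2 + z)) * f z" for z
    using assms unfolding quasi_periodic_def by auto
  have "f (- (z + L)) = exp (- of_nat D * (L / 2 + z)) * f (- z)" for z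
  proof -
    have "exp (of_nat D * (L / 2 + z)) * exp (- of_nat D * (L / 2 + z)) = 1"
      by (simp flip: exp_add)
    moreover have "- of_nat D * (L / 2 + - (z + L)) = of_nat D * (L / 2 + z)"
      by (simp add: algebra_simps)
    ultimately show ?thesis
      using 1(2)[of "- (z + L)"] by (simp add: mult_ac)
  qed
  moreover have "f (- (z + 2 * of_real pi * \<i>)) = f (- z)" for z
    using 1(1)[of "- (z + 2 * of_real pi * \<i>)"] by simp
  moreover have "(\<lambda>z. f (- z)) holomorphic_on UNIV"
    using holomorphic_on_compose_gen[of uminus UNIV f UNIV] assms
    by (auto simp: quasi_periodic_def o_def holomorphic_on_minus holomorphic_on_ident)
  ultimately show ?thesis using assms by (auto simp: quasi_periodic_def)
qed

lemma quasi_periodic_E_double: "quasi_periodic 4 0 (\<lambda>z. E (2 * z))"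
proof -
  have "E (2 * (z + L)) = exp (- 4 * (L / 2 + z)) * E (2 * z)" for z
  proof -
    have "E (2 * (z + L)) = E (2 * z + L + L)" by (simp add: algebra_simps)
    also have "\<dots> = (exp (- (L / 2) - (2 * z + L)) * exp (- (L / 2) - 2 * z)) * E (2 * z)"
      by (simp only: E_period_L) simp
    also have "exp (- (L / 2) - (2 * z + L)) * exp (- (L / 2) - 2 * z) = exp (- 4 * (L / 2 + z))"
      unfolding exp_add[symmetric] by (rule arg_cong[of _ _ exp]) (simp add: algebra_simps)
    finally show ?thesis .
  qed
  moreover have "E (2 * (z + 2 * of_real pi * \<i>)) = E (2 * z)" for z
    using E_period_2pi[of "2 * z"] E_period_2pi[of "2 * z + 2 * of_real pi * \<i>"]
    by (simp add: algebra_simps)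
  ultimately show ?thesis
    by (auto simp: quasi_periodic_def intro!: holomorphic_intros)
qed

definition half_periods :: "complex set" where
  "half_periods = {0, of_real pi * \<i>, L / 2, L / 2 + of_real pi * \<i>}"

text \<open>At a half period \<open>h\<close> the points \<open>h\<close> and \<open>- h\<close> differ by a period, and for even degree and zero
characteristic the multiplier between them is \<open>1\<close>; oddness then forces the value \<open>0\<close>.\<close>

lemma odd_quasi_periodic_half_periods:
  assumes "quasi_periodic D 0 f" "even D" "\<And>z. f (- z) = - f z" "h \<in> half_periods"
  shows "f h = 0"
proof -
  have 1: "f (z + 2 * of_real pi * \<i>) = f z" "f (z + L) = exp (- of_nat D * (L / 2 + z)) * f z" for z
    using assms unfolding quasi_periodic_def by auto
  have "exp (- of_nat D * (- (of_real pi * \<i>))) = (1::complex)"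
  proof -
    obtain k where "D = 2 * k" using \<open>even D\<close> by blast
    then have "exp (- of_nat D * (- (of_real pi * \<i>))) = (exp (2 * of_real pi * \<i>) :: complex) ^ k"
      by (simp add: exp_of_nat_mult[symmetric] mult_ac)
    then show ?thesis by simp
  qed
  then have "f (L / 2 - of_real pi * \<i>) = f (- (L / 2) - of_real pi * \<i>)"
    using 1(2)[of "- (L / 2) - of_real pi * \<i>"] by (simp add: algebra_simps)
  moreover have "L / 2 - of_real pi * \<i> + 2 * of_real pi * \<i> = L / 2 + of_real pi * \<i>"
    "- (L / 2) - of_real pi * \<i> = - (L / 2 + of_real pi * \<i>)" by simp_all
  ultimately have "f (L / 2 + of_real pi * \<i>) = f (- (L / 2 + of_real pi * \<i>))"
    using 1(1)[of "L / 2 - of_real pi * \<i>"] by metis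
  moreover have "f (L / 2) = f (- (L / 2))"
    using 1(2)[of "- (L / 2)"] by simp
  moreover have "f (of_real pi * \<i>) = f (- (of_real pi * \<i>))"
  proof -
    have "- (of_real pi * \<i>) + 2 * of_real pi * \<i> = of_real pi * \<i>" by simp
    with 1(1)[of "- (of_real pi * \<i>)"] show ?thesis by metis
  qed
  ultimately have "f (- h) = f h"
    using assms(4) unfolding half_periods_def by (elim insertE emptyE) (metis minus_zero)+
  then show ?thesis
    using assms(3)[of h] by simp
qed

definition separated :: "complex set \<Rightarrow> bool" where
  "separated Z \<longleftrightarrow> finite Z \<and> (\<forall>a\<in>Z. \<forall>b\<in>Z. a \<noteq> b \<longrightarrow> a - b \<notin> lattice)"

lemma lattice_diff_commute: "a - b \<in> lattice \<longleftrightarrow> b - a \<in> lattice"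
  using lattice_minus_iff[of "a - b"] by simp

lemma separated_Un:
  assumes "separated X" "separated Y" "\<And>a b. a \<in> X \<Longrightarrow> b \<in> Y \<Longrightarrow> a - b \<notin> lattice"
  shows "separated (X \<union> Y)" "card (X \<union> Y) = card X + card Y"
proof -
  show "separated (X \<union> Y)"
    using assms unfolding separated_def by (metis UnE finite_Un lattice_diff_commute)
  have "X \<inter> Y = {}" using assms(3) by fastforce
  then show "card (X \<union> Y) = card X + card Y"
    using assms by (simp add: card_Un_disjoint separated_def)
qed

lemma separated_image:
  assumes "finite I" "\<And>i j. i \<in> I \<Longrightarrow> j \<in> I \<Longrightarrow> i \<noteq> j \<Longrightarrow> f i - f j \<notin> lattice"
  shows "separated (f ` I)" "card (f ` I) = card I"
proof -
  show "separated (f ` I)" using assms by (auto simp: separated_def)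
  have "inj_on f I"
    by (rule inj_onI) (metis assms(2) cancel_comm_monoid_add_class.diff_cancel zero_in_lattice)
  then show "card (f ` I) = card I" by (rule card_image)
qed

lemma half_period_double: "h \<in> half_periods \<Longrightarrow> 2 * h \<in> lattice"
  using latticeI[of 0 1] latticeI[of 1 0] latticeI[of 1 1] by (auto simp: half_periods_def algebra_simps)

lemma double_lattice: "a \<in> lattice \<Longrightarrow> 2 * a \<in> lattice"
  using lattice_add[of a a] by simp

lemma separated_half_periods: "separated half_periods" "card half_periods = 4"
proof -
  have half: "of_real x * L + of_real y * (2 * of_real pi * \<i>) \<in> lattice \<Longrightarrow> x \<in> \<int> \<and> y \<in> \<int>" for x y
  proof -
    assume "of_real x * L + of_real y * (2 * of_real pi * \<i>) \<in> lattice"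
    then obtain j k :: int where eq: "of_real x * L + of_real y * (2 * of_real pi * \<i>) =
        of_int j * L + of_int k * (2 * of_real pi * \<i>)"
      unfolding lattice_def by blast
    from arg_cong[OF eq, of Re] Re_L have x: "x = of_int j" by simp
    with arg_cong[OF eq, of Im] have "y = of_int k" by simp
    with x show ?thesis by simp
  qed
  have int: "x = x'" if "x - x' \<in> \<int>" "x \<in> {0, 1/2}" "x' \<in> {0, 1/2}" for x x' :: real
  proof -
    from that(1) obtain k :: int where k: "x - x' = of_int k" by (auto elim: Ints_cases)
    have "2 * k \<noteq> 1" "2 * k \<noteq> -1" by presburger+
    then have "of_int (2 * k) \<noteq> (of_int 1 :: real)" "of_int (2 * k) \<noteq> (of_int (-1) :: real)"
      unfolding of_int_eq_iff by auto
    then show ?thesis using that(2,3) k by auto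
  qed
  let ?f = "\<lambda>(x, y). of_real x * L + of_real y * (2 * of_real pi * \<i>)"
  let ?I = "{0, 1/2} \<times> {0, 1/2} :: (real \<times> real) set"
  have sep: "?f a - ?f b \<notin> lattice" if "a \<in> ?I" "b \<in> ?I" "a \<noteq> b" for a b
  proof
    obtain x y x' y' where ab: "a = (x, y)" "b = (x', y')" by (metis surj_pair)
    assume "?f a - ?f b \<in> lattice"
    then have "of_real (x - x') * L + of_real (y - y') * (2 * of_real pi * \<i>) \<in> lattice"
      by (simp add: ab algebra_simps)
    from half[OF this] have "x = x'" "y = y'" using int that by (auto simp: ab)
    with that show False by (simp add: ab)
  qed
  have eq: "half_periods = ?f ` ?I"
    by (auto simp: half_periods_def)
  show "separated half_periods" "card half_periods = 4"
    unfolding eq using separated_image[of ?I ?f] sep by auto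
qed

end

section \<open>A sum over sign vectors\<close>

lemma index_pairs_Suc:
  "index_pairs 1 (Suc n) = index_pairs 1 n \<union> (\<lambda>i. (i, Suc n)) ` {1..n}"
  by (auto simp: index_pairs_def)

lemma prod_index_pairs_Suc:
  "(\<Prod>(i, j)\<in>index_pairs 1 (Suc n). f i j) = (\<Prod>(i, j)\<in>index_pairs 1 n. f i j) * (\<Prod>i=1..n. f i (Suc n))"
proof -
  have "index_pairs 1 n \<inter> (\<lambda>i. (i, Suc n)) ` {1..n} = {}"
    by (auto simp: index_pairs_def)
  moreover have "inj_on (\<lambda>i. (i, Suc n)) {1..n}"
    by (auto simp: inj_on_def)
  ultimately show ?thesis
    unfolding index_pairs_Suc
    by (subst prod.union_disjoint) (auto simp: finite_index_pairs prod.reindex)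
qed

lemma prod_index_pairs_split:
  assumes k: "k \<in> {1..n}" and sym: "\<And>i j. f i j = f j i"
  shows "(\<Prod>(i, j)\<in>index_pairs 1 n. f i j) =
    (\<Prod>(i, j)\<in>{(i, j)\<in>index_pairs 1 n. i \<noteq> k \<and> j \<noteq> k}. f i j) * (\<Prod>i\<in>{1..n} - {k}. f i k)"
proof -
  let ?A = "{(i, j)\<in>index_pairs 1 n. i \<noteq> k \<and> j \<noteq> k}"
  let ?g = "\<lambda>i. if i < k then (i, k) else (k, i)"
  have eq: "index_pairs 1 n = ?A \<union> ?g ` ({1..n} - {k})"
    using k by (auto simp: index_pairs_def image_iff)
  have disj: "?A \<inter> ?g ` ({1..n} - {k}) = {}"
    by auto
  have inj: "inj_on ?g ({1..n} - {k})"
    by (auto simp: inj_on_def split: if_splits)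
  have fin: "finite ?A" "finite (?g ` ({1..n} - {k}))"
    by (rule finite_subset[OF _ finite_index_pairs[of 1 n]]) auto
  let ?h = "\<lambda>(i, j). f i j"
  have "prod ?h (index_pairs 1 n) = prod ?h (?A \<union> ?g ` ({1..n} - {k}))"
    by (rule arg_cong[OF eq])
  also have "\<dots> = prod ?h ?A * prod ?h (?g ` ({1..n} - {k}))"
    by (rule prod.union_disjoint[OF fin disj])
  also have "prod ?h (?g ` ({1..n} - {k})) = prod (?h \<circ> ?g) ({1..n} - {k})"
    by (rule prod.reindex[OF inj])
  also have "?h \<circ> ?g = (\<lambda>i. f i k)"
    using sym by auto
  finally show ?thesis .
qed

lemma regroup_products:
  fixes c :: "'a::comm_ring_1"
  assumes "e * q = e' * q'" "v * u * x = v' * u' * x'"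
  shows "(v * c * e) * (u * (t * x) * q) = (v' * c * e') * (u' * (t * x') * q')"
proof -
  have "(v * c * e) * (u * (t * x) * q) = c * t * ((v * u * x) * (e * q))" by (simp add: mult_ac)
  also have "\<dots> = c * t * ((v' * u' * x') * (e' * q'))" by (simp only: assms)
  also have "\<dots> = (v' * c * e') * (u' * (t * x') * q')" by (simp add: mult_ac)
  finally show ?thesis .
qed

text \<open>Sign vectors are encoded as the sets of indices carrying a plus sign.\<close>

definition sg :: "nat set \<Rightarrow> nat \<Rightarrow> complex" where
  "sg S i = (if i \<in> S then 1 else -1)"

context theta_lattice
begin

definition vertex :: "complex \<Rightarrow> complex \<Rightarrow> complex \<Rightarrow> complex \<Rightarrow> complex \<Rightarrow> complex" where
  "vertex u0 u1 u2 u3 z = E (u0 + z) * E (u1 + z) * E (u2 + z) * E (u3 + z) / E (2 * z)"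

definition edge :: "complex \<Rightarrow> complex \<Rightarrow> complex \<Rightarrow> complex" where
  "edge \<tau> v z = E (\<tau> + v + z) / E (v + z)"

lemma edge_commute: "edge \<tau> v z = edge \<tau> z v"
  by (simp add: edge_def add_ac)

text \<open>The terms of the elliptic difference operator of type \<open>C\<close> applied to the constant function \<open>1\<close>.\<close>

definition signed_term where
  "signed_term n \<tau> u0 u1 u2 u3 w S =
     (\<Prod>i=1..n. vertex u0 u1 u2 u3 (sg S i * w i)) *
     (\<Prod>(i, j)\<in>index_pairs 1 n. edge \<tau> (sg S i * w i) (sg S j * w j))"

lemma signed_sum_Suc:
  "(\<Sum>S\<in>Pow {1..Suc n}. signed_term (Suc n) \<tau> u0 u1 u2 u3 w S) =
   (\<Sum>S\<in>Pow {1..n}. signed_term n \<tau> u0 u1 u2 u3 w S *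
      (vertex u0 u1 u2 u3 (w (Suc n)) * (\<Prod>i=1..n. edge \<tau> (sg S i * w i) (w (Suc n))) +
       vertex u0 u1 u2 u3 (- w (Suc n)) * (\<Prod>i=1..n. edge \<tau> (sg S i * w i) (- w (Suc n)))))"
  (is "_ = ?R")
proof -
  let ?V = "vertex u0 u1 u2 u3"
  let ?t = "signed_term (Suc n) \<tau> u0 u1 u2 u3 w"
  let ?P = "signed_term n \<tau> u0 u1 u2 u3 w"
  have Pow: "Pow {1..Suc n} = Pow {1..n} \<union> insert (Suc n) ` Pow {1..n}"
    by (simp add: atLeastAtMostSuc_conv Pow_insert)
  have inj: "inj_on (insert (Suc n)) (Pow {1..n})"
    by (rule inj_onI) (metis Pow_iff atLeastAtMost_iff insert_ident not_less_eq_eq order_refl subsetD)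
  have 1: "?t S = ?P S * (?V (- w (Suc n)) * (\<Prod>i=1..n. edge \<tau> (sg S i * w i) (- w (Suc n))))"
    if "S \<in> Pow {1..n}" for S
  proof -
    have "sg S (Suc n) = -1" using that by (auto simp: sg_def)
    then show ?thesis unfolding signed_term_def prod_index_pairs_Suc by simp
  qed
  have 2: "?t (insert (Suc n) S) = ?P S * (?V (w (Suc n)) * (\<Prod>i=1..n. edge \<tau> (sg S i * w i) (w (Suc n))))"
    if "S \<in> Pow {1..n}" for S
  proof -
    let ?S = "insert (Suc n) S"
    have sg: "sg ?S (Suc n) = 1" "\<And>i. i \<le> n \<Longrightarrow> sg ?S i = sg S i"
      by (auto simp: sg_def)
    have "(\<Prod>i=1..n. ?V (sg ?S i * w i)) = (\<Prod>i=1..n. ?V (sg S i * w i))"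
      "(\<Prod>(i, j)\<in>index_pairs 1 n. edge \<tau> (sg ?S i * w i) (sg ?S j * w j)) =
         (\<Prod>(i, j)\<in>index_pairs 1 n. edge \<tau> (sg S i * w i) (sg S j * w j))"
      "(\<Prod>i=1..n. edge \<tau> (sg ?S i * w i) (w (Suc n))) = (\<Prod>i=1..n. edge \<tau> (sg S i * w i) (w (Suc n)))"
      by (rule prod.cong; auto simp: index_pairs_def sg)+
    with sg(1) show ?thesis
      unfolding signed_term_def prod_index_pairs_Suc by simp
  qed
  have "(\<Sum>S\<in>Pow {1..Suc n}. ?t S) = (\<Sum>S\<in>Pow {1..n}. ?t S) + (\<Sum>S\<in>Pow {1..n}. ?t (insert (Suc n) S))"
    unfolding Pow by (subst sum.union_disjoint) (auto simp: sum.reindex[OF inj, simplified])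
  also have "\<dots> = (\<Sum>S\<in>Pow {1..n}. ?t S + ?t (insert (Suc n) S))"
    by (simp add: sum.distrib)
  also have "\<dots> = ?R"
    by (intro sum.cong refl) (simp only: 1 2 ring_distribs add.commute)
  finally show ?thesis .
qed

text \<open>The constant function is an eigenfunction of the difference operator: the sum does not depend on
the positions \<open>w\<close>.  The proof is by induction on \<open>n\<close>.  As a function of the last position \<open>z\<close>, the
difference of the two sides times the common denominator is an odd theta function \<open>G\<close> of degree
\<open>4 + 2 * n\<close> and characteristic \<open>0\<close> (this is where the relation between the \<open>u\<close>'s and \<open>\<tau>\<close> enters).
Oddness gives zeros at the four half periods.  At \<open>z = w k\<close> the terms that survive are the ones in
which the two equal positions carry opposite signs, and exchanging these signs cancels them in
pairs; oddness adds the zeros \<open>- w k\<close>.  These are only as many zeros as the degree.  One more is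
\<open>z = u0\<close>: there the sign \<open>-1\<close> of the last position is impossible, and the rest is the sum for \<open>n\<close>
with \<open>u0\<close> replaced by \<open>u0 + \<tau>\<close>.\<close>

theorem signed_sum:
  assumes "u0 + u1 + u2 + u3 + of_nat n * \<tau> = \<tau>"
    and "\<And>i. i \<in> {1..n} \<Longrightarrow> 2 * w i \<notin> lattice"
    and "\<And>i j. i \<in> {1..n} \<Longrightarrow> j \<in> {1..n} \<Longrightarrow> i \<noteq> j \<Longrightarrow> w i - w j \<notin> lattice \<and> w i + w j \<notin> lattice"
    and "\<And>k. k < n \<Longrightarrow> 2 * (u0 + of_nat k * \<tau>) \<notin> lattice"
    and "\<And>k i. k < n \<Longrightarrow> i \<in> {1..n} \<Longrightarrow>
            u0 + of_nat k * \<tau> + w i \<notin> lattice \<and> u0 + of_nat k * \<tau> - w i \<notin> lattice"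
  shows "(\<Sum>S\<in>Pow {1..n}. signed_term n \<tau> u0 u1 u2 u3 w S) =
    (\<Prod>k<n. E (u0 + u1 + of_nat k * \<tau>) * E (u0 + u2 + of_nat k * \<tau>) * E (u0 + u3 + of_nat k * \<tau>))"
  using assms
proof (induction n arbitrary: u0)
  case 0
  have "index_pairs 1 0 = {}" by (auto simp: index_pairs_def)
  then show ?case by (simp add: signed_term_def)
next
  case (Suc n)
  let ?V = "vertex u0 u1 u2 u3"
  define P where "P S = signed_term n \<tau> u0 u1 u2 u3 w S" for S
  define R where "R = (\<Prod>k<Suc n. E (u0 + u1 + of_nat k * \<tau>) * E (u0 + u2 + of_nat k * \<tau>) * E (u0 + u3 + of_nat k * \<tau>))"
  define K where "K S z = E (u0 + z) * E (u1 + z) * E (u2 + z) * E (u3 + z) *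
      (\<Prod>i=1..n. E (\<tau> + sg S i * w i + z) * E (z - sg S i * w i))" for S z
  define Den where "Den z = E (2 * z) * (\<Prod>i=1..n. E (z + w i) * E (z - w i))" for z
  define D where "D = 4 + 2 * n"
  define G where "G z = (\<Sum>S\<in>Pow {1..n}. P S * (K S z - K S (- z))) - R * Den z" for z
  define F where "F z = (\<Sum>S\<in>Pow {1..n}. P S *
      (?V z * (\<Prod>i=1..n. edge \<tau> (sg S i * w i) z) +
       ?V (- z) * (\<Prod>i=1..n. edge \<tau> (sg S i * w i) (- z))))" for z
  note sums = Suc.prems(1)
  have w2: "2 * w i \<notin> lattice" if "i \<in> {1..n}" for i
    using Suc.prems(2)[of i] that by auto
  have wd: "w i - w j \<notin> lattice" "w i + w j \<notin> lattice" if "i \<in> {1..n}" "j \<in> {1..n}" "i \<noteq> j" for i j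
    using Suc.prems(3)[of i j] that by auto
  have sgc: "sg S i = 1 \<or> sg S i = -1" for S i by (simp add: sg_def)
  \<comment> \<open>an edge cancels the one of \<open>E (z + w i)\<close> and \<open>E (z - w i)\<close> selected by the sign of \<open>w i\<close>\<close>
  have clear: "?V z * (\<Prod>i=1..n. edge \<tau> (sg S i * w i) z) * Den z = K S z"
    if z: "Den z \<noteq> 0" for S z
  proof -
    have E2: "E (2 * z) \<noteq> 0" using z by (auto simp: Den_def)
    have "edge \<tau> (sg S i * w i) z * (E (z + w i) * E (z - w i)) =
            E (\<tau> + sg S i * w i + z) * E (z - sg S i * w i)" if "i \<in> {1..n}" for i
    proof -
      have "E (z + w i) \<noteq> 0" "E (z - w i) \<noteq> 0"
        using z that by (auto simp: Den_def)
      then show ?thesis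
        using sgc[of S i] by (auto simp: edge_def add_ac)
    qed
    then have "(\<Prod>i=1..n. edge \<tau> (sg S i * w i) z) * (\<Prod>i=1..n. E (z + w i) * E (z - w i)) =
        (\<Prod>i=1..n. E (\<tau> + sg S i * w i + z) * E (z - sg S i * w i))"
      unfolding prod.distrib[symmetric] by (intro prod.cong refl)
    moreover have "?V z * E (2 * z) = E (u0 + z) * E (u1 + z) * E (u2 + z) * E (u3 + z)"
      using E2 by (simp add: vertex_def)
    moreover have "v * e * (b * d) = (v * b) * (e * d)" for v e b d :: complex
      by simp
    ultimately show ?thesis
      unfolding Den_def K_def by (simp only:)
  qed
  have Den_odd: "Den (- z) = - Den z" for z
  proof -
    have "E (- z + w i) * E (- z - w i) = E (z + w i) * E (z - w i)" for i
      using E_minus[of "z - w i"] E_minus[of "z + w i"] by (simp add: mult_ac)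
    then show ?thesis using E_minus[of "2 * z"] by (simp add: Den_def)
  qed
  have G_eq: "G z = Den z * (F z - R)"
    if z: "Den z \<noteq> 0" for z
  proof -
    have "Den (- z) \<noteq> 0" using z by (simp add: Den_odd)
    note c = clear[OF z] clear[OF this]
    have "P S * (K S z - K S (- z)) = Den z * (P S *
      (?V z * (\<Prod>i=1..n. edge \<tau> (sg S i * w i) z) +
       ?V (- z) * (\<Prod>i=1..n. edge \<tau> (sg S i * w i) (- z))))" for S
      by (subst c(1)[symmetric], subst c(2)[symmetric]) (simp add: Den_odd algebra_simps)
    then show ?thesis
      unfolding G_def F_def by (simp add: sum_distrib_left right_diff_distrib mult.commute[of R])
  qed
  have "quasi_periodic D 0 (K S)" for S
  proof -
    have "quasi_periodic (1 + 1 + 1 + 1 + card {1..n} * (1 + 1))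
         (u0 + u1 + u2 + u3 + of_nat (card {1..n}) * \<tau>) (K S)"
      unfolding K_def
    proof (intro quasi_periodic_mult quasi_periodic_E quasi_periodic_prod)
      fix i
      have "quasi_periodic (1 + 1) (\<tau> + sg S i * w i + - (sg S i * w i))
         (\<lambda>z. E (\<tau> + sg S i * w i + z) * E (z - sg S i * w i))"
        by (intro quasi_periodic_mult quasi_periodic_E quasi_periodic_E')
      then show "quasi_periodic (1 + 1) \<tau> (\<lambda>z. E (\<tau> + sg S i * w i + z) * E (z - sg S i * w i))"
        by simp
    qed auto
    moreover have "u0 + u1 + u2 + u3 + of_nat n * \<tau> = 0"
      using sums by (simp add: algebra_simps)
    moreover have "1 + 1 + 1 + 1 + card {1..n} * (1 + 1) = D" by (simp add: D_def)
    ultimately show ?thesis by simp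
  qed
  then have K_refl: "quasi_periodic D 0 (\<lambda>z. K S (- z))" and K: "quasi_periodic D 0 (K S)" for S
    using quasi_periodic_reflect[of D "K S"] by (auto simp: D_def)
  have Den: "quasi_periodic D 0 Den"
  proof -
    have "quasi_periodic (4 + card {1..n} * (1 + 1)) (0 + of_nat (card {1..n}) * 0) Den"
      unfolding Den_def
    proof (intro quasi_periodic_mult quasi_periodic_E_double quasi_periodic_prod)
      fix i
      have "quasi_periodic (1 + 1) (w i + - w i) (\<lambda>z. E (w i + z) * E (z - w i))"
        by (intro quasi_periodic_mult quasi_periodic_E quasi_periodic_E')
      then show "quasi_periodic (1 + 1) 0 (\<lambda>z. E (z + w i) * E (z - w i))"
        by (simp add: add.commute)
    qed auto
    moreover have "4 + card {1..n} * (1 + 1) = D" by (simp add: D_def)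
    ultimately show ?thesis by simp
  qed
  have G: "quasi_periodic D 0 G"
    unfolding G_def
    by (intro quasi_periodic_diff quasi_periodic_sum quasi_periodic_cmult K K_refl Den) auto
  have G_odd: "G (- z) = - G z" for z
    by (simp add: G_def Den_odd algebra_simps sum_subtractf)
  have zero_w: "G (w k) = 0" if k: "k \<in> {1..n}" for k
  proof -
    let ?z = "w k"
    have K0: "K S ?z = 0" if "k \<in> S" for S
    proof -
      have "(\<Prod>i=1..n. E (\<tau> + sg S i * w i + ?z) * E (?z - sg S i * w i)) = 0"
        using k that by (intro prod_zero) (auto intro!: bexI[of _ k] simp: sg_def)
      then show ?thesis by (simp add: K_def)
    qed
    have K0': "K S (- ?z) = 0" if "k \<notin> S" for S
    proof -
      have "(\<Prod>i=1..n. E (\<tau> + sg S i * w i + (- ?z)) * E (- ?z - sg S i * w i)) = 0"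
        using k that by (intro prod_zero) (auto intro!: bexI[of _ k] simp: sg_def)
      then show ?thesis by (simp add: K_def)
    qed
    \<comment> \<open>this is the cancellation of the poles at equal positions\<close>
    have swap: "P S * K S ?z = P (insert k S) * K (insert k S) (- ?z)" if S: "k \<notin> S" for S
    proof -
      let ?S = "insert k S" and ?I = "{1..n} - {k}"
      let ?A = "{(i, j)\<in>index_pairs 1 n. i \<noteq> k \<and> j \<noteq> k}"
      define c where "c = (\<Prod>i\<in>?I. ?V (sg S i * w i)) *
         (\<Prod>(i, j)\<in>?A. edge \<tau> (sg S i * w i) (sg S j * w j))"
      have sgi: "sg ?S i = sg S i" if "i \<noteq> k" for i using that by (simp add: sg_def)
      have sgk: "sg S k = -1" "sg ?S k = 1" using S by (auto simp: sg_def)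
      have P_split: "P T = ?V (sg T k * ?z) * c * (\<Prod>i\<in>?I. edge \<tau> (sg S i * w i) (sg T k * ?z))"
        if "\<And>i. i \<noteq> k \<Longrightarrow> sg T i = sg S i" for T
      proof -
        have "(\<Prod>i=1..n. ?V (sg T i * w i)) =
            ?V (sg T k * ?z) * (\<Prod>i\<in>?I. ?V (sg S i * w i))"
          using k by (subst prod.remove[of _ k]) (auto simp: that)
        moreover have "(\<Prod>(i, j)\<in>index_pairs 1 n. edge \<tau> (sg T i * w i) (sg T j * w j)) =
           (\<Prod>(i, j)\<in>?A. edge \<tau> (sg T i * w i) (sg T j * w j)) *
           (\<Prod>i\<in>?I. edge \<tau> (sg T i * w i) (sg T k * ?z))"
          by (rule prod_index_pairs_split[OF k]) (rule edge_commute)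
        moreover have "(\<Prod>(i, j)\<in>?A. edge \<tau> (sg T i * w i) (sg T j * w j)) =
             (\<Prod>(i, j)\<in>?A. edge \<tau> (sg S i * w i) (sg S j * w j))"
          by (intro prod.cong refl) (auto simp: that)
        moreover have "(\<Prod>i\<in>?I. edge \<tau> (sg T i * w i) (sg T k * ?z)) =
             (\<Prod>i\<in>?I. edge \<tau> (sg S i * w i) (sg T k * ?z))"
          by (intro prod.cong refl) (auto simp: that)
        ultimately show ?thesis
          by (simp add: P_def signed_term_def c_def mult_ac)
      qed
      have K_split: "K T y = E (u0 + y) * E (u1 + y) * E (u2 + y) * E (u3 + y) *
          (E (\<tau> + sg T k * ?z + y) * E (y - sg T k * ?z)) *
          (\<Prod>i\<in>?I. E (\<tau> + sg S i * w i + y) * E (y - sg S i * w i))"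
        if "\<And>i. i \<noteq> k \<Longrightarrow> sg T i = sg S i" for T y
      proof -
        have "(\<Prod>i=1..n. E (\<tau> + sg T i * w i + y) * E (y - sg T i * w i)) =
          (E (\<tau> + sg T k * ?z + y) * E (y - sg T k * ?z)) *
          (\<Prod>i\<in>?I. E (\<tau> + sg S i * w i + y) * E (y - sg S i * w i))"
          using k by (subst prod.remove[of _ k]) (auto simp: that)
        then show ?thesis by (simp add: K_def mult_ac)
      qed
      have E2: "E (2 * ?z) \<noteq> 0" "E (- (2 * ?z)) = - E (2 * ?z)"
        using w2[OF k] E_eq_0_iff E_minus by auto
      have edges: "(\<Prod>i\<in>?I. edge \<tau> (sg S i * w i) (- ?z)) * (\<Prod>i\<in>?I. E (\<tau> + sg S i * w i + ?z) * E (?z - sg S i * w i))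
          = (\<Prod>i\<in>?I. edge \<tau> (sg S i * w i) ?z) * (\<Prod>i\<in>?I. E (\<tau> + sg S i * w i - ?z) * E (- ?z - sg S i * w i))"
        unfolding prod.distrib[symmetric]
      proof (intro prod.cong refl)
        fix i assume i: "i \<in> ?I"
        let ?v = "sg S i * w i"
        have "E (?z - ?v) = - E (?v - ?z)" "E (- ?z - ?v) = - E (?v + ?z)"
          using E_minus[of "?v - ?z"] E_minus[of "?z + ?v"] by (simp_all add: add.commute[of ?v ?z])
        moreover have "E (?v - ?z) \<noteq> 0" "E (?v + ?z) \<noteq> 0"
          using wd[of i k] wd[of k i] i k sgc[of S i] lattice_minus_iff[of "w i + w k"]
          by (auto simp: E_eq_0_iff lattice_diff_commute)
        ultimately show "edge \<tau> ?v (- ?z) * (E (\<tau> + ?v + ?z) * E (?z - ?v)) =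
            edge \<tau> ?v ?z * (E (\<tau> + ?v - ?z) * E (- ?z - ?v))"
          by (simp add: edge_def)
      qed
      have vertices: "?V (- ?z) * (E (u0 + ?z) * E (u1 + ?z) * E (u2 + ?z) * E (u3 + ?z)) * E (2 * ?z)
           = ?V ?z * (E (u0 - ?z) * E (u1 - ?z) * E (u2 - ?z) * E (u3 - ?z)) * E (- (2 * ?z))"
        using E2 by (simp add: vertex_def)
      have P1: "P S = ?V (- ?z) * c * (\<Prod>i\<in>?I. edge \<tau> (sg S i * w i) (- ?z))"
        using P_split[of S] by (simp add: sgk)
      have P2: "P ?S = ?V ?z * c * (\<Prod>i\<in>?I. edge \<tau> (sg S i * w i) ?z)"
        using P_split[of ?S] sgi by (simp add: sgk)
      have K1: "K S ?z = E (u0 + ?z) * E (u1 + ?z) * E (u2 + ?z) * E (u3 + ?z) * (E \<tau> * E (2 * ?z)) *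
          (\<Prod>i\<in>?I. E (\<tau> + sg S i * w i + ?z) * E (?z - sg S i * w i))"
        using K_split[of S ?z] by (simp add: sgk)
      have K2: "K ?S (- ?z) = E (u0 - ?z) * E (u1 - ?z) * E (u2 - ?z) * E (u3 - ?z) * (E \<tau> * E (- (2 * ?z))) *
          (\<Prod>i\<in>?I. E (\<tau> + sg S i * w i - ?z) * E (- ?z - sg S i * w i))"
        using K_split[of ?S "- ?z"] sgi by (simp add: sgk)
      show ?thesis
        unfolding P1 P2 K1 K2 by (rule regroup_products[OF edges vertices])
    qed
    have "(\<Sum>S\<in>Pow {1..n}. P S * K S ?z) = (\<Sum>S\<in>{S\<in>Pow {1..n}. k \<notin> S}. P S * K S ?z)"
      by (rule sum.mono_neutral_right) (auto simp: K0)
    also have "\<dots> = (\<Sum>S\<in>{S\<in>Pow {1..n}. k \<in> S}. P S * K S (- ?z))"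
      by (rule sum.reindex_bij_witness[of _ "\<lambda>S. S - {k}" "insert k"])
         (use k swap in \<open>auto simp: insert_absorb\<close>)
    also have "\<dots> = (\<Sum>S\<in>Pow {1..n}. P S * K S (- ?z))"
      by (rule sum.mono_neutral_left) (auto simp: K0')
    finally have "(\<Sum>S\<in>Pow {1..n}. P S * (K S ?z - K S (- ?z))) = 0"
      by (simp add: right_diff_distrib sum_subtractf)
    moreover have "Den ?z = 0"
    proof -
      have "(\<Prod>i=1..n. E (?z + w i) * E (?z - w i)) = 0"
        using k by (intro prod_zero) (auto intro!: bexI[of _ k])
      then show ?thesis by (simp add: Den_def)
    qed
    ultimately show ?thesis by (simp add: G_def)
  qed
  have u0_2: "2 * u0 \<notin> lattice" using Suc.prems(4)[of 0] by simp
  have u0_w: "u0 + w i \<notin> lattice" "u0 - w i \<notin> lattice" if "i \<in> {1..Suc n}" for i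
    using Suc.prems(5)[of 0 i] that by auto
  have Den_u0: "Den u0 \<noteq> 0"
    using u0_2 u0_w by (auto simp: Den_def E_eq_0_iff)
  have zero_u0: "G u0 = 0"
  proof -
    have IH: "(\<Sum>S\<in>Pow {1..n}. signed_term n \<tau> (u0 + \<tau>) u1 u2 u3 w S) =
      (\<Prod>k<n. E (u0 + \<tau> + u1 + of_nat k * \<tau>) * E (u0 + \<tau> + u2 + of_nat k * \<tau>) * E (u0 + \<tau> + u3 + of_nat k * \<tau>))"
    proof (rule Suc.IH)
      show "u0 + \<tau> + u1 + u2 + u3 + of_nat n * \<tau> = \<tau>"
        using sums by (simp add: algebra_simps)
      show "2 * (u0 + \<tau> + of_nat k * \<tau>) \<notin> lattice" if "k < n" for k
        using Suc.prems(4)[of "Suc k"] that by (simp add: algebra_simps)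
      show "u0 + \<tau> + of_nat k * \<tau> + w i \<notin> lattice \<and> u0 + \<tau> + of_nat k * \<tau> - w i \<notin> lattice"
        if "k < n" "i \<in> {1..n}" for k i
        using Suc.prems(5)[of "Suc k" i] that by (simp add: algebra_simps)
    qed (use w2 wd in auto)
    have "signed_term n \<tau> (u0 + \<tau>) u1 u2 u3 w S = P S * (\<Prod>i=1..n. edge \<tau> (sg S i * w i) u0)" for S
    proof -
      have "vertex (u0 + \<tau>) u1 u2 u3 (sg S i * w i) = ?V (sg S i * w i) * edge \<tau> (sg S i * w i) u0"
        if "i \<in> {1..n}" for i
      proof -
        have "E (u0 + sg S i * w i) \<noteq> 0"
          using u0_w[of i] that sgc[of S i] by (auto simp: E_eq_0_iff)
        then show ?thesis by (simp add: vertex_def edge_def add_ac)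
      qed
      then show ?thesis by (simp add: P_def signed_term_def prod.distrib mult_ac)
    qed
    then have "(\<Sum>S\<in>Pow {1..n}. P S * (\<Prod>i=1..n. edge \<tau> (sg S i * w i) u0)) =
      (\<Prod>k<n. E (u0 + \<tau> + u1 + of_nat k * \<tau>) * E (u0 + \<tau> + u2 + of_nat k * \<tau>) * E (u0 + \<tau> + u3 + of_nat k * \<tau>))"
      using IH by simp
    moreover have "?V u0 * (\<Prod>k<n. E (u0 + \<tau> + u1 + of_nat k * \<tau>) *
        E (u0 + \<tau> + u2 + of_nat k * \<tau>) * E (u0 + \<tau> + u3 + of_nat k * \<tau>)) = R"
    proof -
      have "?V u0 = E (u0 + u1) * E (u0 + u2) * E (u0 + u3)"
        using u0_2 by (simp add: vertex_def E_eq_0_iff add.commute)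
      then show ?thesis
        unfolding R_def by (subst prod.lessThan_Suc_shift) (simp add: algebra_simps)
    qed
    moreover have "?V (- u0) = 0"
      by (simp add: vertex_def)
    moreover have "(\<Sum>S\<in>Pow {1..n}. P S * (?V u0 * (\<Prod>i=1..n. edge \<tau> (sg S i * w i) u0))) =
        ?V u0 * (\<Sum>S\<in>Pow {1..n}. P S * (\<Prod>i=1..n. edge \<tau> (sg S i * w i) u0))"
      unfolding sum_distrib_left by (simp only: mult.left_commute)
    ultimately show ?thesis
      unfolding G_eq[OF Den_u0] F_def by simp
  qed
  \<comment> \<open>\<open>4 + n + n + 1\<close> incongruent zeros, one more than the degree\<close>
  define Z where "Z = (half_periods \<union> w ` {1..n}) \<union> (\<lambda>i. - w i) ` {1..n} \<union> {u0}"
  have G0: "G z = 0" if "z \<in> Z" for z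
    using that zero_w zero_u0 odd_quasi_periodic_half_periods[OF G _ G_odd] G_odd
    by (auto simp: Z_def D_def)
  have not_half: "h - x \<notin> lattice" "x - h \<notin> lattice" if "h \<in> half_periods" "2 * x \<notin> lattice" for h x
  proof -
    have "2 * x = 2 * h - 2 * (h - x)" by simp
    then show "h - x \<notin> lattice"
      using lattice_diff[OF half_period_double[OF that(1)] double_lattice] that(2) by metis
    then show "x - h \<notin> lattice" by (simp add: lattice_diff_commute)
  qed
  have w_minus: "w i + w j \<notin> lattice" if "i \<in> {1..n}" "j \<in> {1..n}" for i j
    using w2[OF that(1)] wd[OF that] by (cases "i = j") auto
  have sw: "separated (w ` {1..n})" "card (w ` {1..n}) = n"
    using separated_image[of "{1..n}" w] wd by auto
  have cross1: "a - b \<notin> lattice" if "a \<in> half_periods" "b \<in> w ` {1..n}" for a b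
    using that w2 not_half(1) by blast
  note s1 = separated_Un[OF separated_half_periods(1) sw(1) cross1]
  have sm: "separated ((\<lambda>i. - w i) ` {1..n})" "card ((\<lambda>i. - w i) ` {1..n}) = n"
    using separated_image[of "{1..n}" "\<lambda>i. - w i"] wd by (auto simp: lattice_diff_commute)
  have nh: "h + w i \<notin> lattice" if "h \<in> half_periods" "i \<in> {1..n}" for h i
    using not_half(1)[OF that(1), of "- w i"] w2[OF that(2)] lattice_minus_iff[of "2 * w i"] by simp
  have cross2: "a - b \<notin> lattice" if "a \<in> half_periods \<union> w ` {1..n}" "b \<in> (\<lambda>i. - w i) ` {1..n}" for a b
    using that w_minus nh by fastforce
  note s2 = separated_Un[OF s1(1) sm(1) cross2]
  have su: "separated {u0}" by (simp add: separated_def)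
  have cross: "a - b \<notin> lattice" if "a \<in> half_periods \<union> w ` {1..n} \<union> (\<lambda>i. - w i) ` {1..n}" "b \<in> {u0}" for a b
  proof -
    have "- w i - u0 \<notin> lattice" "w i - u0 \<notin> lattice" if "i \<in> {1..n}" for i
      using u0_w[of i] that lattice_minus_iff[of "u0 + w i"] by (auto simp: lattice_diff_commute)
    then show ?thesis using that not_half(1) u0_2 by auto
  qed
  have Z: "separated Z" "card Z = Suc D"
    using separated_Un[OF s2(1) su cross] s2(2) s1(2) sw(2) sm(2) separated_half_periods(2)
    by (auto simp: Z_def D_def)
  have "G z = 0" for z
  proof (rule quasi_periodic_eq_0[where G = G and w = z and D = D and Z = Z and c = "- of_nat D * (L / 2)"])
    show "G holomorphic_on UNIV" using G by (simp add: quasi_periodic_def)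
    show "norm (G (w + 2 * of_real pi * \<i>)) = norm (G w)" for w
      using G by (simp add: quasi_periodic_def norm_mult norm_power)
    show "norm (G (w + L)) = norm (exp (- of_nat D * (L / 2) - of_nat D * w)) * norm (G w)" for w
      using G by (simp add: quasi_periodic_def norm_mult norm_power algebra_simps)
  qed (use Z G0 in \<open>auto simp: separated_def\<close>)
  moreover have "Den (w (Suc n)) \<noteq> 0"
    using Suc.prems(2)[of "Suc n"] Suc.prems(3)[of "Suc n"]
    by (auto simp: Den_def E_eq_0_iff)
  ultimately have "F (w (Suc n)) = R"
    using G_eq[of "w (Suc n)"] by simp
  then show ?case
    unfolding signed_sum_Suc R_def P_def F_def .
qed

section \<open>Detailed balance between two lattices\<close>

definition Efact :: "complex \<Rightarrow> complex \<Rightarrow> nat \<Rightarrow> complex" where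
  "Efact \<kappa> z k = (\<Prod>i<k. E (z + of_nat i * \<kappa>))"

lemma Efact_0 [simp]: "Efact \<kappa> z 0 = 1"
  by (simp add: Efact_def)

lemma Efact_Suc: "Efact \<kappa> z (Suc k) = Efact \<kappa> z k * E (z + of_nat k * \<kappa>)"
  by (simp add: Efact_def)

lemma Efact_Suc_shift: "Efact \<kappa> z (Suc k) = E z * Efact \<kappa> (z + \<kappa>) k"
  unfolding Efact_def by (subst prod.lessThan_Suc_shift) (simp add: algebra_simps)

lemma Efact_nonzero: "(\<And>i. i < k \<Longrightarrow> E (z + of_nat i * \<kappa>) \<noteq> 0) \<Longrightarrow> Efact \<kappa> z k \<noteq> 0"
  by (simp add: Efact_def)

definition pair_factor :: "complex \<Rightarrow> complex \<Rightarrow> complex \<Rightarrow> nat \<Rightarrow> complex" where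
  "pair_factor \<kappa> \<tau> z k = E (z + of_nat k * \<kappa>) / E z * (Efact \<kappa> (\<tau> + z) k / Efact \<kappa> (\<kappa> - \<tau> + z) k)"

text \<open>The part of the weight ratio of a pair that depends on neither occupation number.\<close>

definition pair_shift :: "complex \<Rightarrow> complex \<Rightarrow> complex \<Rightarrow> complex" where
  "pair_shift \<kappa> \<tau> z = E (z + \<kappa>) * E (\<tau> + z) / (E z * E (\<kappa> - \<tau> + z))"

text \<open>The ratio of consecutive values is a quotient of two edges.  This is why the pair weights and the
edges of the sign sum fit together.\<close>

lemma pair_factor_step:
  assumes "E (z + of_nat k * \<kappa>) \<noteq> 0" "E (z + of_nat (Suc k) * \<kappa>) \<noteq> 0"
    "E (\<kappa> - \<tau> + z + of_nat k * \<kappa>) \<noteq> 0"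
    and v: "v + v' = - (z + of_nat (Suc k) * \<kappa>)" and w: "w + w' = z + of_nat k * \<kappa>"
  shows "pair_factor \<kappa> \<tau> z (Suc k) * edge \<tau> v v' = pair_factor \<kappa> \<tau> z k * edge \<tau> w w'"
proof -
  have "\<tau> + v + v' = - (\<kappa> - \<tau> + z + of_nat k * \<kappa>)"
    by (simp add: add.assoc v) (simp add: algebra_simps)
  then have "E (\<tau> + v + v') = - E (\<kappa> - \<tau> + z + of_nat k * \<kappa>)"
    by (simp only: E_minus)
  moreover have "E (v + v') = - E (z + of_nat (Suc k) * \<kappa>)"
    unfolding v by (rule E_minus)
  moreover have "E (\<tau> + w + w') = E (\<tau> + z + of_nat k * \<kappa>)" "E (w + w') = E (z + of_nat k * \<kappa>)"
    using w by (simp_all add: add.assoc)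
  ultimately show ?thesis
    unfolding pair_factor_def edge_def Efact_Suc using assms(1-3) by simp
qed

lemma pair_factor_shift:
  assumes "E (z + \<kappa>) \<noteq> 0"
  shows "pair_factor \<kappa> \<tau> z (Suc k) = pair_shift \<kappa> \<tau> z * pair_factor \<kappa> \<tau> (z + \<kappa>) k"
proof -
  have eq: "\<kappa> - \<tau> + (z + \<kappa>) = \<kappa> - \<tau> + z + \<kappa>" "\<tau> + (z + \<kappa>) = \<tau> + z + \<kappa>"
    "z + of_nat (Suc k) * \<kappa> = z + \<kappa> + of_nat k * \<kappa>"
    by (simp_all add: algebra_simps)
  show ?thesis
    unfolding pair_factor_def pair_shift_def Efact_Suc_shift eq using assms by simp
qed

definition param_factor :: "complex \<Rightarrow> complex \<Rightarrow> complex \<Rightarrow> nat \<Rightarrow> complex" where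
  "param_factor \<kappa> a \<xi> k = Efact \<kappa> (a + \<xi>) k / Efact \<kappa> (\<kappa> - a + \<xi>) k"

text \<open>Three parameters move up by \<open>\<eta>\<close> and three move down when the base point \<open>\<xi>\<close> moves up by \<open>\<eta>\<close>.  In the
first case the factor of the sign sum at the upper lattice point is absorbed, in the second the
factor at the lower one appears.\<close>

lemma param_factor_up:
  assumes nz: "E (2 * \<eta> - a + \<xi> + of_nat \<mu> * (2 * \<eta>)) \<noteq> 0"
    and s: "s = 1 \<and> \<nu> = Suc \<mu> \<or> s = -1 \<and> \<nu> = \<mu>"
  shows "param_factor (2 * \<eta>) a \<xi> \<nu> * E (a - s * (\<xi> + of_nat \<nu> * (2 * \<eta>))) =
         - s * E (a + \<xi>) * param_factor (2 * \<eta>) (a + \<eta>) (\<xi> + \<eta>) \<mu>"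
proof -
  have eq: "a + \<eta> + (\<xi> + \<eta>) = a + \<xi> + 2 * \<eta>" "2 * \<eta> - (a + \<eta>) + (\<xi> + \<eta>) = 2 * \<eta> - a + \<xi>"
    by simp_all
  have E1: "Efact (2 * \<eta>) (a + \<xi>) \<mu> * E (a + \<xi> + of_nat \<mu> * (2 * \<eta>)) = E (a + \<xi>) * Efact (2 * \<eta>) (a + \<xi> + 2 * \<eta>) \<mu>"
    by (metis Efact_Suc Efact_Suc_shift)
  from s show ?thesis
  proof (elim disjE conjE)
    assume s1: "s = 1" "\<nu> = Suc \<mu>"
    have "E (a - (\<xi> + of_nat (Suc \<mu>) * (2 * \<eta>))) = - E (2 * \<eta> - a + \<xi> + of_nat \<mu> * (2 * \<eta>))"
      using E_minus[of "2 * \<eta> - a + \<xi> + of_nat \<mu> * (2 * \<eta>)"] by (simp add: algebra_simps)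
    then show ?thesis
      using nz E1 unfolding s1 param_factor_def eq Efact_Suc by simp
  next
    assume s1: "s = -1" "\<nu> = \<mu>"
    have x: "a - (-1) * (\<xi> + of_nat \<mu> * (2 * \<eta>)) = a + \<xi> + of_nat \<mu> * (2 * \<eta>)" by simp
    show ?thesis
      unfolding s1 x param_factor_def eq using E1 by simp
  qed
qed

lemma param_factor_down:
  assumes nz: "\<And>i. E (2 * \<eta> - a + \<xi> + of_nat i * (2 * \<eta>)) \<noteq> 0"
    and s: "s = 1 \<and> \<nu> = Suc \<mu> \<or> s = -1 \<and> \<nu> = \<mu>"
  shows "param_factor (2 * \<eta>) a \<xi> \<nu> =
         s * param_factor (2 * \<eta>) (a - \<eta>) (\<xi> + \<eta>) \<mu> * E (a - \<eta> + s * (\<xi> + \<eta> + of_nat \<mu> * (2 * \<eta>))) / E (2 * \<eta> - a + \<xi>)"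
proof -
  have eq: "a - \<eta> + (\<xi> + \<eta>) = a + \<xi>" "2 * \<eta> - (a - \<eta>) + (\<xi> + \<eta>) = 2 * \<eta> - a + \<xi> + 2 * \<eta>"
    by simp_all
  have E1: "Efact (2 * \<eta>) (2 * \<eta> - a + \<xi>) \<mu> * E (2 * \<eta> - a + \<xi> + of_nat \<mu> * (2 * \<eta>)) =
      E (2 * \<eta> - a + \<xi>) * Efact (2 * \<eta>) (2 * \<eta> - a + \<xi> + 2 * \<eta>) \<mu>"
    by (metis Efact_Suc Efact_Suc_shift)
  have nzf: "Efact (2 * \<eta>) (2 * \<eta> - a + \<xi>) k \<noteq> 0" for k
    using nz by (intro Efact_nonzero)
  have nz0: "E (2 * \<eta> - a + \<xi>) \<noteq> 0" using nz[of 0] by simp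
  have nzs: "Efact (2 * \<eta>) (2 * \<eta> - a + \<xi> + 2 * \<eta>) \<mu> \<noteq> 0"
    using nzf[of "Suc \<mu>"] by (simp add: Efact_Suc_shift)
  from s show ?thesis
  proof (elim disjE conjE)
    assume s1: "s = 1" "\<nu> = Suc \<mu>"
    have x: "a - \<eta> + 1 * (\<xi> + \<eta> + of_nat \<mu> * (2 * \<eta>)) = a + \<xi> + of_nat \<mu> * (2 * \<eta>)" by simp
    have den: "Efact (2 * \<eta>) (2 * \<eta> - a + \<xi>) (Suc \<mu>) = E (2 * \<eta> - a + \<xi>) * Efact (2 * \<eta>) (2 * \<eta> - a + \<xi> + 2 * \<eta>) \<mu>"
      by (rule Efact_Suc_shift)
    show ?thesis
      unfolding s1 x param_factor_def eq den Efact_Suc[of _ "a + \<xi>"] by simp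
  next
    assume s1: "s = -1" "\<nu> = \<mu>"
    have "E (a - \<eta> + (-1) * (\<xi> + \<eta> + of_nat \<mu> * (2 * \<eta>))) = - E (2 * \<eta> - a + \<xi> + of_nat \<mu> * (2 * \<eta>))"
      using E_minus[of "2 * \<eta> - a + \<xi> + of_nat \<mu> * (2 * \<eta>)"] by (simp add: algebra_simps)
    then show ?thesis
      unfolding s1 param_factor_def eq using E1 nzf nz0 nzs by (simp add: field_simps)
  qed
qed

definition site :: "nat \<Rightarrow> complex \<Rightarrow> complex \<Rightarrow> nat \<Rightarrow> complex" where
  "site n \<tau> a i = a + of_nat (n - i) * \<tau>"

definition site_weight :: "complex \<Rightarrow> (nat \<Rightarrow> complex) \<Rightarrow> complex \<Rightarrow> nat \<Rightarrow> complex" where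
  "site_weight \<kappa> \<alpha> \<xi> k = E (2 * (\<xi> + of_nat k * \<kappa>)) / E (2 * \<xi>) * (\<Prod>m=1..6. param_factor \<kappa> (\<alpha> m) \<xi> k)"

definition pair_weight :: "complex \<Rightarrow> complex \<Rightarrow> complex \<Rightarrow> complex \<Rightarrow> nat \<Rightarrow> nat \<Rightarrow> complex" where
  "pair_weight \<kappa> \<tau> \<xi> \<xi>' k k' = pair_factor \<kappa> \<tau> (\<xi> - \<xi>') (k - k') * pair_factor \<kappa> \<tau> (\<xi> + \<xi>') (k + k')"

definition weight :: "nat \<Rightarrow> complex \<Rightarrow> complex \<Rightarrow> (nat \<Rightarrow> complex) \<Rightarrow> (nat \<Rightarrow> nat) \<Rightarrow> complex" where
  "weight n \<kappa> \<tau> \<alpha> \<nu> = (\<Prod>i=1..n. site_weight \<kappa> \<alpha> (site n \<tau> (\<alpha> 1) i) (\<nu> i)) *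
     (\<Prod>(j, k)\<in>index_pairs 1 n. pair_weight \<kappa> \<tau> (site n \<tau> (\<alpha> 1) j) (site n \<tau> (\<alpha> 1) k) (\<nu> j) (\<nu> k))"

text \<open>The indices \<open>2, 3, 4\<close> are those in which the closed form is symmetric; the truncation involves \<open>1\<close>
and \<open>6\<close>, which both move up and so lower the length of the sum by one.  The balancing condition
then forces the index \<open>5\<close> up as well.\<close>

definition shift_params :: "complex \<Rightarrow> (nat \<Rightarrow> complex) \<Rightarrow> nat \<Rightarrow> complex" where
  "shift_params \<eta> \<alpha> m = (if m \<in> {2..4} then \<alpha> m - \<eta> else \<alpha> m + \<eta>)"

lemma prod_1_6: "(\<Prod>m=1..6. f m) = f 1 * f 2 * f 3 * f 4 * f 5 * (f (6::nat) :: complex)"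
  by (simp add: numeral_eq_Suc mult_ac)

definition site_shift :: "complex \<Rightarrow> (nat \<Rightarrow> complex) \<Rightarrow> complex \<Rightarrow> complex" where
  "site_shift \<eta> \<alpha> \<xi> = - (E (\<alpha> 1 + \<xi>) * E (\<alpha> 5 + \<xi>) * E (\<alpha> 6 + \<xi>) * E (2 * (\<xi> + \<eta>))) /
     (E (2 * \<eta> - \<alpha> 2 + \<xi>) * E (2 * \<eta> - \<alpha> 3 + \<xi>) * E (2 * \<eta> - \<alpha> 4 + \<xi>) * E (2 * \<xi>))"

text \<open>Moving from \<open>y\<close> to \<open>x = y + s * \<eta>\<close> changes the weight of a site by the quotient of the two vertices,
up to a constant.  The fourth parameters \<open>u\<close> and \<open>v\<close> of the two sign sums match because of the
balancing condition, which is exactly \<open>u + v = \<eta>\<close>.\<close>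

lemma site_balance:
  assumes s: "s = 1 \<and> \<nu> = Suc \<mu> \<or> s = -1 \<and> \<nu> = \<mu>"
    and nz: "\<And>m i. m \<in> {1..6} \<Longrightarrow> E (2 * \<eta> - \<alpha> m + \<xi> + of_nat i * (2 * \<eta>)) \<noteq> 0"
    and x: "x = \<xi> + of_nat \<nu> * (2 * \<eta>)" and y: "y = \<xi> + \<eta> + of_nat \<mu> * (2 * \<eta>)"
    and x0: "E (2 * x) \<noteq> 0" and y0: "E (2 * y) \<noteq> 0" and \<xi>0: "E (2 * (\<xi> + \<eta>)) \<noteq> 0"
    and uv: "u + v = \<eta>"
  shows "site_weight (2 * \<eta>) \<alpha> \<xi> \<nu> * vertex (\<alpha> 5) (\<alpha> 1) (\<alpha> 6) v (s * (- x)) =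
    site_shift \<eta> \<alpha> \<xi> *
    (site_weight (2 * \<eta>) (shift_params \<eta> \<alpha>) (\<xi> + \<eta>) \<mu> * vertex (\<alpha> 2 - \<eta>) (\<alpha> 3 - \<eta>) (\<alpha> 4 - \<eta>) u (s * y))"
proof -
  have ss: "s * s = 1" "s \<noteq> 0" using s by auto
  have xy: "s * x = s * y + \<eta>"
    using s unfolding x y by (auto simp: algebra_simps)
  define U where "U m = param_factor (2 * \<eta>) (\<alpha> m) \<xi> \<nu>" for m
  define U' where "U' m = param_factor (2 * \<eta>) (shift_params \<eta> \<alpha> m) (\<xi> + \<eta>) \<mu>" for m
  have up: "U m * E (\<alpha> m + s * (- x)) = - s * E (\<alpha> m + \<xi>) * U' m" if "m \<in> {1, 5, 6}" for m
  proof -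
    have "E (2 * \<eta> - \<alpha> m + \<xi> + of_nat \<mu> * (2 * \<eta>)) \<noteq> 0" using that nz by auto
    from param_factor_up[OF this s] have "U m * E (\<alpha> m - s * x) = - s * E (\<alpha> m + \<xi>) * U' m"
      using that by (auto simp: U_def U'_def shift_params_def x)
    then show ?thesis by simp
  qed
  have down: "U m = s * U' m * E (\<alpha> m - \<eta> + s * y) / E (2 * \<eta> - \<alpha> m + \<xi>)" if "m \<in> {2, 3, 4}" for m
  proof -
    have "E (2 * \<eta> - \<alpha> m + \<xi> + of_nat i * (2 * \<eta>)) \<noteq> 0" for i using that nz by auto
    from param_factor_down[OF this s] show ?thesis
      using that by (auto simp: U_def U'_def shift_params_def y)
  qed
  have V: "E (v + s * (- x)) = - E (u + s * y)"
  proof -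
    have "v + s * (- x) = - (u + s * y)" using uv xy by (simp add: algebra_simps)
    then show ?thesis by (simp only: E_minus)
  qed
  have X2: "E (2 * (s * (- x))) = - s * E (2 * x)" "E (2 * (s * y)) = s * E (2 * y)"
    using s E_minus[of "2 * x"] E_minus[of "2 * y"] by auto
  define d where "d = E (2 * \<eta> - \<alpha> 2 + \<xi>) * E (2 * \<eta> - \<alpha> 3 + \<xi>) * E (2 * \<eta> - \<alpha> 4 + \<xi>)"
  define e where "e = E (\<alpha> 2 - \<eta> + s * y) * E (\<alpha> 3 - \<eta> + s * y) * E (\<alpha> 4 - \<eta> + s * y)"
  define h where "h = E (\<alpha> 1 + \<xi>) * E (\<alpha> 5 + \<xi>) * E (\<alpha> 6 + \<xi>)"
  have ups: "(U 5 * E (\<alpha> 5 + s * (- x))) * (U 1 * E (\<alpha> 1 + s * (- x))) * (U 6 * E (\<alpha> 6 + s * (- x)))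
      = - s * h * (U' 1 * U' 5 * U' 6)"
  proof -
    have prods: "(- s * e1 * a) * (- s * e2 * b) * (- s * e3 * c) = - (s * s) * s * (e2 * e1 * e3) * (b * a * c)"
      for e1 e2 e3 a b c :: complex by simp
    have "U 1 * E (\<alpha> 1 + s * (- x)) = - s * E (\<alpha> 1 + \<xi>) * U' 1"
      "U 5 * E (\<alpha> 5 + s * (- x)) = - s * E (\<alpha> 5 + \<xi>) * U' 5"
      "U 6 * E (\<alpha> 6 + s * (- x)) = - s * E (\<alpha> 6 + \<xi>) * U' 6"
      by (rule up; simp)+
    then show ?thesis by (simp only: prods h_def ss(1)) simp
  qed
  have downs: "U 2 * U 3 * U 4 = s * (U' 2 * U' 3 * U' 4) * e / d"
  proof -
    have "(s * a * e1 / d1) * (s * b * e2 / d2) * (s * c * e3 / d3) =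
        (s * s) * s * (a * b * c) * (e1 * e2 * e3) / (d1 * d2 * d3)" for e1 e2 e3 d1 d2 d3 a b c :: complex
      by simp
    then show ?thesis by (simp add: down d_def e_def ss(1))
  qed
  have W: "site_weight (2 * \<eta>) \<alpha> \<xi> \<nu> = E (2 * x) / E (2 * \<xi>) * (U 1 * U 2 * U 3 * U 4 * U 5 * U 6)"
    unfolding site_weight_def prod_1_6 U_def x ..
  have W': "site_weight (2 * \<eta>) (shift_params \<eta> \<alpha>) (\<xi> + \<eta>) \<mu> =
      E (2 * y) / E (2 * (\<xi> + \<eta>)) * (U' 1 * U' 2 * U' 3 * U' 4 * U' 5 * U' 6)"
    unfolding site_weight_def prod_1_6 U'_def y ..
  have "site_weight (2 * \<eta>) \<alpha> \<xi> \<nu> * vertex (\<alpha> 5) (\<alpha> 1) (\<alpha> 6) v (s * (- x)) =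
     ((U 5 * E (\<alpha> 5 + s * (- x))) * (U 1 * E (\<alpha> 1 + s * (- x))) * (U 6 * E (\<alpha> 6 + s * (- x)))) *
     (U 2 * U 3 * U 4) * E (v + s * (- x)) * (E (2 * x) / E (2 * (s * (- x)))) / E (2 * \<xi>)"
    unfolding W vertex_def by (simp add: mult_ac)
  also have "\<dots> = - (h * (U' 1 * U' 5 * U' 6) * (U' 2 * U' 3 * U' 4) * e / d) * E (u + s * y) * s / E (2 * \<xi>)"
    unfolding ups downs V X2 using x0 ss s by auto
  also have "\<dots> = - (h * E (2 * (\<xi> + \<eta>))) / (d * E (2 * \<xi>)) *
      (E (2 * y) / E (2 * (\<xi> + \<eta>)) * (U' 1 * U' 2 * U' 3 * U' 4 * U' 5 * U' 6) * (e * E (u + s * y) / (s * E (2 * y))))"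
    using y0 \<xi>0 s by auto
  also have "\<dots> = site_shift \<eta> \<alpha> \<xi> *
    (site_weight (2 * \<eta>) (shift_params \<eta> \<alpha>) (\<xi> + \<eta>) \<mu> * vertex (\<alpha> 2 - \<eta>) (\<alpha> 3 - \<eta>) (\<alpha> 4 - \<eta>) u (s * y))"
    unfolding W' vertex_def site_shift_def X2 d_def e_def h_def ..
  finally show ?thesis .
qed

text \<open>With equal signs only the sum of the two positions moves, by \<open>\<plusminus> 2 * \<eta>\<close>, and with opposite signs only
their difference.  In each of the four cases one step of \<open>pair_factor\<close> remains after the shift of
the base point has been split off.\<close>

lemma pair_balance:
  assumes s: "s = 1 \<and> \<nu> = Suc \<mu> \<or> s = -1 \<and> \<nu> = \<mu>"
    and s': "s' = 1 \<and> \<nu>' = Suc \<mu>' \<or> s' = -1 \<and> \<nu>' = \<mu>'"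
    and le: "\<nu>' \<le> \<nu>" "\<mu>' \<le> \<mu>"
    and x: "x = \<xi> + of_nat \<nu> * \<kappa>" "x' = \<xi>' + of_nat \<nu>' * \<kappa>"
    and y: "y = \<xi> + \<eta> + of_nat \<mu> * \<kappa>" "y' = \<xi>' + \<eta> + of_nat \<mu>' * \<kappa>" and \<kappa>: "\<kappa> = 2 * \<eta>"
    and nz: "\<And>i. E (\<xi> - \<xi>' + of_nat i * \<kappa>) \<noteq> 0" "\<And>i. E (\<xi> + \<xi>' + of_nat i * \<kappa>) \<noteq> 0"
      "\<And>i. E (\<kappa> - \<tau> + (\<xi> - \<xi>') + of_nat i * \<kappa>) \<noteq> 0" "\<And>i. E (\<kappa> - \<tau> + (\<xi> + \<xi>') + of_nat i * \<kappa>) \<noteq> 0"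
  shows "pair_weight \<kappa> \<tau> \<xi> \<xi>' \<nu> \<nu>' * edge \<tau> (s * (- x)) (s' * (- x')) =
    pair_shift \<kappa> \<tau> (\<xi> + \<xi>') * (pair_weight \<kappa> \<tau> (\<xi> + \<eta>) (\<xi>' + \<eta>) \<mu> \<mu>' * edge \<tau> (s * y) (s' * y'))"
proof -
  let ?r = "\<xi> - \<xi>'" and ?z = "\<xi> + \<xi>'"
  have Y: "pair_factor \<kappa> \<tau> ?z (Suc k) = pair_shift \<kappa> \<tau> ?z * pair_factor \<kappa> \<tau> (?z + \<kappa>) k" for k
    using nz(2)[of 1] by (intro pair_factor_shift) simp
  have Xr: "pair_factor \<kappa> \<tau> ?r (Suc k) * edge \<tau> v v' = pair_factor \<kappa> \<tau> ?r k * edge \<tau> w w'"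
    if "v + v' = - (?r + of_nat (Suc k) * \<kappa>)" "w + w' = ?r + of_nat k * \<kappa>" for k v v' w w'
    using nz(1)[of k] nz(1)[of "Suc k"] nz(3)[of k] that by (rule pair_factor_step)
  have Xz: "pair_factor \<kappa> \<tau> ?z (Suc k) * edge \<tau> v v' = pair_factor \<kappa> \<tau> ?z k * edge \<tau> w w'"
    if "v + v' = - (?z + of_nat (Suc k) * \<kappa>)" "w + w' = ?z + of_nat k * \<kappa>" for k v v' w w'
    using nz(2)[of k] nz(2)[of "Suc k"] nz(4)[of k] that by (rule pair_factor_step)
  have sh: "\<xi> + \<eta> - (\<xi>' + \<eta>) = ?r" "\<xi> + \<eta> + (\<xi>' + \<eta>) = ?z + \<kappa>"
    by (simp_all add: \<kappa>)
  note [simp] = pair_weight_def sh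
  from s s' show ?thesis
  proof (elim disjE conjE)
    assume 1: "s = 1" "\<nu> = Suc \<mu>" "s' = 1" "\<nu>' = Suc \<mu>'"
    have "pair_factor \<kappa> \<tau> ?z (Suc (Suc (\<mu> + \<mu>'))) * edge \<tau> (s * (- x)) (s' * (- x')) =
          pair_factor \<kappa> \<tau> ?z (Suc (\<mu> + \<mu>')) * edge \<tau> (s * y) (s' * y')"
      by (rule Xz) (simp_all add: 1 x y \<kappa> algebra_simps)
    then show ?thesis by (simp add: 1(2,4) Y[of "\<mu> + \<mu>'"])
  next
    assume 1: "s = -1" "\<nu> = \<mu>" "s' = -1" "\<nu>' = \<mu>'"
    have "pair_factor \<kappa> \<tau> ?z (Suc (\<mu> + \<mu>')) * edge \<tau> (s * y) (s' * y') =
          pair_factor \<kappa> \<tau> ?z (\<mu> + \<mu>') * edge \<tau> (s * (- x)) (s' * (- x'))"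
      by (rule Xz) (simp_all add: 1 x y \<kappa> algebra_simps)
    then show ?thesis by (simp add: 1(2,4) Y[of "\<mu> + \<mu>'"] mult.assoc)
  next
    assume 1: "s = 1" "\<nu> = Suc \<mu>" "s' = -1" "\<nu>' = \<mu>'"
    have "pair_factor \<kappa> \<tau> ?r (Suc (\<mu> - \<mu>')) * edge \<tau> (s * (- x)) (s' * (- x')) =
          pair_factor \<kappa> \<tau> ?r (\<mu> - \<mu>') * edge \<tau> (s * y) (s' * y')"
      using le by (intro Xr) (simp_all add: 1 x y \<kappa> algebra_simps of_nat_diff)
    then show ?thesis using le by (simp add: 1(2,4) Y[of "\<mu> + \<mu>'"] Suc_diff_le)
  next
    assume 1: "s = -1" "\<nu> = \<mu>" "s' = 1" "\<nu>' = Suc \<mu>'"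
    then have d: "\<mu> - \<mu>' = Suc (\<mu> - Suc \<mu>')" using le by simp
    have "pair_factor \<kappa> \<tau> ?r (Suc (\<mu> - Suc \<mu>')) * edge \<tau> (s * y) (s' * y') =
          pair_factor \<kappa> \<tau> ?r (\<mu> - Suc \<mu>') * edge \<tau> (s * (- x)) (s' * (- x'))"
      using le by (intro Xr) (simp_all add: 1 x y \<kappa> algebra_simps of_nat_diff)
    then show ?thesis using le by (simp add: 1(2,4) Y[of "\<mu> + \<mu>'"] d)
  qed
qed

end

section \<open>Boundary terms and summation by parts\<close>

lemma partition_tuples_iff:
  "\<nu> \<in> partition_tuples n N \<longleftrightarrow> \<nu> \<in> {1..n} \<rightarrow>\<^sub>E {0..N} \<and> (\<forall>i. 1 \<le> i \<and> i < n \<longrightarrow> \<nu> (Suc i) \<le> \<nu> i)"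
  (is "_ \<longleftrightarrow> ?R")
proof
  assume "\<nu> \<in> partition_tuples n N"
  then show ?R
    by (auto simp: partition_tuples_def)
next
  assume \<nu>: ?R
  have "\<nu> k \<le> \<nu> j" if "1 \<le> j" "j \<le> k" "k \<le> n" for j k
    using that(2,1,3)
  proof (induction k rule: dec_induct)
    case (step k)
    then have "\<nu> (Suc k) \<le> \<nu> k" using \<nu> by simp
    with step show ?case by simp
  qed simp
  with \<nu> show "\<nu> \<in> partition_tuples n N"
    by (auto simp: partition_tuples_def)
qed

definition add_indicator :: "nat \<Rightarrow> (nat \<Rightarrow> nat) \<Rightarrow> nat set \<Rightarrow> nat \<Rightarrow> nat" where
  "add_indicator n \<mu> S = (\<lambda>i\<in>{1..n}. \<mu> i + (if i \<in> S then 1 else 0))"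

lemma inj_add_indicator:
  assumes "\<mu> \<in> {1..n} \<rightarrow>\<^sub>E A" "\<mu>' \<in> {1..n} \<rightarrow>\<^sub>E A" "add_indicator n \<mu> S = add_indicator n \<mu>' S"
  shows "\<mu> = \<mu>'"
proof (rule PiE_ext[OF assms(1,2)])
  fix i assume "i \<in> {1..n}"
  then show "\<mu> i = \<mu>' i"
    using fun_cong[OF assms(3), of i] by (simp add: add_indicator_def)
qed

text \<open>The three conditions exclude precisely the ways in which subtracting the indicator of \<open>S\<close> can leave
the set of partitions.  Each of them will correspond to a vanishing factor of the sign sum.\<close>

lemma subtract_indicator:
  assumes \<nu>: "\<nu> \<in> partition_tuples n (Suc M)"
    and step: "\<And>i. 1 \<le> i \<Longrightarrow> i < n \<Longrightarrow> \<nu> i = \<nu> (Suc i) \<Longrightarrow> i \<in> S \<Longrightarrow> Suc i \<in> S"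
    and bot: "n \<in> S \<Longrightarrow> \<nu> n \<noteq> 0" and top: "1 \<notin> S \<Longrightarrow> \<nu> 1 \<noteq> Suc M"
  shows "\<exists>\<mu>\<in>partition_tuples n M. \<nu> = add_indicator n \<mu> S"
proof
  have \<nu>1: "\<nu> \<in> {1..n} \<rightarrow>\<^sub>E {0..Suc M}" and \<nu>2: "\<And>i. 1 \<le> i \<Longrightarrow> i < n \<Longrightarrow> \<nu> (Suc i) \<le> \<nu> i"
    using \<nu> by (auto simp: partition_tuples_iff)
  have le: "\<nu> i \<le> Suc M" if "1 \<le> i" "i \<le> n" for i
    using \<nu>1 that by (auto simp: PiE_iff)
  have pos: "\<nu> i \<noteq> 0" if "1 \<le> i" "i \<le> n" "i \<in> S" for i
    using that(2,1,3)
  proof (induction i rule: inc_induct)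
    case base
    then show ?case using bot by simp
  next
    case (step i)
    then show ?case using assms(2)[of i] \<nu>2[of i] by fastforce
  qed
  have less: "\<nu> i \<noteq> Suc M" if "1 \<le> i" "i \<le> n" "i \<notin> S" for i
    using that
  proof (induction i rule: dec_induct)
    case base
    then show ?case using top by simp
  next
    case (step i)
    then show ?case using assms(2)[of i] \<nu>2[of i] le[of i] by fastforce
  qed
  define \<mu> where "\<mu> = (\<lambda>i\<in>{1..n}. \<nu> i - (if i \<in> S then 1 else 0))"
  show "\<nu> = add_indicator n \<mu> S"
  proof
    fix i
    show "\<nu> i = add_indicator n \<mu> S i"
    proof (cases "i \<in> {1..n}")
      case True
      then show ?thesis using pos[of i] by (auto simp: add_indicator_def \<mu>_def)
    next
      case False
      then show ?thesis using PiE_arb[OF \<nu>1 False] by (auto simp: add_indicator_def)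
    qed
  qed
  show "\<mu> \<in> partition_tuples n M"
    unfolding partition_tuples_iff
  proof (intro conjI allI impI)
    show "\<mu> \<in> {1..n} \<rightarrow>\<^sub>E {0..M}"
    proof (intro PiE_I)
      fix i assume "i \<in> {1..n}"
      then show "\<mu> i \<in> {0..M}"
        using le[of i] less[of i] by (auto simp: \<mu>_def)
    qed (auto simp: \<mu>_def)
    fix i assume "1 \<le> i \<and> i < n"
    then have i: "1 \<le> i" "i < n" by auto
    then show "\<mu> (Suc i) \<le> \<mu> i"
      using \<nu>2[OF i] step[OF i] by (cases "\<nu> i = \<nu> (Suc i)") (auto simp: \<mu>_def)
  qed
qed

lemma add_indicator_partition:
  assumes \<mu>: "\<mu> \<in> partition_tuples n M"
    and step: "\<And>i. 1 \<le> i \<Longrightarrow> i < n \<Longrightarrow> \<mu> i = \<mu> (Suc i) \<Longrightarrow> Suc i \<in> S \<Longrightarrow> i \<in> S"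
  shows "add_indicator n \<mu> S \<in> partition_tuples n (Suc M)"
  unfolding partition_tuples_iff
proof (intro conjI allI impI)
  show "add_indicator n \<mu> S \<in> {1..n} \<rightarrow>\<^sub>E {0..Suc M}"
    using \<mu> by (auto simp: partition_tuples_iff add_indicator_def PiE_iff split: if_splits)
  fix i assume "1 \<le> i \<and> i < n"
  then have i: "1 \<le> i" "i < n" by auto
  then have "\<mu> (Suc i) \<le> \<mu> i" using \<mu> by (simp add: partition_tuples_iff)
  then show "add_indicator n \<mu> S (Suc i) \<le> add_indicator n \<mu> S i"
    using i step[OF i] by (cases "\<mu> i = \<mu> (Suc i)") (auto simp: add_indicator_def)
qed

context theta_lattice
begin

text \<open>Multiplicatively: no nontrivial monomial in a square root of \<open>q\<close>, \<open>t\<close> and \<open>a 1, \<dots>, a 4\<close> is a power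
of \<open>p\<close>.  The half step \<open>\<eta>\<close> of the base \<open>q = exp (2 * \<eta>)\<close> is a generator because the parameters
move by \<open>\<eta>\<close> in the induction.\<close>

definition independent :: "complex \<Rightarrow> complex \<Rightarrow> (nat \<Rightarrow> complex) \<Rightarrow> bool" where
  "independent \<eta> \<tau> \<alpha> \<longleftrightarrow> (\<forall>a b c d e f :: int.
     of_int a * \<eta> + of_int b * \<tau> + of_int c * \<alpha> 1 + of_int d * \<alpha> 2 + of_int e * \<alpha> 3 + of_int f * \<alpha> 4 \<in> lattice
     \<longrightarrow> a = 0 \<and> b = 0 \<and> c = 0 \<and> d = 0 \<and> e = 0 \<and> f = 0)"

lemma independentD:
  fixes a b c d e f :: int
  assumes "independent \<eta> \<tau> \<alpha>"
    and "x = of_int a * \<eta> + of_int b * \<tau> + of_int c * \<alpha> 1 + of_int d * \<alpha> 2 + of_int e * \<alpha> 3 + of_int f * \<alpha> 4"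
    and "a \<noteq> 0 \<or> b \<noteq> 0 \<or> c \<noteq> 0 \<or> d \<noteq> 0 \<or> e \<noteq> 0 \<or> f \<noteq> 0"
  shows "x \<notin> lattice"
  using assms unfolding independent_def by blast

lemma independent_shift:
  assumes "independent \<eta> \<tau> \<alpha>"
  shows "independent \<eta> \<tau> (shift_params \<eta> \<alpha>)"
  unfolding independent_def
proof (intro allI impI)
  fix a b c d e f :: int
  assume "of_int a * \<eta> + of_int b * \<tau> + of_int c * shift_params \<eta> \<alpha> 1 + of_int d * shift_params \<eta> \<alpha> 2
    + of_int e * shift_params \<eta> \<alpha> 3 + of_int f * shift_params \<eta> \<alpha> 4 \<in> lattice"
  then have "of_int (a + c - d - e - f) * \<eta> + of_int b * \<tau> + of_int c * \<alpha> 1 + of_int d * \<alpha> 2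
    + of_int e * \<alpha> 3 + of_int f * \<alpha> 4 \<in> lattice"
    by (simp add: shift_params_def algebra_simps)
  then show "a = 0 \<and> b = 0 \<and> c = 0 \<and> d = 0 \<and> e = 0 \<and> f = 0"
    using assms unfolding independent_def by fastforce
qed

text \<open>The balancing and truncation conditions, solved for \<open>\<alpha> 5\<close> and \<open>\<alpha> 6\<close>.\<close>

definition balanced :: "nat \<Rightarrow> nat \<Rightarrow> complex \<Rightarrow> complex \<Rightarrow> (nat \<Rightarrow> complex) \<Rightarrow> bool" where
  "balanced n N \<eta> \<tau> \<alpha> \<longleftrightarrow>
     \<alpha> 5 = 2 * (of_nat N + 1) * \<eta> + (1 - of_nat n) * \<tau> - \<alpha> 2 - \<alpha> 3 - \<alpha> 4 \<and>
     \<alpha> 6 = - 2 * of_nat N * \<eta> + (1 - of_nat n) * \<tau> - \<alpha> 1"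

lemma balanced_shift:
  "balanced n (Suc M) \<eta> \<tau> \<alpha> \<Longrightarrow> balanced n M \<eta> \<tau> (shift_params \<eta> \<alpha>)"
  by (simp add: balanced_def shift_params_def algebra_simps)

definition jackson_sum :: "nat \<Rightarrow> nat \<Rightarrow> complex \<Rightarrow> complex \<Rightarrow> (nat \<Rightarrow> complex) \<Rightarrow> complex" where
  "jackson_sum n N \<eta> \<tau> \<alpha> = (\<Sum>\<nu>\<in>partition_tuples n N. weight n (2 * \<eta>) \<tau> \<alpha> \<nu>)"

definition position :: "nat \<Rightarrow> complex \<Rightarrow> complex \<Rightarrow> complex \<Rightarrow> (nat \<Rightarrow> nat) \<Rightarrow> nat \<Rightarrow> complex" where
  "position n \<eta> \<tau> a \<nu> i = site n \<tau> a i + of_nat (\<nu> i) * (2 * \<eta>)"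

lemma signed_term_eq_0_edge:
  assumes "1 \<le> i" "i < n" "\<tau> + sg S i * w i + sg S (Suc i) * w (Suc i) = 0"
  shows "signed_term n \<tau> u0 u1 u2 u3 w S = 0"
proof -
  have "(\<Prod>(i, j)\<in>index_pairs 1 n. edge \<tau> (sg S i * w i) (sg S j * w j)) = 0"
    using assms by (intro prod_zero finite_index_pairs bexI[of _ "(i, Suc i)"])
      (auto simp: index_pairs_def edge_def)
  then show ?thesis by (simp add: signed_term_def)
qed

lemma signed_term_eq_0_vertex:
  assumes "1 \<le> i" "i \<le> n" "vertex u0 u1 u2 u3 (sg S i * w i) = 0"
  shows "signed_term n \<tau> u0 u1 u2 u3 w S = 0"
proof -
  have "(\<Prod>i=1..n. vertex u0 u1 u2 u3 (sg S i * w i)) = 0"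
    using assms by (intro prod_zero bexI[of _ i]) auto
  then show ?thesis by (simp add: signed_term_def)
qed

lemma site_diff: "1 \<le> i \<Longrightarrow> i < n \<Longrightarrow> site n \<tau> a i = site n \<tau> a (Suc i) + \<tau>"
  by (simp add: site_def algebra_simps flip: Suc_diff_Suc)

text \<open>The factors that vanish: \<open>E (\<alpha> 1 - x\<^sub>n)\<close> if a part would become negative, \<open>E (\<alpha> 6 + x\<^sub>1)\<close> by the
truncation condition if a part would stay too large, and \<open>E (\<tau> - x\<^sub>i + x\<^sub>i\<^sub>+\<^sub>1)\<close> if two equal parts
would change their order.\<close>

lemma lower_term_eq_0:
  assumes \<nu>: "\<nu> \<in> partition_tuples n (Suc M)" and n: "1 \<le> n" and bal: "balanced n (Suc M) \<eta> \<tau> \<alpha>"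
    and no: "\<nexists>\<mu>. \<mu> \<in> partition_tuples n M \<and> \<nu> = add_indicator n \<mu> S"
  shows "signed_term n \<tau> (\<alpha> 5) (\<alpha> 1) (\<alpha> 6) v (\<lambda>i. - position n \<eta> \<tau> (\<alpha> 1) \<nu> i) S = 0"
proof (rule ccontr)
  let ?w = "\<lambda>i. - position n \<eta> \<tau> (\<alpha> 1) \<nu> i"
  assume nz: "signed_term n \<tau> (\<alpha> 5) (\<alpha> 1) (\<alpha> 6) v ?w S \<noteq> 0"
  have "\<exists>\<mu>\<in>partition_tuples n M. \<nu> = add_indicator n \<mu> S"
  proof (rule subtract_indicator[OF \<nu>])
    fix i assume i: "1 \<le> i" "i < n" "\<nu> i = \<nu> (Suc i)" "i \<in> S"
    show "Suc i \<in> S"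
    proof (rule ccontr)
      assume "Suc i \<notin> S"
      then have "\<tau> + sg S i * ?w i + sg S (Suc i) * ?w (Suc i) = 0"
        using i site_diff[OF i(1,2)] by (simp add: sg_def position_def)
      from signed_term_eq_0_edge[OF i(1,2) this] nz show False by simp
    qed
  next
    assume "n \<in> S"
    show "\<nu> n \<noteq> 0"
    proof
      assume "\<nu> n = 0"
      with \<open>n \<in> S\<close> have "vertex (\<alpha> 5) (\<alpha> 1) (\<alpha> 6) v (sg S n * ?w n) = 0"
        by (simp add: vertex_def sg_def position_def site_def)
      from signed_term_eq_0_vertex[where w = ?w, OF n _ this] nz show False by simp
    qed
  next
    assume "1 \<notin> S"
    show "\<nu> 1 \<noteq> Suc M"
    proof
      assume "\<nu> 1 = Suc M"
      have "\<alpha> 6 + position n \<eta> \<tau> (\<alpha> 1) \<nu> 1 = 0"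
        using bal n unfolding balanced_def position_def site_def \<open>\<nu> 1 = Suc M\<close>
        by (simp add: of_nat_diff algebra_simps)
      with \<open>1 \<notin> S\<close> have "vertex (\<alpha> 5) (\<alpha> 1) (\<alpha> 6) v (sg S 1 * ?w 1) = 0"
        by (simp add: vertex_def sg_def)
      from signed_term_eq_0_vertex[where w = ?w, OF _ n this] nz show False by simp
    qed
  qed
  with no show False by blast
qed

lemma upper_term_eq_0:
  assumes \<mu>: "\<mu> \<in> partition_tuples n M"
    and no: "add_indicator n \<mu> S \<notin> partition_tuples n (Suc M)"
  shows "signed_term n \<tau> u0 u1 u2 u3 (position n \<eta> \<tau> a \<mu>) S = 0"
proof (rule ccontr)
  assume nz: "signed_term n \<tau> u0 u1 u2 u3 (position n \<eta> \<tau> a \<mu>) S \<noteq> 0"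
  have "add_indicator n \<mu> S \<in> partition_tuples n (Suc M)"
  proof (rule add_indicator_partition[OF \<mu>])
    fix i assume i: "1 \<le> i" "i < n" "\<mu> i = \<mu> (Suc i)" "Suc i \<in> S"
    show "i \<in> S"
    proof (rule ccontr)
      assume "i \<notin> S"
      then have "\<tau> + sg S i * position n \<eta> \<tau> a \<mu> i + sg S (Suc i) * position n \<eta> \<tau> a \<mu> (Suc i) = 0"
        using i site_diff[OF i(1,2)] by (simp add: sg_def position_def)
      from signed_term_eq_0_edge[OF i(1,2) this] nz show False by simp
    qed
  qed
  with no show False by blast
qed

definition total_shift :: "nat \<Rightarrow> complex \<Rightarrow> complex \<Rightarrow> (nat \<Rightarrow> complex) \<Rightarrow> complex" where
  "total_shift n \<eta> \<tau> \<alpha> = (\<Prod>i=1..n. site_shift \<eta> \<alpha> (site n \<tau> (\<alpha> 1) i)) *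
     (\<Prod>(j, k)\<in>index_pairs 1 n. pair_shift (2 * \<eta>) \<tau> (site n \<tau> (\<alpha> 1) j + site n \<tau> (\<alpha> 1) k))"

text \<open>Taking the product of the site and pair balances over all sites and pairs gives one constant that
depends neither on the partition nor on the signs.\<close>

lemma detailed_balance:
  assumes ind: "independent \<eta> \<tau> \<alpha>" and bal: "balanced n (Suc M) \<eta> \<tau> \<alpha>"
    and \<mu>: "\<mu> \<in> partition_tuples n M" and \<nu>: "\<nu> = add_indicator n \<mu> S" "\<nu> \<in> partition_tuples n (Suc M)"
    and uv: "u + v = \<eta>"
  shows "weight n (2 * \<eta>) \<tau> \<alpha> \<nu> *
      signed_term n \<tau> (\<alpha> 5) (\<alpha> 1) (\<alpha> 6) v (\<lambda>i. - position n \<eta> \<tau> (\<alpha> 1) \<nu> i) S =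
    total_shift n \<eta> \<tau> \<alpha> * (weight n (2 * \<eta>) \<tau> (shift_params \<eta> \<alpha>) \<mu> *
      signed_term n \<tau> (\<alpha> 2 - \<eta>) (\<alpha> 3 - \<eta>) (\<alpha> 4 - \<eta>) u (position n \<eta> \<tau> (\<alpha> 1 + \<eta>) \<mu>) S)"
proof -
  let ?x = "\<lambda>i. position n \<eta> \<tau> (\<alpha> 1) \<nu> i" and ?y = "position n \<eta> \<tau> (\<alpha> 1 + \<eta>) \<mu>"
  let ?\<xi> = "site n \<tau> (\<alpha> 1)"
  note notin = independentD[OF ind] and nz = independentD[OF ind, folded E_eq_0_iff]
    and coords = position_def site_def algebra_simps
  have sgc: "sg S i = 1 \<and> \<nu> i = Suc (\<mu> i) \<or> sg S i = -1 \<and> \<nu> i = \<mu> i" if "i \<in> {1..n}" for i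
    using that by (auto simp: \<nu>(1) add_indicator_def sg_def)
  have site': "site n \<tau> (shift_params \<eta> \<alpha> 1) i = ?\<xi> i + \<eta>" for i
    by (simp add: site_def shift_params_def)
  have vert: "site_weight (2 * \<eta>) \<alpha> (?\<xi> i) (\<nu> i) * vertex (\<alpha> 5) (\<alpha> 1) (\<alpha> 6) v (sg S i * (- ?x i)) =
      site_shift \<eta> \<alpha> (?\<xi> i) * (site_weight (2 * \<eta>) (shift_params \<eta> \<alpha>) (?\<xi> i + \<eta>) (\<mu> i) *
        vertex (\<alpha> 2 - \<eta>) (\<alpha> 3 - \<eta>) (\<alpha> 4 - \<eta>) u (sg S i * ?y i))" if i: "i \<in> {1..n}" for i
  proof (rule site_balance[OF sgc[OF i] _ _ _ _ _ _ uv])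
    show "?x i = ?\<xi> i + of_nat (\<nu> i) * (2 * \<eta>)" by (simp add: position_def)
    show "?y i = ?\<xi> i + \<eta> + of_nat (\<mu> i) * (2 * \<eta>)" by (simp add: position_def site_def)
    show "E (2 * ?x i) \<noteq> 0"
      by (rule nz[of _ "4 * int (\<nu> i)" "2 * int (n - i)" 2 0 0 0])
        (simp_all add: coords)
    show "E (2 * ?y i) \<noteq> 0"
      by (rule nz[of _ "4 * int (\<mu> i) + 2" "2 * int (n - i)" 2 0 0 0])
        (simp_all add: coords)
    show "E (2 * (?\<xi> i + \<eta>)) \<noteq> 0"
      by (rule nz[of _ 2 "2 * int (n - i)" 2 0 0 0])
        (simp_all add: coords)
    fix m k :: nat
    assume "m \<in> {1..6}"
    then have "m \<in> {1, 2, 3, 4, 5, 6}" by auto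
    then have "2 * \<eta> - \<alpha> m + ?\<xi> i + of_nat k * (2 * \<eta>) \<notin> lattice"
    proof (elim insertE emptyE)
      assume m: "m = 1"
      show ?thesis unfolding m
        by (rule notin[of _ "2 * int k + 2" "int (n - i)" 0 0 0 0])
          (simp_all add: site_def algebra_simps)
    next
      assume m: "m = 2"
      show ?thesis unfolding m
        by (rule notin[of _ "2 * int k + 2" "int (n - i)" 1 "-1" 0 0])
          (simp_all add: site_def algebra_simps)
    next
      assume m: "m = 3"
      show ?thesis unfolding m
        by (rule notin[of _ "2 * int k + 2" "int (n - i)" 1 0 "-1" 0])
          (simp_all add: site_def algebra_simps)
    next
      assume m: "m = 4"
      show ?thesis unfolding m
        by (rule notin[of _ "2 * int k + 2" "int (n - i)" 1 0 0 "-1"])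
          (simp_all add: site_def algebra_simps)
    next
      assume m: "m = 5"
      show ?thesis unfolding m
        by (rule notin[of _ "2 * int k + 2 - 2 * (int M + 2)" "int (n - i) - 1 + int n" 1 1 1 1])
          (use bal in \<open>simp_all add: balanced_def site_def algebra_simps\<close>)
    next
      assume m: "m = 6"
      show ?thesis unfolding m
        by (rule notin[of _ "2 * int k + 2 + 2 * (int M + 1)" "int (n - i) - 1 + int n" 2 0 0 0])
          (use bal in \<open>simp_all add: balanced_def site_def algebra_simps\<close>)
    qed
    then show "E (2 * \<eta> - \<alpha> m + ?\<xi> i + of_nat k * (2 * \<eta>)) \<noteq> 0" by (simp add: E_eq_0_iff)
  qed
  have pair: "pair_weight (2 * \<eta>) \<tau> (?\<xi> j) (?\<xi> k) (\<nu> j) (\<nu> k) * edge \<tau> (sg S j * (- ?x j)) (sg S k * (- ?x k)) =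
      pair_shift (2 * \<eta>) \<tau> (?\<xi> j + ?\<xi> k) * (pair_weight (2 * \<eta>) \<tau> (?\<xi> j + \<eta>) (?\<xi> k + \<eta>) (\<mu> j) (\<mu> k) *
        edge \<tau> (sg S j * ?y j) (sg S k * ?y k))" if jk: "(j, k) \<in> index_pairs 1 n" for j k
  proof -
    from jk have jk': "1 \<le> j" "j < k" "k \<le> n" "j \<in> {1..n}" "k \<in> {1..n}" "j \<le> k" by (auto simp: index_pairs_def)
    have r: "?\<xi> j - ?\<xi> k = of_int (int k - int j) * \<tau>"
      using jk' by (simp add: site_def of_nat_diff algebra_simps)
    show ?thesis
    proof (rule pair_balance[OF sgc[OF jk'(4)] sgc[OF jk'(5)] _ _ _ _ _ _ refl])
      show "\<nu> k \<le> \<nu> j" "\<mu> k \<le> \<mu> j" using \<nu>(2) \<mu> jk' by (auto simp: partition_tuples_def)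
      show "?x j = ?\<xi> j + of_nat (\<nu> j) * (2 * \<eta>)" "?x k = ?\<xi> k + of_nat (\<nu> k) * (2 * \<eta>)"
        by (simp_all add: position_def)
      show "?y j = ?\<xi> j + \<eta> + of_nat (\<mu> j) * (2 * \<eta>)" "?y k = ?\<xi> k + \<eta> + of_nat (\<mu> k) * (2 * \<eta>)"
        by (simp_all add: position_def site_def)
      fix i :: nat
      show "E (?\<xi> j - ?\<xi> k + of_nat i * (2 * \<eta>)) \<noteq> 0"
        unfolding r
        by (rule nz[of _ "2 * int i" "int k - int j" 0 0 0 0])
          (use jk' in simp_all)
      show "E (?\<xi> j + ?\<xi> k + of_nat i * (2 * \<eta>)) \<noteq> 0"
        by (rule nz[of _ "2 * int i" "int (n - j) + int (n - k)" 2 0 0 0])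
          (simp_all add: site_def algebra_simps)
      show "E (2 * \<eta> - \<tau> + (?\<xi> j - ?\<xi> k) + of_nat i * (2 * \<eta>)) \<noteq> 0"
        unfolding r
        by (rule nz[of _ "2 * int i + 2" "int k - int j - 1" 0 0 0 0])
          (simp_all add: algebra_simps)
      show "E (2 * \<eta> - \<tau> + (?\<xi> j + ?\<xi> k) + of_nat i * (2 * \<eta>)) \<noteq> 0"
        by (rule nz[of _ "2 * int i + 2" "int (n - j) + int (n - k) - 1" 2 0 0 0])
          (simp_all add: site_def algebra_simps)
    qed
  qed
  have V: "(\<Prod>i=1..n. site_weight (2 * \<eta>) \<alpha> (?\<xi> i) (\<nu> i)) * (\<Prod>i=1..n. vertex (\<alpha> 5) (\<alpha> 1) (\<alpha> 6) v (sg S i * (- ?x i))) =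
      (\<Prod>i=1..n. site_shift \<eta> \<alpha> (?\<xi> i)) * ((\<Prod>i=1..n. site_weight (2 * \<eta>) (shift_params \<eta> \<alpha>) (?\<xi> i + \<eta>) (\<mu> i)) *
        (\<Prod>i=1..n. vertex (\<alpha> 2 - \<eta>) (\<alpha> 3 - \<eta>) (\<alpha> 4 - \<eta>) u (sg S i * ?y i)))"
    unfolding prod.distrib[symmetric] by (intro prod.cong refl vert)
  have P: "(\<Prod>(j, k)\<in>index_pairs 1 n. pair_weight (2 * \<eta>) \<tau> (?\<xi> j) (?\<xi> k) (\<nu> j) (\<nu> k)) *
       (\<Prod>(j, k)\<in>index_pairs 1 n. edge \<tau> (sg S j * (- ?x j)) (sg S k * (- ?x k))) =
      (\<Prod>(j, k)\<in>index_pairs 1 n. pair_shift (2 * \<eta>) \<tau> (?\<xi> j + ?\<xi> k)) *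
      ((\<Prod>(j, k)\<in>index_pairs 1 n. pair_weight (2 * \<eta>) \<tau> (?\<xi> j + \<eta>) (?\<xi> k + \<eta>) (\<mu> j) (\<mu> k)) *
       (\<Prod>(j, k)\<in>index_pairs 1 n. edge \<tau> (sg S j * ?y j) (sg S k * ?y k)))"
    unfolding prod.distrib[symmetric] by (intro prod.cong refl) (simp only: pair split_paired_all prod.case)
  have regroup: "(a * b) * (c * d) = (a' * b') * ((e * f) * (g * h))"
    if "a * c = a' * (e * g)" "b * d = b' * (f * h)" for a b c d a' b' e f g h :: complex
  proof -
    have "(a * b) * (c * d) = (a * c) * (b * d)" by simp
    also have "\<dots> = (a' * b') * ((e * f) * (g * h))" unfolding that by simp
    finally show ?thesis .
  qed
  show ?thesis
    unfolding weight_def signed_term_def total_shift_def site'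
    by (rule regroup[OF V P])
qed

end

section \<open>Induction on the length of the sum\<close>

lemma prod_reverse_index: "(\<Prod>i=1..n. f (n - i)) = (\<Prod>k<n. f k)" for n :: nat
  by (rule prod.reindex_bij_witness[of _ "\<lambda>k. n - k" "\<lambda>i. n - i"]) auto

lemma prod_pred_index: "(\<Prod>i=1..n. f (i - 1)) = (\<Prod>k<n. f k)" for n :: nat
  by (rule prod.reindex_bij_witness[of _ Suc "\<lambda>i. i - 1"]) auto

context theta_lattice
begin

text \<open>Peeling off the last site shifts \<open>b\<close> by \<open>2 * \<tau>\<close>, and the pair factors involving that site telescope.\<close>

lemma shift_telescope:
  assumes "\<And>r::nat. E (b + of_nat r * \<tau>) \<noteq> 0" "\<And>r::nat. E (\<kappa> + b + of_nat r * \<tau>) \<noteq> 0"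
  shows "(\<Prod>k<n. E (\<kappa> + b + of_nat (2 * k) * \<tau>) * E (b + of_nat k * \<tau>) / E (b + of_nat (2 * k) * \<tau>)) *
      (\<Prod>(j, k)\<in>index_pairs 1 n. pair_shift \<kappa> \<tau> (b + of_nat ((n - j) + (n - k)) * \<tau>)) =
      (\<Prod>i=1..n. E (\<kappa> + b + of_nat (n + i - 2) * \<tau>))"
  using assms
proof (induction n arbitrary: b)
  case 0
  have "index_pairs 1 0 = {}" by (auto simp: index_pairs_def)
  then show ?case by simp
next
  case (Suc n)
  define e where "e k = E (b + of_nat k * \<tau>)" for k
  define h where "h k = E (\<kappa> + b + of_nat k * \<tau>)" for k
  have e0: "e k \<noteq> 0" and h0: "h k \<noteq> 0" for k
    using Suc.prems by (auto simp: e_def h_def)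
  have e2: "E (b + 2 * \<tau> + of_nat k * \<tau>) = e (k + 2)" for k
    by (simp add: e_def algebra_simps)
  have h2: "E (\<kappa> + (b + 2 * \<tau>) + of_nat k * \<tau>) = h (k + 2)" for k
    by (simp add: h_def algebra_simps)
  define pairs where "pairs = (\<Prod>(j, k)\<in>index_pairs 1 n. pair_shift \<kappa> \<tau> (b + 2 * \<tau> + of_nat ((n - j) + (n - k)) * \<tau>))"
  have IH: "(\<Prod>k<n. h (2 * k + 2) * e (k + 2) / e (2 * k + 2)) * pairs = (\<Prod>i=1..n. h (n + i))"
  proof -
    have "(\<Prod>k<n. h (2 * k + 2) * e (k + 2) / e (2 * k + 2)) * pairs = (\<Prod>i=1..n. h ((n + i - 2) + 2))"
      using Suc.IH[of "b + 2 * \<tau>"] e0 h0 unfolding e2 h2 pairs_def by simp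
    also have "\<dots> = (\<Prod>i=1..n. h (n + i))"
    proof (intro prod.cong refl)
      fix i assume "i \<in> {1..n}"
      then have "n + i - 2 + 2 = n + i" by auto
      then show "h (n + i - 2 + 2) = h (n + i)" by (simp only:)
    qed
    finally show ?thesis .
  qed
  have "(\<Prod>(j, k)\<in>index_pairs 1 (Suc n). pair_shift \<kappa> \<tau> (b + of_nat ((Suc n - j) + (Suc n - k)) * \<tau>)) =
      pairs * (\<Prod>i=1..n. pair_shift \<kappa> \<tau> (b + of_nat (Suc (n - i)) * \<tau>))"
    unfolding prod_index_pairs_Suc pairs_def
    by (intro arg_cong2[of _ _ _ _ "(*)"] prod.cong refl)
       (auto simp: index_pairs_def Suc_diff_le algebra_simps)
  also have "(\<Prod>i=1..n. pair_shift \<kappa> \<tau> (b + of_nat (Suc (n - i)) * \<tau>)) =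
      (\<Prod>k<n. pair_shift \<kappa> \<tau> (b + of_nat (Suc k) * \<tau>))"
    by (rule prod_reverse_index)
  also have "\<dots> = (\<Prod>k<n. e (k + 2) / e (k + 1) * (h (Suc k) / h k))"
  proof (intro prod.cong refl)
    fix k
    have arg: "b + of_nat (Suc k) * \<tau> + \<kappa> = \<kappa> + b + of_nat (Suc k) * \<tau>"
      "\<tau> + (b + of_nat (Suc k) * \<tau>) = b + of_nat (k + 2) * \<tau>"
      "\<kappa> - \<tau> + (b + of_nat (Suc k) * \<tau>) = \<kappa> + b + of_nat k * \<tau>"
      by (simp_all add: algebra_simps)
    show "pair_shift \<kappa> \<tau> (b + of_nat (Suc k) * \<tau>) = e (k + 2) / e (k + 1) * (h (Suc k) / h k)"
      unfolding pair_shift_def arg unfolding e_def h_def Suc_eq_plus1 by (simp add: mult_ac)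
  qed
  also have "\<dots> = (\<Prod>k<n. e (k + 2) / e (k + 1)) * (h n / h 0)"
    by (simp only: prod.distrib prod_lessThan_telescope h0 not_False_eq_True)
  finally have P: "(\<Prod>(j, k)\<in>index_pairs 1 (Suc n). pair_shift \<kappa> \<tau> (b + of_nat ((Suc n - j) + (Suc n - k)) * \<tau>)) =
      pairs * ((\<Prod>k<n. e (k + 2) / e (k + 1)) * (h n / h 0))" .
  have "(\<Prod>k<Suc n. E (\<kappa> + b + of_nat (2 * k) * \<tau>) * E (b + of_nat k * \<tau>) / E (b + of_nat (2 * k) * \<tau>)) =
      (\<Prod>k<Suc n. h (2 * k) * e k / e (2 * k))"
    by (simp add: h_def e_def)
  also have "\<dots> = h 0 * (\<Prod>k<n. h (2 * k + 2) * e (k + 1) / e (2 * k + 2))"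
    using e0[of 0] by (subst prod.lessThan_Suc_shift) simp
  finally have V: "(\<Prod>k<Suc n. E (\<kappa> + b + of_nat (2 * k) * \<tau>) * E (b + of_nat k * \<tau>) / E (b + of_nat (2 * k) * \<tau>)) =
      h 0 * (\<Prod>k<n. h (2 * k + 2) * e (k + 1) / e (2 * k + 2))" .
  have M: "(\<Prod>k<n. h (2 * k + 2) * e (k + 1) / e (2 * k + 2)) * (\<Prod>k<n. e (k + 2) / e (k + 1)) =
      (\<Prod>k<n. h (2 * k + 2) * e (k + 2) / e (2 * k + 2))"
    unfolding prod.distrib[symmetric] using e0 by (intro prod.cong) auto
  have "(\<Prod>i=1..Suc n. h (Suc n + i - 2)) = h n * (\<Prod>i=1..n. h (n + i))"
    by (subst prod.atLeast_Suc_atMost) (simp_all add: prod.shift_bounds_cl_Suc_ivl del: prod.cl_ivl_Suc)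
  moreover have "h 0 * a * (p * (c * (h n / h 0))) = h n * ((a * c) * p)" for a p c
    using h0[of 0] by simp
  ultimately show ?case
    unfolding V P using M IH by (simp add: h_def)
qed

definition jackson_prod :: "nat \<Rightarrow> nat \<Rightarrow> complex \<Rightarrow> complex \<Rightarrow> (nat \<Rightarrow> complex) \<Rightarrow> complex" where
  "jackson_prod n N \<eta> \<tau> \<alpha> = (\<Prod>i=1..n.
     Efact (2 * \<eta>) (2 * \<eta> + 2 * \<alpha> 1 + of_nat (n + i - 2) * \<tau>) N *
     (Efact (2 * \<eta>) (2 * \<eta> - \<alpha> 2 - \<alpha> 3 + (1 - of_nat i) * \<tau>) N *
      Efact (2 * \<eta>) (2 * \<eta> - \<alpha> 2 - \<alpha> 4 + (1 - of_nat i) * \<tau>) N *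
      Efact (2 * \<eta>) (2 * \<eta> - \<alpha> 3 - \<alpha> 4 + (1 - of_nat i) * \<tau>) N) /
     (Efact (2 * \<eta>) (2 * \<eta> - \<alpha> 1 - \<alpha> 2 - \<alpha> 3 - \<alpha> 4 + (2 - of_nat n - of_nat i) * \<tau>) N *
      (Efact (2 * \<eta>) (2 * \<eta> - \<alpha> 2 + \<alpha> 1 + of_nat (i - 1) * \<tau>) N *
       Efact (2 * \<eta>) (2 * \<eta> - \<alpha> 3 + \<alpha> 1 + of_nat (i - 1) * \<tau>) N *
       Efact (2 * \<eta>) (2 * \<eta> - \<alpha> 4 + \<alpha> 1 + of_nat (i - 1) * \<tau>) N)))"

lemma jackson_prod_Suc:
  "jackson_prod n (Suc M) \<eta> \<tau> \<alpha> = (\<Prod>i=1..n.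
     E (2 * \<eta> + 2 * \<alpha> 1 + of_nat (n + i - 2) * \<tau>) *
     (E (2 * \<eta> - \<alpha> 2 - \<alpha> 3 + (1 - of_nat i) * \<tau>) *
      E (2 * \<eta> - \<alpha> 2 - \<alpha> 4 + (1 - of_nat i) * \<tau>) *
      E (2 * \<eta> - \<alpha> 3 - \<alpha> 4 + (1 - of_nat i) * \<tau>)) /
     (E (2 * \<eta> - \<alpha> 1 - \<alpha> 2 - \<alpha> 3 - \<alpha> 4 + (2 - of_nat n - of_nat i) * \<tau>) *
      (E (2 * \<eta> - \<alpha> 2 + \<alpha> 1 + of_nat (i - 1) * \<tau>) *
       E (2 * \<eta> - \<alpha> 3 + \<alpha> 1 + of_nat (i - 1) * \<tau>) *
       E (2 * \<eta> - \<alpha> 4 + \<alpha> 1 + of_nat (i - 1) * \<tau>)))) * jackson_prod n M \<eta> \<tau> (shift_params \<eta> \<alpha>)"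
proof -
  have arg: "2 * \<eta> + 2 * shift_params \<eta> \<alpha> 1 + c = 2 * \<eta> + 2 * \<alpha> 1 + c + 2 * \<eta>"
    "2 * \<eta> - shift_params \<eta> \<alpha> 2 - shift_params \<eta> \<alpha> 3 + c = 2 * \<eta> - \<alpha> 2 - \<alpha> 3 + c + 2 * \<eta>"
    "2 * \<eta> - shift_params \<eta> \<alpha> 2 - shift_params \<eta> \<alpha> 4 + c = 2 * \<eta> - \<alpha> 2 - \<alpha> 4 + c + 2 * \<eta>"
    "2 * \<eta> - shift_params \<eta> \<alpha> 3 - shift_params \<eta> \<alpha> 4 + c = 2 * \<eta> - \<alpha> 3 - \<alpha> 4 + c + 2 * \<eta>"
    "2 * \<eta> - shift_params \<eta> \<alpha> 1 - shift_params \<eta> \<alpha> 2 - shift_params \<eta> \<alpha> 3 - shift_params \<eta> \<alpha> 4 + c =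
       2 * \<eta> - \<alpha> 1 - \<alpha> 2 - \<alpha> 3 - \<alpha> 4 + c + 2 * \<eta>"
    "2 * \<eta> - shift_params \<eta> \<alpha> 2 + shift_params \<eta> \<alpha> 1 + c = 2 * \<eta> - \<alpha> 2 + \<alpha> 1 + c + 2 * \<eta>"
    "2 * \<eta> - shift_params \<eta> \<alpha> 3 + shift_params \<eta> \<alpha> 1 + c = 2 * \<eta> - \<alpha> 3 + \<alpha> 1 + c + 2 * \<eta>"
    "2 * \<eta> - shift_params \<eta> \<alpha> 4 + shift_params \<eta> \<alpha> 1 + c = 2 * \<eta> - \<alpha> 4 + \<alpha> 1 + c + 2 * \<eta>" for c
    by (simp_all add: shift_params_def)
  have split: "(d * d') * ((a * a') * (b * b') * (c * c')) / ((q * q') * ((x * x') * (y * y') * (z * z'))) =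
     (d * (a * b * c) / (q * (x * y * z))) * (d' * (a' * b' * c') / (q' * (x' * y' * z')))"
    for a b c d q x y z a' b' c' d' q' x' y' z' :: complex
    by (simp add: mult_ac)
  show ?thesis
    unfolding jackson_prod_def arg Efact_Suc_shift split prod.distrib ..
qed

text \<open>After reversing the order of some of the products the factors match one by one, except for those
involving \<open>\<alpha> 1 + \<xi>\<close>, \<open>2 * \<xi>\<close> or pairs of sites, which combine by \<open>shift_telescope\<close>.\<close>

lemma step_identity:
  assumes ind: "independent \<eta> \<tau> \<alpha>" and bal: "balanced n (Suc M) \<eta> \<tau> \<alpha>"
    and v: "v = \<tau> - of_nat n * \<tau> - (\<alpha> 1 + \<alpha> 5 + \<alpha> 6)"
    and u: "u = \<tau> - of_nat n * \<tau> - (\<alpha> 2 + \<alpha> 3 + \<alpha> 4 - 3 * \<eta>)"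
  shows "(\<Prod>k<n. E (\<alpha> 5 + \<alpha> 1 + of_nat k * \<tau>) * E (\<alpha> 5 + \<alpha> 6 + of_nat k * \<tau>) * E (\<alpha> 5 + v + of_nat k * \<tau>)) *
      jackson_prod n (Suc M) \<eta> \<tau> \<alpha> =
    total_shift n \<eta> \<tau> \<alpha> *
      ((\<Prod>k<n. E (\<alpha> 2 - \<eta> + (\<alpha> 3 - \<eta>) + of_nat k * \<tau>) * E (\<alpha> 2 - \<eta> + (\<alpha> 4 - \<eta>) + of_nat k * \<tau>) *
        E (\<alpha> 2 - \<eta> + u + of_nat k * \<tau>)) *
      jackson_prod n M \<eta> \<tau> (shift_params \<eta> \<alpha>))"
proof -
  note notin = independentD[OF ind]
  have b5: "\<alpha> 5 = 2 * (of_nat (Suc M) + 1) * \<eta> + (1 - of_nat n) * \<tau> - \<alpha> 2 - \<alpha> 3 - \<alpha> 4"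
    and b6: "\<alpha> 6 = - 2 * of_nat (Suc M) * \<eta> + (1 - of_nat n) * \<tau> - \<alpha> 1"
    using bal by (simp_all only: balanced_def)
  let ?\<xi> = "site n \<tau> (\<alpha> 1)"
  define D where "D = (\<Prod>i=1..n. E (2 * \<eta> + 2 * \<alpha> 1 + of_nat (n + i - 2) * \<tau>))"
  define r23 where "r23 = (\<Prod>i=1..n. E (2 * \<eta> - \<alpha> 2 - \<alpha> 3 + (1 - of_nat i) * \<tau>))"
  define r24 where "r24 = (\<Prod>i=1..n. E (2 * \<eta> - \<alpha> 2 - \<alpha> 4 + (1 - of_nat i) * \<tau>))"
  define r34 where "r34 = (\<Prod>i=1..n. E (2 * \<eta> - \<alpha> 3 - \<alpha> 4 + (1 - of_nat i) * \<tau>))"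
  define Q where "Q = (\<Prod>i=1..n. E (2 * \<eta> - \<alpha> 1 - \<alpha> 2 - \<alpha> 3 - \<alpha> 4 + (2 - of_nat n - of_nat i) * \<tau>))"
  define d where "d m = (\<Prod>i=1..n. E (2 * \<eta> - \<alpha> m + \<alpha> 1 + of_nat (i - 1) * \<tau>))" for m
  define X5 where "X5 = (\<Prod>i=1..n. E (\<alpha> 5 + ?\<xi> i))"
  define X6 where "X6 = (\<Prod>i=1..n. - E (\<alpha> 6 + ?\<xi> i))"
  have prod_Suc: "jackson_prod n (Suc M) \<eta> \<tau> \<alpha> =
      D * (r23 * r24 * r34) / (Q * (d 2 * d 3 * d 4)) * jackson_prod n M \<eta> \<tau> (shift_params \<eta> \<alpha>)"
    unfolding jackson_prod_Suc D_def r23_def r24_def r34_def Q_def d_def prod.distrib prod_dividef ..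
  have rev: "(\<Prod>k<n. f k) = (\<Prod>i=1..n. g i)" if "\<And>i. 1 \<le> i \<Longrightarrow> i \<le> n \<Longrightarrow> f (n - i) = g i" for f g :: "nat \<Rightarrow> complex"
    unfolding prod_reverse_index[symmetric] using that by (intro prod.cong) auto
  have pred: "(\<Prod>k<n. f k) = (\<Prod>i=1..n. g i)" if "\<And>i. 1 \<le> i \<Longrightarrow> i \<le> n \<Longrightarrow> f (i - 1) = g i" for f g :: "nat \<Rightarrow> complex"
    unfolding prod_pred_index[symmetric] using that by (intro prod.cong) auto
  have B1: "(\<Prod>k<n. E (\<alpha> 5 + \<alpha> 1 + of_nat k * \<tau>)) = X5"
    unfolding X5_def by (rule rev) (simp add: site_def add.assoc)
  have B2: "(\<Prod>k<n. E (\<alpha> 5 + \<alpha> 6 + of_nat k * \<tau>)) = Q"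
    unfolding Q_def
  proof (rule rev)
    fix i assume "1 \<le> i" "i \<le> n"
    then have "\<alpha> 5 + \<alpha> 6 + of_nat (n - i) * \<tau> =
        2 * \<eta> - \<alpha> 1 - \<alpha> 2 - \<alpha> 3 - \<alpha> 4 + (2 - of_nat n - of_nat i) * \<tau>"
      by (simp add: b5 b6 of_nat_diff algebra_simps)
    then show "E (\<alpha> 5 + \<alpha> 6 + of_nat (n - i) * \<tau>) =
        E (2 * \<eta> - \<alpha> 1 - \<alpha> 2 - \<alpha> 3 - \<alpha> 4 + (2 - of_nat n - of_nat i) * \<tau>)"
      by simp
  qed
  have B3: "(\<Prod>k<n. E (\<alpha> 5 + v + of_nat k * \<tau>)) = X6"
    unfolding X6_def
  proof (rule pred)
    fix i assume "1 \<le> i" "i \<le> n"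
    then have "\<alpha> 5 + v + of_nat (i - 1) * \<tau> = - (\<alpha> 6 + ?\<xi> i)"
      using bal by (simp add: v balanced_def site_def of_nat_diff algebra_simps)
    then show "E (\<alpha> 5 + v + of_nat (i - 1) * \<tau>) = - E (\<alpha> 6 + ?\<xi> i)"
      by (simp only: E_minus)
  qed
  have A1: "(\<Prod>k<n. E (\<alpha> 2 - \<eta> + (\<alpha> 3 - \<eta>) + of_nat k * \<tau>)) = (-1) ^ n * r23"
    and A2: "(\<Prod>k<n. E (\<alpha> 2 - \<eta> + (\<alpha> 4 - \<eta>) + of_nat k * \<tau>)) = (-1) ^ n * r24"
  proof -
    have neg: "(\<Prod>k<n. E (a - \<eta> + (b - \<eta>) + of_nat k * \<tau>)) =
        (-1) ^ n * (\<Prod>i=1..n. E (2 * \<eta> - a - b + (1 - of_nat i) * \<tau>))" for a b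
    proof -
      have "(\<Prod>k<n. E (a - \<eta> + (b - \<eta>) + of_nat k * \<tau>)) =
          (\<Prod>i=1..n. (-1) * E (2 * \<eta> - a - b + (1 - of_nat i) * \<tau>))"
      proof (rule pred)
        fix i assume "1 \<le> i" "i \<le> n"
        then have "a - \<eta> + (b - \<eta>) + of_nat (i - 1) * \<tau> = - (2 * \<eta> - a - b + (1 - of_nat i) * \<tau>)"
          by (simp add: of_nat_diff algebra_simps)
        then show "E (a - \<eta> + (b - \<eta>) + of_nat (i - 1) * \<tau>) = (-1) * E (2 * \<eta> - a - b + (1 - of_nat i) * \<tau>)"
          by (simp only: E_minus) simp
      qed
      then show ?thesis by (simp only: prod.distrib prod_constant card_atLeastAtMost) simp
    qed
    show "(\<Prod>k<n. E (\<alpha> 2 - \<eta> + (\<alpha> 3 - \<eta>) + of_nat k * \<tau>)) = (-1) ^ n * r23"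
      "(\<Prod>k<n. E (\<alpha> 2 - \<eta> + (\<alpha> 4 - \<eta>) + of_nat k * \<tau>)) = (-1) ^ n * r24"
      unfolding r23_def r24_def by (rule neg)+
  qed
  have A3: "(\<Prod>k<n. E (\<alpha> 2 - \<eta> + u + of_nat k * \<tau>)) = r34"
    unfolding r34_def
  proof (rule rev)
    fix i assume "1 \<le> i" "i \<le> n"
    then have "\<alpha> 2 - \<eta> + u + of_nat (n - i) * \<tau> = 2 * \<eta> - \<alpha> 3 - \<alpha> 4 + (1 - of_nat i) * \<tau>"
      by (simp add: u of_nat_diff algebra_simps)
    then show "E (\<alpha> 2 - \<eta> + u + of_nat (n - i) * \<tau>) = E (2 * \<eta> - \<alpha> 3 - \<alpha> 4 + (1 - of_nat i) * \<tau>)"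
      by (simp only:)
  qed
  have T: "total_shift n \<eta> \<tau> \<alpha> = D * X5 * X6 / (d 2 * d 3 * d 4)"
  proof -
    have site_shift: "site_shift \<eta> \<alpha> \<xi> = (E (2 * (\<xi> + \<eta>)) * E (\<alpha> 1 + \<xi>) / E (2 * \<xi>)) * E (\<alpha> 5 + \<xi>) * (- E (\<alpha> 6 + \<xi>)) /
        (E (2 * \<eta> - \<alpha> 2 + \<xi>) * E (2 * \<eta> - \<alpha> 3 + \<xi>) * E (2 * \<eta> - \<alpha> 4 + \<xi>))" for \<xi>
      by (simp add: site_shift_def mult_ac)
    have d: "(\<Prod>i=1..n. E (2 * \<eta> - \<alpha> m + ?\<xi> i)) = d m" for m
    proof -
      have "(\<Prod>i=1..n. E (2 * \<eta> - \<alpha> m + ?\<xi> i)) = (\<Prod>k<n. E (2 * \<eta> - \<alpha> m + \<alpha> 1 + of_nat k * \<tau>))"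
        by (rule rev[symmetric]) (simp add: site_def algebra_simps)
      also have "\<dots> = d m"
        unfolding d_def by (rule pred) simp
      finally show ?thesis .
    qed
    have nz: "2 * \<alpha> 1 + of_nat r * \<tau> \<notin> lattice" "2 * \<eta> + 2 * \<alpha> 1 + of_nat r * \<tau> \<notin> lattice" for r
      by (rule notin[of _ 0 "int r" 2 0 0 0];
          simp add: algebra_simps)
         (rule notin[of _ 2 "int r" 2 0 0 0];
          simp add: algebra_simps)
    have "(\<Prod>k<n. E (2 * \<eta> + 2 * \<alpha> 1 + of_nat (2 * k) * \<tau>) * E (2 * \<alpha> 1 + of_nat k * \<tau>) / E (2 * \<alpha> 1 + of_nat (2 * k) * \<tau>)) =
        (\<Prod>i=1..n. E (2 * (?\<xi> i + \<eta>)) * E (\<alpha> 1 + ?\<xi> i) / E (2 * ?\<xi> i))"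
      by (rule rev) (simp add: site_def algebra_simps)
    moreover have "(\<Prod>(j, k)\<in>index_pairs 1 n. pair_shift (2 * \<eta>) \<tau> (2 * \<alpha> 1 + of_nat ((n - j) + (n - k)) * \<tau>)) =
        (\<Prod>(j, k)\<in>index_pairs 1 n. pair_shift (2 * \<eta>) \<tau> (?\<xi> j + ?\<xi> k))"
      by (simp add: site_def algebra_simps)
    ultimately have "(\<Prod>i=1..n. E (2 * (?\<xi> i + \<eta>)) * E (\<alpha> 1 + ?\<xi> i) / E (2 * ?\<xi> i)) *
        (\<Prod>(j, k)\<in>index_pairs 1 n. pair_shift (2 * \<eta>) \<tau> (?\<xi> j + ?\<xi> k)) = D"
      using shift_telescope[of "2 * \<alpha> 1" \<tau> "2 * \<eta>" n] nz unfolding D_def E_eq_0_iff by simp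
    moreover have "p * x5 * x6 / dd * pr = (p * pr) * x5 * x6 / dd" for p x5 x6 dd pr :: complex
      by simp
    ultimately show ?thesis
      unfolding total_shift_def site_shift prod.distrib[of _ _ "{1..n}"] prod_dividef[of _ _ "{1..n}"] d X5_def X6_def
      by (simp only:)
  qed
  have Q: "Q \<noteq> 0"
  proof -
    have "2 * \<eta> - \<alpha> 1 - \<alpha> 2 - \<alpha> 3 - \<alpha> 4 + (2 - of_nat n - of_nat i) * \<tau> \<notin> lattice" for i
      by (rule notin[of _ 2 "2 - int n - int i" "-1" "-1" "-1" "-1"]) simp_all
    then show ?thesis unfolding Q_def by (simp add: E_eq_0_iff)
  qed
  \<comment> \<open>the reflections in \<open>A1\<close> and \<open>A2\<close> contribute the same sign\<close>
  have sq: "(-1) ^ n * ((-1) ^ n :: complex) = 1"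
    by (simp flip: power_mult_distrib)
  have "x5 * Q * x6 * (D * (a * b * c) / (Q * dd) * j) = D * x5 * x6 / dd * ((-1) ^ n * a * ((-1) ^ n * b) * c * j)"
    for x5 x6 a b c dd j
  proof -
    have "(-1) ^ n * a * ((-1) ^ n * b) * c * j = ((-1) ^ n * ((-1) ^ n)) * (a * b * c * j)"
      by (simp add: mult_ac)
    then show ?thesis using Q by (simp add: sq)
  qed
  then show ?thesis
    unfolding prod.distrib B1 B2 B3 A1 A2 A3 T prod_Suc .
qed

text \<open>Discrete summation by parts: both sides are sums over the pairs of neighbouring points of the two
lattices, extended by terms that vanish.\<close>

lemma sum_exchange:
  assumes ind: "independent \<eta> \<tau> \<alpha>" and bal: "balanced n (Suc M) \<eta> \<tau> \<alpha>" and n: "1 \<le> n"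
    and uv: "u + v = \<eta>"
  shows "(\<Sum>\<nu>\<in>partition_tuples n (Suc M). weight n (2 * \<eta>) \<tau> \<alpha> \<nu> * (\<Sum>S\<in>Pow {1..n}.
      signed_term n \<tau> (\<alpha> 5) (\<alpha> 1) (\<alpha> 6) v (\<lambda>i. - position n \<eta> \<tau> (\<alpha> 1) \<nu> i) S)) =
    total_shift n \<eta> \<tau> \<alpha> * (\<Sum>\<mu>\<in>partition_tuples n M. weight n (2 * \<eta>) \<tau> (shift_params \<eta> \<alpha>) \<mu> * (\<Sum>S\<in>Pow {1..n}.
      signed_term n \<tau> (\<alpha> 2 - \<eta>) (\<alpha> 3 - \<eta>) (\<alpha> 4 - \<eta>) u (position n \<eta> \<tau> (\<alpha> 1 + \<eta>) \<mu>) S))"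
proof -
  let ?C = "total_shift n \<eta> \<tau> \<alpha>"
  define F where "F \<nu> S = weight n (2 * \<eta>) \<tau> \<alpha> \<nu> *
      signed_term n \<tau> (\<alpha> 5) (\<alpha> 1) (\<alpha> 6) v (\<lambda>i. - position n \<eta> \<tau> (\<alpha> 1) \<nu> i) S" for \<nu> S
  define F' where "F' \<mu> S = weight n (2 * \<eta>) \<tau> (shift_params \<eta> \<alpha>) \<mu> *
      signed_term n \<tau> (\<alpha> 2 - \<eta>) (\<alpha> 3 - \<eta>) (\<alpha> 4 - \<eta>) u (position n \<eta> \<tau> (\<alpha> 1 + \<eta>) \<mu>) S" for \<mu> S
  let ?P = "partition_tuples n (Suc M) \<times> Pow {1..n}" and ?P' = "partition_tuples n M \<times> Pow {1..n}"
  let ?V = "{(\<mu>, S) \<in> ?P'. add_indicator n \<mu> S \<in> partition_tuples n (Suc M)}"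
  let ?h = "\<lambda>(\<mu>, S). (add_indicator n \<mu> S, S)"
  have fin: "finite ?P" "finite ?P'" by (auto simp: finite_partition_tuples)
  have inj: "inj_on ?h ?V"
  proof (rule inj_onI)
    fix z z' assume z: "z \<in> ?V" "z' \<in> ?V" "?h z = ?h z'"
    obtain \<mu> S \<mu>' S' where zz: "z = (\<mu>, S)" "z' = (\<mu>', S')" by (metis surj_pair)
    from z have "\<mu> \<in> {1..n} \<rightarrow>\<^sub>E {0..M}" "\<mu>' \<in> {1..n} \<rightarrow>\<^sub>E {0..M}" "S = S'"
      "add_indicator n \<mu> S = add_indicator n \<mu>' S"
      unfolding zz by (auto simp: partition_tuples_def)
    with inj_add_indicator[of \<mu> n "{0..M}" \<mu>' S] show "z = z'" by (simp add: zz)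
  qed
  have "(\<Sum>\<nu>\<in>partition_tuples n (Suc M). \<Sum>S\<in>Pow {1..n}. F \<nu> S) = (\<Sum>(\<nu>, S)\<in>?P. F \<nu> S)"
    by (rule sum.cartesian_product)
  also have "\<dots> = (\<Sum>(\<nu>, S)\<in>?h ` ?V. F \<nu> S)"
  proof (rule sum.mono_neutral_right[OF fin(1)])
    show "\<forall>z\<in>?P - ?h ` ?V. (case z of (\<nu>, S) \<Rightarrow> F \<nu> S) = 0"
    proof safe
      fix \<nu> S assume \<nu>: "\<nu> \<in> partition_tuples n (Suc M)" "S \<subseteq> {1..n}" "(\<nu>, S) \<notin> ?h ` ?V"
      have "\<nexists>\<mu>. \<mu> \<in> partition_tuples n M \<and> \<nu> = add_indicator n \<mu> S"
      proof
        assume "\<exists>\<mu>. \<mu> \<in> partition_tuples n M \<and> \<nu> = add_indicator n \<mu> S"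
        then obtain \<mu> where "\<mu> \<in> partition_tuples n M" "\<nu> = add_indicator n \<mu> S" by blast
        with \<nu> have "(\<mu>, S) \<in> ?V" "(\<nu>, S) = ?h (\<mu>, S)" by auto
        with \<nu>(3) show False by blast
      qed
      from lower_term_eq_0[OF \<nu>(1) n bal this] show "F \<nu> S = 0" by (simp add: F_def)
    qed
  qed auto
  also have "\<dots> = (\<Sum>(\<mu>, S)\<in>?V. F (add_indicator n \<mu> S) S)"
    by (subst sum.reindex[OF inj]) (auto intro: sum.cong)
  also have "\<dots> = (\<Sum>(\<mu>, S)\<in>?V. ?C * F' \<mu> S)"
  proof (rule sum.cong[OF refl], clarify)
    fix \<mu> S assume "\<mu> \<in> partition_tuples n M" "add_indicator n \<mu> S \<in> partition_tuples n (Suc M)"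
    from detailed_balance[OF ind bal this(1) refl this(2) uv]
    show "F (add_indicator n \<mu> S) S = ?C * F' \<mu> S"
      by (simp add: F_def F'_def)
  qed
  also have "\<dots> = (\<Sum>(\<mu>, S)\<in>?P'. ?C * F' \<mu> S)"
  proof (rule sum.mono_neutral_left[OF fin(2)])
    show "\<forall>z\<in>?P' - ?V. (case z of (\<mu>, S) \<Rightarrow> ?C * F' \<mu> S) = 0"
    proof
      fix z assume z: "z \<in> ?P' - ?V"
      obtain \<mu> S where zz: "z = (\<mu>, S)" by (metis surj_pair)
      from z have "\<mu> \<in> partition_tuples n M" "add_indicator n \<mu> S \<notin> partition_tuples n (Suc M)"
        unfolding zz by auto
      from upper_term_eq_0[OF this] show "(case z of (\<mu>, S) \<Rightarrow> ?C * F' \<mu> S) = 0"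
        by (simp add: zz F'_def)
    qed
  qed auto
  also have "\<dots> = (\<Sum>\<mu>\<in>partition_tuples n M. \<Sum>S\<in>Pow {1..n}. ?C * F' \<mu> S)"
    by (rule sum.cartesian_product[symmetric])
  finally show ?thesis
    by (simp only: F_def F'_def sum_distrib_left)
qed

lemma partition_tuples_0: "partition_tuples n 0 = {\<lambda>i\<in>{1..n}. 0}"
proof -
  have "\<nu> = (\<lambda>i\<in>{1..n}. 0)" if "\<nu> \<in> partition_tuples n 0" for \<nu>
    using that by (intro extensionalityI[of _ "{1..n}"]) (auto simp: partition_tuples_def PiE_iff)
  then show ?thesis by (auto simp: partition_tuples_def)
qed

text \<open>By \<open>signed_sum\<close> both inner sums of \<open>sum_exchange\<close> are constants, so the two lattice sums are proportional.
In the sign sum on the upper lattice \<open>\<alpha> 5\<close> takes the role of the distinguished parameter \<open>u0\<close>, since \<open>\<alpha> 1\<close>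
and \<open>\<alpha> 6\<close> are not in general position with respect to the lattice points.\<close>

theorem jackson_sum_eq_prod:
  assumes "independent \<eta> \<tau> \<alpha>" "balanced n N \<eta> \<tau> \<alpha>" "1 \<le> n"
  shows "jackson_sum n N \<eta> \<tau> \<alpha> = jackson_prod n N \<eta> \<tau> \<alpha>"
  using assms
proof (induction N arbitrary: \<alpha>)
  case 0
  note notin = independentD[OF 0(1)]
  let ?\<xi> = "site n \<tau> (\<alpha> 1)"
  have "2 * ?\<xi> i \<notin> lattice" for i
    by (rule notin[of _ 0 "2 * int (n - i)" 2 0 0 0])
       (simp_all add: site_def algebra_simps)
  then have site: "site_weight (2 * \<eta>) \<alpha> (?\<xi> i) 0 = 1" for i
    by (simp add: site_weight_def param_factor_def E_eq_0_iff)
  have pair: "pair_weight (2 * \<eta>) \<tau> (?\<xi> j) (?\<xi> k) 0 0 = 1" if "(j, k) \<in> index_pairs 1 n" for j k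
  proof -
    have "?\<xi> j + ?\<xi> k \<notin> lattice"
      by (rule notin[of _ 0 "int (n - j) + int (n - k)" 2 0 0 0])
         (simp_all add: site_def algebra_simps)
    moreover have "?\<xi> j - ?\<xi> k \<notin> lattice"
      by (rule notin[of _ 0 "int k - int j" 0 0 0 0])
         (use that in \<open>auto simp: index_pairs_def site_def of_nat_diff algebra_simps\<close>)
    ultimately show ?thesis
      by (simp add: pair_weight_def pair_factor_def E_eq_0_iff)
  qed
  have "(\<Prod>(j, k)\<in>index_pairs 1 n. pair_weight (2 * \<eta>) \<tau> (?\<xi> j) (?\<xi> k)
      ((\<lambda>i\<in>{1..n}. 0) j) ((\<lambda>i\<in>{1..n}. 0) k)) = 1"
    using pair by (intro prod.neutral) (auto simp: index_pairs_def)
  then show ?case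
    using site by (simp add: jackson_sum_def partition_tuples_0 weight_def jackson_prod_def)
next
  case (Suc M)
  let ?x = "position n \<eta> \<tau> (\<alpha> 1)" and ?y = "position n \<eta> \<tau> (\<alpha> 1 + \<eta>)"
  note ind = Suc.prems(1) and bal = Suc.prems(2) and n = Suc.prems(3)
  note notin = independentD[OF ind] and coords = position_def site_def algebra_simps
  have b5: "\<alpha> 5 = 2 * (of_nat (Suc M) + 1) * \<eta> + (1 - of_nat n) * \<tau> - \<alpha> 2 - \<alpha> 3 - \<alpha> 4"
    and b6: "\<alpha> 6 = - 2 * of_nat (Suc M) * \<eta> + (1 - of_nat n) * \<tau> - \<alpha> 1"
    using bal by (simp_all only: balanced_def)
  define v where "v = \<tau> - of_nat n * \<tau> - (\<alpha> 1 + \<alpha> 5 + \<alpha> 6)"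
  define u where "u = \<tau> - of_nat n * \<tau> - (\<alpha> 2 + \<alpha> 3 + \<alpha> 4 - 3 * \<eta>)"
  have uv: "u + v = \<eta>"
    by (simp add: u_def v_def b5 b6 algebra_simps)
  define RB where "RB = (\<Prod>k<n. E (\<alpha> 5 + \<alpha> 1 + of_nat k * \<tau>) * E (\<alpha> 5 + \<alpha> 6 + of_nat k * \<tau>) * E (\<alpha> 5 + v + of_nat k * \<tau>))"
  define RA where "RA = (\<Prod>k<n. E (\<alpha> 2 - \<eta> + (\<alpha> 3 - \<eta>) + of_nat k * \<tau>) * E (\<alpha> 2 - \<eta> + (\<alpha> 4 - \<eta>) + of_nat k * \<tau>) *
        E (\<alpha> 2 - \<eta> + u + of_nat k * \<tau>))"
  have B: "(\<Sum>S\<in>Pow {1..n}. signed_term n \<tau> (\<alpha> 5) (\<alpha> 1) (\<alpha> 6) v (\<lambda>i. - ?x \<nu> i) S) = RB" for \<nu>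
    unfolding RB_def
  proof (rule signed_sum)
    show "\<alpha> 5 + \<alpha> 1 + \<alpha> 6 + v + of_nat n * \<tau> = \<tau>" by (simp add: v_def)
    show "2 * - ?x \<nu> i \<notin> lattice" for i
      by (rule notin[of _ "- 4 * int (\<nu> i)" "- 2 * int (n - i)" "-2" 0 0 0])
         (simp_all add: coords)
    show "2 * (\<alpha> 5 + of_nat k * \<tau>) \<notin> lattice" for k
      by (rule notin[of _ "4 * (int M + 2)" "2 * (1 - int n + int k)" 0 "-2" "-2" "-2"])
         (simp_all add: b5 b6 algebra_simps)
    fix i j assume ij: "i \<in> {1..n}" "j \<in> {1..n}" "i \<noteq> j"
    have "- ?x \<nu> i - - ?x \<nu> j \<notin> lattice"
      by (rule notin[of _ "2 * int (\<nu> j) - 2 * int (\<nu> i)" "int i - int j" 0 0 0 0])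
         (use ij in \<open>simp_all add: of_nat_diff coords\<close>)
    moreover have "- ?x \<nu> i + - ?x \<nu> j \<notin> lattice"
      by (rule notin[of _ "- 2 * int (\<nu> j) - 2 * int (\<nu> i)" "int i + int j - 2 * int n" "-2" 0 0 0])
         (use ij in \<open>simp_all add: of_nat_diff coords\<close>)
    ultimately show "- ?x \<nu> i - - ?x \<nu> j \<notin> lattice \<and>
        - ?x \<nu> i + - ?x \<nu> j \<notin> lattice" by blast
  next
    fix k i :: nat
    have "\<alpha> 5 + of_nat k * \<tau> + - ?x \<nu> i \<notin> lattice"
      by (rule notin[of _ "2 * (int M + 2) - 2 * int (\<nu> i)" "1 - int n + int k - int (n - i)" "-1" "-1" "-1" "-1"])
         (simp_all add: b5 b6 coords)
    moreover have "\<alpha> 5 + of_nat k * \<tau> - - ?x \<nu> i \<notin> lattice"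
      by (rule notin[of _ "2 * (int M + 2) + 2 * int (\<nu> i)" "1 - int n + int k + int (n - i)" 1 "-1" "-1" "-1"])
         (simp_all add: b5 b6 coords)
    ultimately show "\<alpha> 5 + of_nat k * \<tau> + - ?x \<nu> i \<notin> lattice \<and>
       \<alpha> 5 + of_nat k * \<tau> - - ?x \<nu> i \<notin> lattice" by blast
  qed
  have A: "(\<Sum>S\<in>Pow {1..n}. signed_term n \<tau> (\<alpha> 2 - \<eta>) (\<alpha> 3 - \<eta>) (\<alpha> 4 - \<eta>) u (?y \<mu>) S) = RA" for \<mu>
    unfolding RA_def
  proof (rule signed_sum)
    show "\<alpha> 2 - \<eta> + (\<alpha> 3 - \<eta>) + (\<alpha> 4 - \<eta>) + u + of_nat n * \<tau> = \<tau>" by (simp add: u_def)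
    show "2 * ?y \<mu> i \<notin> lattice" for i
      by (rule notin[of _ "4 * int (\<mu> i) + 2" "2 * int (n - i)" 2 0 0 0])
         (simp_all add: coords)
    show "2 * (\<alpha> 2 - \<eta> + of_nat k * \<tau>) \<notin> lattice" for k
      by (rule notin[of _ "-2" "2 * int k" 0 2 0 0])
         (simp_all add: algebra_simps)
    fix i j assume ij: "i \<in> {1..n}" "j \<in> {1..n}" "i \<noteq> j"
    have "?y \<mu> i - ?y \<mu> j \<notin> lattice"
      by (rule notin[of _ "2 * int (\<mu> i) - 2 * int (\<mu> j)" "int j - int i" 0 0 0 0])
         (use ij in \<open>simp_all add: of_nat_diff coords\<close>)
    moreover have "?y \<mu> i + ?y \<mu> j \<notin> lattice"
      by (rule notin[of _ "2 + 2 * int (\<mu> j) + 2 * int (\<mu> i)" "2 * int n - int i - int j" 2 0 0 0])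
         (use ij in \<open>simp_all add: of_nat_diff coords\<close>)
    ultimately show "?y \<mu> i - ?y \<mu> j \<notin> lattice \<and>
        ?y \<mu> i + ?y \<mu> j \<notin> lattice" by blast
  next
    fix k i :: nat
    have "\<alpha> 2 - \<eta> + of_nat k * \<tau> + ?y \<mu> i \<notin> lattice"
      by (rule notin[of _ "2 * int (\<mu> i)" "int k + int (n - i)" 1 1 0 0])
         (simp_all add: coords)
    moreover have "\<alpha> 2 - \<eta> + of_nat k * \<tau> - ?y \<mu> i \<notin> lattice"
      by (rule notin[of _ "- 2 - 2 * int (\<mu> i)" "int k - int (n - i)" "-1" 1 0 0])
         (simp_all add: coords)
    ultimately show "\<alpha> 2 - \<eta> + of_nat k * \<tau> + ?y \<mu> i \<notin> lattice \<and>
       \<alpha> 2 - \<eta> + of_nat k * \<tau> - ?y \<mu> i \<notin> lattice" by blast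
  qed
  have RB0: "RB \<noteq> 0"
  proof -
    have "\<alpha> 5 + \<alpha> 1 + of_nat k * \<tau> \<notin> lattice" for k
      by (rule notin[of _ "2 * (int M + 2)" "1 - int n + int k" 1 "-1" "-1" "-1"])
         (simp_all add: b5 b6 algebra_simps)
    moreover have "\<alpha> 5 + \<alpha> 6 + of_nat k * \<tau> \<notin> lattice" for k
      by (rule notin[of _ 2 "2 - 2 * int n + int k" "-1" "-1" "-1" "-1"])
         (simp_all add: b5 b6 algebra_simps)
    moreover have "\<alpha> 5 + v + of_nat k * \<tau> \<notin> lattice" for k
      by (rule notin[of _ "2 * (int M + 1)" "int k" 0 0 0 0])
         (simp_all add: v_def b5 b6 algebra_simps)
    ultimately show ?thesis by (simp add: RB_def E_eq_0_iff)
  qed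
  have "RB * jackson_sum n (Suc M) \<eta> \<tau> \<alpha> = total_shift n \<eta> \<tau> \<alpha> * (RA * jackson_sum n M \<eta> \<tau> (shift_params \<eta> \<alpha>))"
    using sum_exchange[OF ind bal n uv] unfolding A B jackson_sum_def sum_distrib_right[symmetric]
    by (simp only: mult.commute)
  also have "jackson_sum n M \<eta> \<tau> (shift_params \<eta> \<alpha>) = jackson_prod n M \<eta> \<tau> (shift_params \<eta> \<alpha>)"
    by (rule Suc.IH[OF independent_shift[OF ind] balanced_shift[OF bal] n])
  also have "total_shift n \<eta> \<tau> \<alpha> * (RA * \<dots>) = RB * jackson_prod n (Suc M) \<eta> \<tau> \<alpha>"
    unfolding RA_def RB_def by (rule step_identity[OF ind bal v_def u_def, symmetric])
  finally show ?case using RB0 by simp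
qed

end

section \<open>Return to the multiplicative form\<close>

definition theta_term where
  "theta_term n p q t a \<xi> \<nu> =
        (\<Prod>i=1..n. (q * t ^ (2 * (i - 1))) ^ \<nu> i
            * (theta (q ^ (2 * \<nu> i) * (\<xi> i)^2) p / theta ((\<xi> i)^2) p))
      * (\<Prod>(j, k)\<in>index_pairs 1 n.
            (theta (q ^ (\<nu> j - \<nu> k) * \<xi> j / \<xi> k) p * theta (q ^ (\<nu> j + \<nu> k) * \<xi> j * \<xi> k) p)
          / (theta (\<xi> j / \<xi> k) p * theta (\<xi> j * \<xi> k) p))
      * (\<Prod>i=1..n. \<Prod>m=1..6.
            theta_fact (a m * \<xi> i) p q (\<nu> i)
          / theta_fact (q * inverse (a m) * \<xi> i) p q (\<nu> i))
      * (\<Prod>(j, k)\<in>index_pairs 1 n.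
            (theta_fact (t * \<xi> j / \<xi> k) p q (\<nu> j - \<nu> k)
              * theta_fact (t * \<xi> j * \<xi> k) p q (\<nu> j + \<nu> k))
          / (theta_fact (q * inverse t * \<xi> j / \<xi> k) p q (\<nu> j - \<nu> k)
              * theta_fact (q * inverse t * \<xi> j * \<xi> k) p q (\<nu> j + \<nu> k)))"
  for a \<xi> :: "nat \<Rightarrow> complex"

definition theta_product where
  "theta_product n N p q t a = (\<Prod>i=1..n.
        (theta_fact (q * (a 1)^2 * t ^ (n + i - 2)) p q N
          * (\<Prod>(j, k)\<in>index_pairs 2 4.
               theta_fact (q * inverse (a j) * inverse (a k) * t powi (1 - int i)) p q N))
      / (theta_fact (q * inverse (a 1) * inverse (a 2) * inverse (a 3) * inverse (a 4)
                       * t powi (2 - int n - int i)) p q N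
          * (\<Prod>m=2..4. theta_fact (q * inverse (a m) * a 1 * t ^ (i - 1)) p q N)))"
  for a :: "nat \<Rightarrow> complex"

lemma prod_index_pairs_fst:
  "(\<Prod>(j, k)\<in>index_pairs 1 n. f j) = (\<Prod>j=1..n. f j ^ (n - j))"
proof (induction n)
  case 0
  have "index_pairs 1 0 = {}" by (auto simp: index_pairs_def)
  then show ?case by simp
next
  case (Suc n)
  have "(\<Prod>(j, k)\<in>index_pairs 1 (Suc n). f j) = (\<Prod>j=1..n. f j ^ (n - j)) * (\<Prod>j=1..n. f j)"
    unfolding prod_index_pairs_Suc[of "\<lambda>j k. f j"] Suc ..
  also have "\<dots> = (\<Prod>j=1..n. f j ^ (Suc n - j))"
    unfolding prod.distrib[symmetric] by (intro prod.cong) (auto simp: Suc_diff_le mult.commute)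
  finally show ?case by simp
qed

lemma index_pairs_2_4: "index_pairs 2 4 = {(2, 3), (2, 4), (3, 4)}"
  by (auto simp: index_pairs_def)

context theta_lattice
begin

lemma theta_ratio: "theta (exp z) p / theta (exp z') p = exp ((z - z') / 2) * (E z / E z')"
  by (simp add: theta_exp diff_divide_distrib exp_diff)

text \<open>The product that does not depend on \<open>z\<close> cancels in every balanced quotient.\<close>

lemma theta_fact_exp:
  "theta_fact (exp z) p (exp \<kappa>) k = exp (of_nat k * z / 2) * (\<Prod>i<k. exp (of_nat i * \<kappa> / 2)) * Efact \<kappa> z k"
proof -
  have "theta (exp \<kappa> ^ i * exp z) p = exp (z / 2) * exp (of_nat i * \<kappa> / 2) * E (z + of_nat i * \<kappa>)" for i
  proof -
    have arg: "exp \<kappa> ^ i * exp z = exp (z + of_nat i * \<kappa>)"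
      by (simp add: exp_add exp_of_nat_mult)
    show ?thesis
      unfolding arg theta_exp by (simp add: add_divide_distrib exp_add)
  qed
  then have "theta_fact (exp z) p (exp \<kappa>) k =
      (\<Prod>i<k. exp (z / 2)) * (\<Prod>i<k. exp (of_nat i * \<kappa> / 2)) * Efact \<kappa> z k"
    by (simp add: theta_fact_def Efact_def prod.distrib)
  also have "(\<Prod>i<k. exp (z / 2)) = exp (of_nat k * z / 2)"
    by (simp flip: exp_of_nat_mult)
  finally show ?thesis .
qed

lemma theta_fact_ratio:
  "theta_fact (exp z) p (exp \<kappa>) k / theta_fact (exp z') p (exp \<kappa>) k =
     exp (of_nat k * (z - z') / 2) * (Efact \<kappa> z k / Efact \<kappa> z' k)"
proof -
  have "exp (of_nat k * (z - z') / 2) = exp (of_nat k * z / 2) / exp (of_nat k * z' / 2)"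
    by (simp add: right_diff_distrib diff_divide_distrib exp_diff)
  moreover have "(\<Prod>i<k. exp (of_nat i * \<kappa> / 2)) \<noteq> 0"
    by simp
  ultimately show ?thesis
    unfolding theta_fact_exp by simp
qed

text \<open>Passing to \<open>E\<close> absorbs the power of \<open>q\<close> and leaves a power of \<open>t\<close>, which the pairs \<open>(i, k)\<close> with \<open>i < k\<close>
will compensate; there are \<open>n - i\<close> of them.\<close>

lemma site_term_exp:
  assumes "\<alpha> 1 + \<alpha> 2 + \<alpha> 3 + \<alpha> 4 + \<alpha> 5 + \<alpha> 6 = 2 * \<eta> + (2 - 2 * of_nat n) * \<tau>" "1 \<le> i" "i \<le> n"
  shows "(exp (2 * \<eta>) * exp \<tau> ^ (2 * (i - 1))) ^ k *
      (theta (exp (2 * \<eta>) ^ (2 * k) * (exp \<xi>)\<^sup>2) p / theta ((exp \<xi>)\<^sup>2) p) *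
      (\<Prod>m=1..6. theta_fact (exp (\<alpha> m) * exp \<xi>) p (exp (2 * \<eta>)) k /
        theta_fact (exp (2 * \<eta>) * inverse (exp (\<alpha> m)) * exp \<xi>) p (exp (2 * \<eta>)) k) =
      inverse (exp (2 * of_nat k * \<tau>) ^ (n - i)) * site_weight (2 * \<eta>) \<alpha> \<xi> k"
proof -
  let ?q = "exp (2 * \<eta>)"
  have "(?q * exp \<tau> ^ (2 * (i - 1))) ^ k = exp (of_nat k * (2 * \<eta> + of_nat (2 * (i - 1)) * \<tau>))"
    by (simp only: exp_of_nat_mult exp_add)
  moreover have "theta (?q ^ (2 * k) * (exp \<xi>)\<^sup>2) p / theta ((exp \<xi>)\<^sup>2) p =
      exp (of_nat k * (2 * \<eta>)) * (E (2 * (\<xi> + of_nat k * (2 * \<eta>))) / E (2 * \<xi>))"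
  proof -
    have arg: "?q ^ (2 * k) * (exp \<xi>)\<^sup>2 = exp (2 * (\<xi> + of_nat k * (2 * \<eta>)))" "(exp \<xi>)\<^sup>2 = exp (2 * \<xi>)"
      by (simp_all add: exp_add algebra_simps flip: exp_of_nat_mult exp_double)
    show ?thesis
      unfolding arg(1) unfolding arg(2) theta_ratio by (simp add: algebra_simps)
  qed
  moreover have "(\<Prod>m=1..6. theta_fact (exp (\<alpha> m) * exp \<xi>) p (?q) k /
        theta_fact (?q * inverse (exp (\<alpha> m)) * exp \<xi>) p (?q) k) =
      exp (of_nat k * (\<alpha> 1 + \<alpha> 2 + \<alpha> 3 + \<alpha> 4 + \<alpha> 5 + \<alpha> 6 - 6 * \<eta>)) * (\<Prod>m=1..6. param_factor (2 * \<eta>) (\<alpha> m) \<xi> k)"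
  proof -
    have "theta_fact (exp (\<alpha> m) * exp \<xi>) p (?q) k /
        theta_fact (?q * inverse (exp (\<alpha> m)) * exp \<xi>) p (?q) k =
        exp (of_nat k * (\<alpha> m - \<eta>)) * param_factor (2 * \<eta>) (\<alpha> m) \<xi> k" for m
    proof -
      have arg: "exp (\<alpha> m) * exp \<xi> = exp (\<alpha> m + \<xi>)" "?q * inverse (exp (\<alpha> m)) * exp \<xi> = exp (2 * \<eta> - \<alpha> m + \<xi>)"
        by (simp_all add: exp_add exp_diff field_simps)
      have exponent: "of_nat k * (\<alpha> m + \<xi> - (2 * \<eta> - \<alpha> m + \<xi>)) / 2 = of_nat k * (\<alpha> m - \<eta>)"
        by (simp add: field_simps)
      show ?thesis
        unfolding arg theta_fact_ratio param_factor_def exponent ..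
    qed
    then have "(\<Prod>m=1..6. theta_fact (exp (\<alpha> m) * exp \<xi>) p (?q) k /
        theta_fact (?q * inverse (exp (\<alpha> m)) * exp \<xi>) p (?q) k) =
      (\<Prod>m=1..6. exp (of_nat k * (\<alpha> m - \<eta>))) * (\<Prod>m=1..6. param_factor (2 * \<eta>) (\<alpha> m) \<xi> k)"
      by (simp only: prod.distrib)
    also have "(\<Prod>m=1..6. exp (of_nat k * (\<alpha> m - \<eta>))) =
        exp (of_nat k * (\<alpha> 1 + \<alpha> 2 + \<alpha> 3 + \<alpha> 4 + \<alpha> 5 + \<alpha> 6 - 6 * \<eta>))"
      unfolding prod_1_6 exp_add[symmetric] by (rule arg_cong[of _ _ exp]) (simp add: algebra_simps)
    finally show ?thesis .
  qed
  moreover have "exp (of_nat k * (2 * \<eta> + of_nat (2 * (i - 1)) * \<tau>)) * exp (of_nat k * (2 * \<eta>)) *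
      exp (of_nat k * (\<alpha> 1 + \<alpha> 2 + \<alpha> 3 + \<alpha> 4 + \<alpha> 5 + \<alpha> 6 - 6 * \<eta>)) =
      inverse (exp (2 * of_nat k * \<tau>) ^ (n - i))"
    unfolding assms(1) exp_add[symmetric] exp_of_nat_mult[symmetric] exp_minus[symmetric]
    by (rule arg_cong[of _ _ exp]) (use assms(2,3) in \<open>simp add: of_nat_diff algebra_simps\<close>)
  moreover have "c1 * (c2 * w) * (c3 * x) = (c1 * c2 * c3) * (w * x)" for c1 c2 c3 w x :: complex
    by simp
  ultimately show ?thesis
    unfolding site_weight_def by (simp only:)
qed

lemma pair_term_exp:
  assumes "k' \<le> k"
  shows "(theta (exp (2 * \<eta>) ^ (k - k') * exp \<xi> / exp \<xi>') p * theta (exp (2 * \<eta>) ^ (k + k') * exp \<xi> * exp \<xi>') p)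
          / (theta (exp \<xi> / exp \<xi>') p * theta (exp \<xi> * exp \<xi>') p) *
      ((theta_fact (exp \<tau> * exp \<xi> / exp \<xi>') p (exp (2 * \<eta>)) (k - k')
              * theta_fact (exp \<tau> * exp \<xi> * exp \<xi>') p (exp (2 * \<eta>)) (k + k'))
          / (theta_fact (exp (2 * \<eta>) * inverse (exp \<tau>) * exp \<xi> / exp \<xi>') p (exp (2 * \<eta>)) (k - k')
              * theta_fact (exp (2 * \<eta>) * inverse (exp \<tau>) * exp \<xi> * exp \<xi>') p (exp (2 * \<eta>)) (k + k'))) =
      exp (2 * of_nat k * \<tau>) * pair_weight (2 * \<eta>) \<tau> \<xi> \<xi>' k k'"
proof -
  let ?q = "exp (2 * \<eta>)"
  have factor: "theta (?q ^ d * exp z) p / theta (exp z) p *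
      (theta_fact (exp \<tau> * exp z) p (?q) d / theta_fact (?q * inverse (exp \<tau>) * exp z) p (?q) d) =
      exp (of_nat d * \<tau>) * pair_factor (2 * \<eta>) \<tau> z d" for d z
  proof -
    have arg: "?q ^ d * exp z = exp (z + of_nat d * (2 * \<eta>))" "exp \<tau> * exp z = exp (\<tau> + z)"
      "?q * inverse (exp \<tau>) * exp z = exp (2 * \<eta> - \<tau> + z)"
      by (simp_all only: exp_add exp_diff exp_of_nat_mult) (simp_all add: field_simps)
    have e: "exp ((z + of_nat d * (2 * \<eta>) - z) / 2) * exp (of_nat d * (\<tau> + z - (2 * \<eta> - \<tau> + z)) / 2) = exp (of_nat d * \<tau>)"
      unfolding exp_add[symmetric] by (rule arg_cong[of _ _ exp]) (simp add: field_simps)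
    have r: "c * a * (c' * b) = c * c' * (a * b)" for a b c c' :: complex
      by simp
    show ?thesis
      unfolding arg theta_ratio theta_fact_ratio pair_factor_def by (rule trans[OF r]) (simp only: e)
  qed
  have args: "?q ^ (k - k') * exp \<xi> / exp \<xi>' = ?q ^ (k - k') * exp (\<xi> - \<xi>')"
    "?q ^ (k + k') * exp \<xi> * exp \<xi>' = ?q ^ (k + k') * exp (\<xi> + \<xi>')"
    "exp \<xi> / exp \<xi>' = exp (\<xi> - \<xi>')" "exp \<xi> * exp \<xi>' = exp (\<xi> + \<xi>')"
    "exp \<tau> * exp \<xi> / exp \<xi>' = exp \<tau> * exp (\<xi> - \<xi>')" "exp \<tau> * exp \<xi> * exp \<xi>' = exp \<tau> * exp (\<xi> + \<xi>')"
    "?q * inverse (exp \<tau>) * exp \<xi> / exp \<xi>' = ?q * inverse (exp \<tau>) * exp (\<xi> - \<xi>')"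
    "?q * inverse (exp \<tau>) * exp \<xi> * exp \<xi>' = ?q * inverse (exp \<tau>) * exp (\<xi> + \<xi>')"
    by (simp_all only: exp_add exp_diff mult.assoc times_divide_eq_right)
  have "exp (2 * of_nat k * \<tau>) = exp (of_nat (k - k') * \<tau>) * exp (of_nat (k + k') * \<tau>)"
    unfolding exp_add[symmetric] by (rule arg_cong[of _ _ exp]) (use assms in \<open>simp add: of_nat_diff algebra_simps\<close>)
  moreover have "(a * b) / (c * d) * ((e * f) / (g * h)) = (a / c * (e / g)) * (b / d * (f / h))" for a b c d e f g h :: complex
    by (simp add: mult_ac)
  ultimately show ?thesis
    unfolding args pair_weight_def by (simp only: factor) (simp only: mult_ac)
qed

lemma theta_term_exp:
  assumes "\<alpha> 1 + \<alpha> 2 + \<alpha> 3 + \<alpha> 4 + \<alpha> 5 + \<alpha> 6 = 2 * \<eta> + (2 - 2 * of_nat n) * \<tau>"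
    and \<nu>: "\<nu> \<in> partition_tuples n N"
  shows "theta_term n p (exp (2 * \<eta>)) (exp \<tau>) (\<lambda>m. exp (\<alpha> m)) (\<lambda>i. exp (site n \<tau> (\<alpha> 1) i)) \<nu> =
    weight n (2 * \<eta>) \<tau> \<alpha> \<nu>"
proof -
  let ?q = "exp (2 * \<eta>)"
  let ?\<xi> = "site n \<tau> (\<alpha> 1)"
  have regroup: "theta_term n p q t a x \<nu> =
      (\<Prod>i=1..n. (q * t ^ (2 * (i - 1))) ^ \<nu> i * (theta (q ^ (2 * \<nu> i) * (x i)^2) p / theta ((x i)^2) p) *
        (\<Prod>m=1..6. theta_fact (a m * x i) p q (\<nu> i) / theta_fact (q * inverse (a m) * x i) p q (\<nu> i))) *
      (\<Prod>(j, k)\<in>index_pairs 1 n. (theta (q ^ (\<nu> j - \<nu> k) * x j / x k) p * theta (q ^ (\<nu> j + \<nu> k) * x j * x k) p)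
          / (theta (x j / x k) p * theta (x j * x k) p) *
        ((theta_fact (t * x j / x k) p q (\<nu> j - \<nu> k) * theta_fact (t * x j * x k) p q (\<nu> j + \<nu> k))
          / (theta_fact (q * inverse t * x j / x k) p q (\<nu> j - \<nu> k)
              * theta_fact (q * inverse t * x j * x k) p q (\<nu> j + \<nu> k))))" for q t a x
  proof -
    have "(\<Prod>i\<in>I. A i) * (\<Prod>(j, k)\<in>X. B j k) * (\<Prod>i\<in>I. C i) * (\<Prod>(j, k)\<in>X. D j k) =
        (\<Prod>i\<in>I. A i * C i) * (\<Prod>(j, k)\<in>X. B j k * D j k)"
      for I :: "nat set" and X :: "(nat \<times> nat) set" and A C :: "nat \<Rightarrow> complex" and B D :: "nat \<Rightarrow> nat \<Rightarrow> complex"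
      by (simp add: prod.distrib case_prod_unfold)
    then show ?thesis
      unfolding theta_term_def .
  qed
  have split: "theta_term n p ?q (exp \<tau>) (\<lambda>m. exp (\<alpha> m)) (\<lambda>i. exp (?\<xi> i)) \<nu> =
      (\<Prod>i=1..n. inverse (exp (2 * of_nat (\<nu> i) * \<tau>) ^ (n - i)) * site_weight (2 * \<eta>) \<alpha> (?\<xi> i) (\<nu> i)) *
      (\<Prod>(j, k)\<in>index_pairs 1 n. exp (2 * of_nat (\<nu> j) * \<tau>) * pair_weight (2 * \<eta>) \<tau> (?\<xi> j) (?\<xi> k) (\<nu> j) (\<nu> k))"
    unfolding regroup
  proof (rule arg_cong2[of _ _ _ _ "(*)"], goal_cases)
    case 1
    show ?case by (intro prod.cong refl site_term_exp assms(1)) auto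
  next
    case 2
    show ?case
      by (rule prod.cong[OF refl], clarify, rule pair_term_exp)
         (use \<nu> in \<open>auto simp: partition_tuples_def index_pairs_def\<close>)
  qed
  have pairs: "(\<Prod>(j, k)\<in>index_pairs 1 n. exp (2 * of_nat (\<nu> j) * \<tau>) * pair_weight (2 * \<eta>) \<tau> (?\<xi> j) (?\<xi> k) (\<nu> j) (\<nu> k)) =
      (\<Prod>j=1..n. exp (2 * of_nat (\<nu> j) * \<tau>) ^ (n - j)) *
      (\<Prod>(j, k)\<in>index_pairs 1 n. pair_weight (2 * \<eta>) \<tau> (?\<xi> j) (?\<xi> k) (\<nu> j) (\<nu> k))"
    unfolding prod_index_pairs_fst[symmetric] prod.distrib[symmetric] by (intro prod.cong) auto
  have cancel: "(\<Prod>i=1..n. inverse (exp (2 * of_nat (\<nu> i) * \<tau>) ^ (n - i))) * (\<Prod>j=1..n. exp (2 * of_nat (\<nu> j) * \<tau>) ^ (n - j)) = 1"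
    unfolding prod.distrib[symmetric] by (intro prod.neutral) simp
  have r: "(a * b) * (c * d) = (a * c) * (b * d)" for a b c d :: complex by simp
  show ?thesis
    unfolding split weight_def pairs prod.distrib[of _ _ "{1..n}"]
    by (rule trans[OF r]) (simp only: cancel mult_1)
qed

text \<open>The individual factors of the product leave exponentials of \<open>N * \<tau> * (n + 1 - 2 * i)\<close>, whose
exponents add up to zero over \<open>i\<close>.\<close>

lemma theta_product_exp:
  "theta_product n N p (exp (2 * \<eta>)) (exp \<tau>) (\<lambda>m. exp (\<alpha> m)) = jackson_prod n N \<eta> \<tau> \<alpha>"
proof -
  let ?q = "exp (2 * \<eta>)"
  have powi: "exp \<tau> powi k = exp (of_int k * \<tau>)" for k
    by (simp add: exp_power_int)
  define c where "c = (\<Prod>i<N. exp (of_nat i * (2 * \<eta>) / 2))"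
  have c0: "c \<noteq> 0" by (simp add: c_def)
  have tf: "theta_fact (exp z) p (?q) N = exp (of_nat N * z / 2) * c * Efact (2 * \<eta>) z N" for z
    unfolding c_def by (rule theta_fact_exp)
  have "theta_product n N p ?q (exp \<tau>) (\<lambda>m. exp (\<alpha> m)) =
      (\<Prod>i=1..n. exp (of_nat N * \<tau> * (of_nat n + 1 - 2 * of_nat i))) * jackson_prod n N \<eta> \<tau> \<alpha>"
    unfolding theta_product_def jackson_prod_def prod.distrib[symmetric]
  proof (intro prod.cong refl, goal_cases)
    case i: (1 i)
    have a1: "?q * (exp (\<alpha> 1))\<^sup>2 * exp \<tau> ^ (n + i - 2) = exp (2 * \<eta> + 2 * \<alpha> 1 + of_nat (n + i - 2) * \<tau>)"
      by (simp only: exp_add exp_of_nat_mult exp_double)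
    have a2: "?q * inverse (exp (\<alpha> j)) * inverse (exp (\<alpha> k)) * exp \<tau> powi (1 - int i) =
        exp (2 * \<eta> - \<alpha> j - \<alpha> k + (1 - of_nat i) * \<tau>)" for j k
      unfolding powi by (simp add: exp_add exp_diff field_simps)
    have a3: "?q * inverse (exp (\<alpha> 1)) * inverse (exp (\<alpha> 2)) * inverse (exp (\<alpha> 3)) * inverse (exp (\<alpha> 4)) *
        exp \<tau> powi (2 - int n - int i) = exp (2 * \<eta> - \<alpha> 1 - \<alpha> 2 - \<alpha> 3 - \<alpha> 4 + (2 - of_nat n - of_nat i) * \<tau>)"
      unfolding powi by (simp add: exp_add exp_diff field_simps)
    have a4: "?q * inverse (exp (\<alpha> m)) * exp (\<alpha> 1) * exp \<tau> ^ (i - 1) =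
        exp (2 * \<eta> - \<alpha> m + \<alpha> 1 + of_nat (i - 1) * \<tau>)" for m
      by (simp only: exp_add exp_diff exp_of_nat_mult) (simp add: field_simps)
    have pr: "(\<Prod>(j, k)\<in>index_pairs 2 4. f j k) = f 2 3 * f 2 4 * f 3 4" for f :: "nat \<Rightarrow> nat \<Rightarrow> complex"
      by (simp add: index_pairs_2_4 mult_ac)
    have pm: "(\<Prod>m=2..4. f m) = f 2 * f 3 * f 4" for f :: "nat \<Rightarrow> complex"
      by (simp add: numeral_eq_Suc mult_ac)
    have alg: "(g1 * c * x1) * ((g2 * c * x2) * (g3 * c * x3) * (g4 * c * x4)) /
        ((h1 * c * y1) * ((h2 * c * y2) * (h3 * c * y3) * (h4 * c * y4))) =
        (g1 * g2 * g3 * g4 / (h1 * h2 * h3 * h4)) * (x1 * (x2 * x3 * x4) / (y1 * (y2 * y3 * y4)))"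
      for g1 g2 g3 g4 h1 h2 h3 h4 x1 x2 x3 x4 y1 y2 y3 y4 :: complex
      using c0 by (simp add: mult_ac)
    have ex: "exp g1 * exp g2 * exp g3 * exp g4 / (exp h1 * exp h2 * exp h3 * exp h4) = exp (g1 + g2 + g3 + g4 - (h1 + h2 + h3 + h4))"
      for g1 g2 g3 g4 h1 h2 h3 h4 :: complex
      by (simp add: exp_add exp_diff)
    show ?case
      unfolding pr pm a1 a2 a3 a4 tf alg ex
      by (rule arg_cong2[of _ _ _ _ "(*)", OF arg_cong[of _ _ exp] refl])
         (use i in \<open>simp add: of_nat_diff field_simps\<close>)
  qed
  also have "(\<Prod>i=1..n. exp (of_nat N * \<tau> * (of_nat n + 1 - 2 * of_nat i))) = 1"
  proof -
    have "(\<Sum>i=1..n. c - 2 * of_nat i) = of_nat n * (c - of_nat n - 1)" for c :: complex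
      by (induction n) (simp_all add: algebra_simps)
    from this[of "of_nat n + 1"] show ?thesis
      by (simp add: exp_sum[symmetric] flip: sum_distrib_left)
  qed
  finally show ?thesis by simp
qed

theorem theta_jackson_generic:
  assumes "independent \<eta> \<tau> \<alpha>" "balanced n N \<eta> \<tau> \<alpha>" "1 \<le> n"
  shows "(\<Sum>\<nu>\<in>partition_tuples n N.
      theta_term n p (exp (2 * \<eta>)) (exp \<tau>) (\<lambda>m. exp (\<alpha> m)) (\<lambda>i. exp (site n \<tau> (\<alpha> 1) i)) \<nu>) =
    theta_product n N p (exp (2 * \<eta>)) (exp \<tau>) (\<lambda>m. exp (\<alpha> m))"
proof -
  have "\<alpha> 1 + \<alpha> 2 + \<alpha> 3 + \<alpha> 4 + \<alpha> 5 + \<alpha> 6 = 2 * \<eta> + (2 - 2 * of_nat n) * \<tau>"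
  proof -
    have b: "\<alpha> 5 = 2 * (of_nat N + 1) * \<eta> + (1 - of_nat n) * \<tau> - \<alpha> 2 - \<alpha> 3 - \<alpha> 4"
      "\<alpha> 6 = - 2 * of_nat N * \<eta> + (1 - of_nat n) * \<tau> - \<alpha> 1"
      using assms(2) by (simp_all only: balanced_def)
    show ?thesis by (simp add: b algebra_simps)
  qed
  then have "(\<Sum>\<nu>\<in>partition_tuples n N.
      theta_term n p (exp (2 * \<eta>)) (exp \<tau>) (\<lambda>m. exp (\<alpha> m)) (\<lambda>i. exp (site n \<tau> (\<alpha> 1) i)) \<nu>) =
      jackson_sum n N \<eta> \<tau> \<alpha>"
    unfolding jackson_sum_def by (intro sum.cong refl theta_term_exp)
  then show ?thesis
    using jackson_sum_eq_prod[OF assms] by (simp only: theta_product_exp)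
qed

section \<open>General parameters\<close>

lemma avoid_countable:
  assumes "countable H" "0 < \<epsilon>"
  obtains y :: complex where "dist y x < \<epsilon>" "\<And>e::int. of_int e * y \<in> H \<Longrightarrow> e = 0"
proof -
  let ?B = "(\<lambda>(e, h). h / of_int e) ` ((UNIV :: int set) \<times> H)"
  have "countable ?B" using assms by (intro countable_image countable_SIGMA) auto
  then have "\<not> ball x \<epsilon> \<subseteq> ?B"
    using uncountable_ball[OF assms(2), of x] countable_subset by blast
  then obtain y where y: "y \<in> ball x \<epsilon>" "y \<notin> ?B" by blast
  show ?thesis
  proof
    show "dist y x < \<epsilon>" using y by (simp add: dist_commute)
    fix e :: int assume "of_int e * y \<in> H"
    then have "e \<noteq> 0 \<Longrightarrow> y \<in> ?B"
      by (intro image_eqI[of _ _ "(e, of_int e * y)"]) auto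
    then show "e = 0" using y(2) by blast
  qed
qed

definition adjoin :: "complex set \<Rightarrow> complex \<Rightarrow> complex set" where
  "adjoin H x = (\<lambda>(h, e). h - of_int e * x) ` (H \<times> (UNIV :: int set))"

lemma countable_adjoin: "countable H \<Longrightarrow> countable (adjoin H x)"
  unfolding adjoin_def by (intro countable_image countable_SIGMA) auto

lemma adjoinI: "h \<in> H \<Longrightarrow> h - of_int e * x \<in> adjoin H x"
  unfolding adjoin_def by force

text \<open>Choosing the parameters one after the other, only countably many values are forbidden each time.\<close>

lemma independent_dense:
  assumes "0 < \<epsilon>"
  obtains \<eta>' \<tau>' \<alpha>' where "independent \<eta>' \<tau>' \<alpha>'" "dist \<eta>' \<eta> < \<epsilon>" "dist \<tau>' \<tau> < \<epsilon>"
    "\<And>m. m \<in> {1, 2, 3, 4} \<Longrightarrow> dist (\<alpha>' m) (\<alpha> m) < \<epsilon>"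
proof -
  note c = countable_lattice
  obtain x0 where x0: "dist x0 \<eta> < \<epsilon>" "\<And>e::int. of_int e * x0 \<in> lattice \<Longrightarrow> e = 0"
    using avoid_countable[OF c assms] by metis
  note c = countable_adjoin[OF c, of x0]
  obtain x1 where x1: "dist x1 \<tau> < \<epsilon>" "\<And>e::int. of_int e * x1 \<in> adjoin lattice x0 \<Longrightarrow> e = 0"
    using avoid_countable[OF c assms] by metis
  note c = countable_adjoin[OF c, of x1]
  obtain y1 where y1: "dist y1 (\<alpha> 1) < \<epsilon>" "\<And>e::int. of_int e * y1 \<in> adjoin (adjoin lattice x0) x1 \<Longrightarrow> e = 0"
    using avoid_countable[OF c assms] by metis
  note c = countable_adjoin[OF c, of y1]
  obtain y2 where y2: "dist y2 (\<alpha> 2) < \<epsilon>"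
    "\<And>e::int. of_int e * y2 \<in> adjoin (adjoin (adjoin lattice x0) x1) y1 \<Longrightarrow> e = 0"
    using avoid_countable[OF c assms] by metis
  note c = countable_adjoin[OF c, of y2]
  obtain y3 where y3: "dist y3 (\<alpha> 3) < \<epsilon>"
    "\<And>e::int. of_int e * y3 \<in> adjoin (adjoin (adjoin (adjoin lattice x0) x1) y1) y2 \<Longrightarrow> e = 0"
    using avoid_countable[OF c assms] by metis
  note c = countable_adjoin[OF c, of y3]
  obtain y4 where y4: "dist y4 (\<alpha> 4) < \<epsilon>"
    "\<And>e::int. of_int e * y4 \<in> adjoin (adjoin (adjoin (adjoin (adjoin lattice x0) x1) y1) y2) y3 \<Longrightarrow> e = 0"
    using avoid_countable[OF c assms] by metis
  define \<alpha>' where "\<alpha>' m = (if m = 1 then y1 else if m = 2 then y2 else if m = 3 then y3 else y4)" for m :: nat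
  show ?thesis
  proof
    show "independent x0 x1 \<alpha>'"
      unfolding independent_def
    proof (intro allI impI)
      fix a b c d e f :: int
      assume "of_int a * x0 + of_int b * x1 + of_int c * \<alpha>' 1 + of_int d * \<alpha>' 2 + of_int e * \<alpha>' 3 + of_int f * \<alpha>' 4 \<in> lattice"
      then obtain l where l: "l \<in> lattice" and
        eq: "l = of_int a * x0 + of_int b * x1 + of_int c * y1 + of_int d * y2 + of_int e * y3 + of_int f * y4"
        by (simp add: \<alpha>'_def)
      have h0: "l - of_int a * x0 \<in> adjoin lattice x0" using l by (rule adjoinI)
      note h1 = adjoinI[OF h0, of b x1]
      note h2 = adjoinI[OF h1, of c y1]
      note h3 = adjoinI[OF h2, of d y2]
      note h4 = adjoinI[OF h3, of e y3]
      have "f = 0" using h4 by (intro y4(2)) (simp add: eq)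
      moreover from this have "e = 0" using h3 by (intro y3(2)) (simp add: eq)
      moreover from calculation have "d = 0" using h2 by (intro y2(2)) (simp add: eq)
      moreover from calculation have "c = 0" using h1 by (intro y1(2)) (simp add: eq)
      moreover from calculation have "b = 0" using h0 by (intro x1(2)) (simp add: eq)
      moreover from calculation have "a = 0" using l by (intro x0(2)) (simp add: eq)
      ultimately show "a = 0 \<and> b = 0 \<and> c = 0 \<and> d = 0 \<and> e = 0 \<and> f = 0" by simp
    qed
    show "dist (\<alpha>' m) (\<alpha> m) < \<epsilon>" if "m \<in> {1, 2, 3, 4}" for m
      using that y1(1) y2(1) y3(1) y4(1) by (auto simp: \<alpha>'_def)
  qed (fact x0(1) x1(1))+
qed

end


lemma tendsto_theta_fact:
  assumes "X \<longlonglongrightarrow> x" "P \<longlonglongrightarrow> p" "Q \<longlonglongrightarrow> q" "norm p < 1" "x \<noteq> 0" "q \<noteq> 0"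
  shows "(\<lambda>r. theta_fact (X r) (P r) (Q r) k) \<longlonglongrightarrow> theta_fact x p q k"
  unfolding theta_fact_def using assms
  by (intro tendsto_prod tendsto_theta tendsto_mult tendsto_power) auto

lemma tendsto_prod_pairs:
  fixes f :: "nat \<Rightarrow> nat \<Rightarrow> nat \<Rightarrow> complex"
  assumes "\<And>j k. (j, k) \<in> A \<Longrightarrow> (\<lambda>r. f r j k) \<longlonglongrightarrow> g j k"
  shows "(\<lambda>r. \<Prod>(j, k)\<in>A. f r j k) \<longlonglongrightarrow> (\<Prod>(j, k)\<in>A. g j k)"
  by (rule tendsto_prod) (use assms in auto)

lemma tendsto_theta_term:
  assumes lim: "P \<longlonglongrightarrow> p" "Q \<longlonglongrightarrow> q" "T \<longlonglongrightarrow> t" "\<And>m. m \<in> {1..6} \<Longrightarrow> (\<lambda>r. A r m) \<longlonglongrightarrow> a m"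
      "\<And>i. i \<in> {1..n} \<Longrightarrow> (\<lambda>r. X r i) \<longlonglongrightarrow> \<xi> i"
    and nz: "norm p < 1" "q \<noteq> 0" "t \<noteq> 0" "\<And>m. m \<in> {1..6} \<Longrightarrow> a m \<noteq> 0" "\<And>i. i \<in> {1..n} \<Longrightarrow> \<xi> i \<noteq> 0"
    and g1: "\<And>i. i \<in> {1..n} \<Longrightarrow> theta ((\<xi> i)^2) p \<noteq> 0"
    and g2: "\<And>j k. (j, k) \<in> index_pairs 1 n \<Longrightarrow> theta (\<xi> j / \<xi> k) p \<noteq> 0 \<and> theta (\<xi> j * \<xi> k) p \<noteq> 0"
    and g3: "\<And>i m. i \<in> {1..n} \<Longrightarrow> m \<in> {1..6} \<Longrightarrow> theta_fact (q * inverse (a m) * \<xi> i) p q (\<nu> i) \<noteq> 0"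
    and g4: "\<And>j k. (j, k) \<in> index_pairs 1 n \<Longrightarrow>
          theta_fact (q * inverse t * \<xi> j / \<xi> k) p q (\<nu> j - \<nu> k) \<noteq> 0 \<and>
          theta_fact (q * inverse t * \<xi> j * \<xi> k) p q (\<nu> j + \<nu> k) \<noteq> 0"
  shows "(\<lambda>r. theta_term n (P r) (Q r) (T r) (A r) (X r) \<nu>) \<longlonglongrightarrow> theta_term n p q t a \<xi> \<nu>"
proof -
  have mem: "j \<in> {1..n} \<and> k \<in> {1..n}" if "(j, k) \<in> index_pairs 1 n" for j k
    using that by (auto simp: index_pairs_def)
  note tendsto = tendsto_mult tendsto_divide tendsto_power tendsto_inverse tendsto_theta tendsto_theta_fact
  show ?thesis
    unfolding theta_term_def
    by (intro tendsto_prod_pairs tendsto_prod tendsto lim)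
       (use mem nz g1 g2 g3 g4 in \<open>simp_all only: power_eq_0_iff mult_eq_0_iff divide_eq_0_iff inverse_nonzero_iff_nonzero, blast+\<close>)
qed

lemma tendsto_theta_product:
  assumes lim: "P \<longlonglongrightarrow> p" "Q \<longlonglongrightarrow> q" "T \<longlonglongrightarrow> t" "\<And>m. m \<in> {1..4} \<Longrightarrow> (\<lambda>r. A r m) \<longlonglongrightarrow> a m"
    and nz: "norm p < 1" "q \<noteq> 0" "t \<noteq> 0" "\<And>m. m \<in> {1..4} \<Longrightarrow> a m \<noteq> 0"
    and g1: "\<And>i. i \<in> {1..n} \<Longrightarrow>
          theta_fact (q * inverse (a 1) * inverse (a 2) * inverse (a 3) * inverse (a 4)
                        * t powi (2 - int n - int i)) p q N \<noteq> 0"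
    and g2: "\<And>i m. i \<in> {1..n} \<Longrightarrow> m \<in> {2..4} \<Longrightarrow>
          theta_fact (q * inverse (a m) * a 1 * t ^ (i - 1)) p q N \<noteq> 0"
  shows "(\<lambda>r. theta_product n N (P r) (Q r) (T r) (A r)) \<longlonglongrightarrow> theta_product n N p q t a"
proof -
  note tendsto = tendsto_mult tendsto_divide tendsto_power tendsto_power_int tendsto_inverse tendsto_theta_fact
  have a: "(\<lambda>r. A r 1) \<longlonglongrightarrow> a 1" "(\<lambda>r. A r 2) \<longlonglongrightarrow> a 2" "(\<lambda>r. A r 3) \<longlonglongrightarrow> a 3" "(\<lambda>r. A r 4) \<longlonglongrightarrow> a 4"
    "a 1 \<noteq> 0" "a 2 \<noteq> 0" "a 3 \<noteq> 0" "a 4 \<noteq> 0"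
    by (rule lim nz; simp)+
  show ?thesis
    unfolding theta_product_def
    by (intro tendsto_prod tendsto_prod_pairs tendsto lim nz a)
       (use nz a g1 g2 in \<open>auto simp: index_pairs_def\<close>)
qed

text \<open>The parameters, and the nome if it is zero, are approximated by parameters in general position.
Both sides are continuous wherever the denominators do not vanish.\<close>

theorem mainTheorem1:
  fixes n N :: nat and p q t :: complex and a \<xi> :: "nat \<Rightarrow> complex"
  assumes n: "n \<ge> 1"
    and p: "norm p < 1"
    and q: "q \<noteq> 0" and t: "t \<noteq> 0"
    and a: "\<And>m. m \<in> {1..6} \<Longrightarrow> a m \<noteq> 0"
    and balancing: "a 1 * a 2 * a 3 * a 4 * a 5 * a 6 * t ^ (2 * n - 2) = q"
    and truncation: "a 1 * a 6 * t ^ (n - 1) = q powi (- int N)"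
    and xi: "\<And>i. i \<in> {1..n} \<Longrightarrow> \<xi> i = a 1 * t ^ (n - i)"
    and generic_lhs_1: "\<And>i. i \<in> {1..n} \<Longrightarrow> theta ((\<xi> i)^2) p \<noteq> 0"
    and generic_lhs_2: "\<And>j k. (j, k) \<in> index_pairs 1 n \<Longrightarrow>
          theta (\<xi> j / \<xi> k) p \<noteq> 0 \<and> theta (\<xi> j * \<xi> k) p \<noteq> 0"
    and generic_lhs_3: "\<And>\<nu> i m. \<nu> \<in> partition_tuples n N \<Longrightarrow> i \<in> {1..n} \<Longrightarrow> m \<in> {1..6} \<Longrightarrow>
          theta_fact (q * inverse (a m) * \<xi> i) p q (\<nu> i) \<noteq> 0"
    and generic_lhs_4: "\<And>\<nu> j k. \<nu> \<in> partition_tuples n N \<Longrightarrow> (j, k) \<in> index_pairs 1 n \<Longrightarrow>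
          theta_fact (q * inverse t * \<xi> j / \<xi> k) p q (\<nu> j - \<nu> k) \<noteq> 0 \<and>
          theta_fact (q * inverse t * \<xi> j * \<xi> k) p q (\<nu> j + \<nu> k) \<noteq> 0"
    and generic_rhs_1: "\<And>i. i \<in> {1..n} \<Longrightarrow>
          theta_fact (q * inverse (a 1) * inverse (a 2) * inverse (a 3) * inverse (a 4)
                        * t powi (2 - int n - int i)) p q N \<noteq> 0"
    and generic_rhs_2: "\<And>i m. i \<in> {1..n} \<Longrightarrow> m \<in> {2..4} \<Longrightarrow>
          theta_fact (q * inverse (a m) * a 1 * t ^ (i - 1)) p q N \<noteq> 0"
  shows
    "(\<Sum>\<nu>\<in>partition_tuples n N.
        (\<Prod>i=1..n. (q * t ^ (2 * (i - 1))) ^ \<nu> i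
            * (theta (q ^ (2 * \<nu> i) * (\<xi> i)^2) p / theta ((\<xi> i)^2) p))
      * (\<Prod>(j, k)\<in>index_pairs 1 n.
            (theta (q ^ (\<nu> j - \<nu> k) * \<xi> j / \<xi> k) p * theta (q ^ (\<nu> j + \<nu> k) * \<xi> j * \<xi> k) p)
          / (theta (\<xi> j / \<xi> k) p * theta (\<xi> j * \<xi> k) p))
      * (\<Prod>i=1..n. \<Prod>m=1..6.
            theta_fact (a m * \<xi> i) p q (\<nu> i)
          / theta_fact (q * inverse (a m) * \<xi> i) p q (\<nu> i))
      * (\<Prod>(j, k)\<in>index_pairs 1 n.
            (theta_fact (t * \<xi> j / \<xi> k) p q (\<nu> j - \<nu> k)
              * theta_fact (t * \<xi> j * \<xi> k) p q (\<nu> j + \<nu> k))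
          / (theta_fact (q * inverse t * \<xi> j / \<xi> k) p q (\<nu> j - \<nu> k)
              * theta_fact (q * inverse t * \<xi> j * \<xi> k) p q (\<nu> j + \<nu> k))))
   = (\<Prod>i=1..n.
        (theta_fact (q * (a 1)^2 * t ^ (n + i - 2)) p q N
          * (\<Prod>(j, k)\<in>index_pairs 2 4.
               theta_fact (q * inverse (a j) * inverse (a k) * t powi (1 - int i)) p q N))
      / (theta_fact (q * inverse (a 1) * inverse (a 2) * inverse (a 3) * inverse (a 4)
                       * t powi (2 - int n - int i)) p q N
          * (\<Prod>m=2..4. theta_fact (q * inverse (a m) * a 1 * t ^ (i - 1)) p q N)))"
proof -
  have a0: "a 1 \<noteq> 0" "a 2 \<noteq> 0" "a 3 \<noteq> 0" "a 4 \<noteq> 0" "a 5 \<noteq> 0" "a 6 \<noteq> 0"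
    by (rule a; simp)+
  define \<eta> where "\<eta> = Ln q / 2"
  define \<tau> where "\<tau> = Ln t"
  define \<alpha> where "\<alpha> m = Ln (a m)" for m
  have exps: "exp (2 * \<eta>) = q" "exp \<tau> = t"
    using q t by (auto simp: \<eta>_def \<tau>_def)
  have exp_\<alpha>: "exp (\<alpha> m) = a m" if "m \<in> {1..6}" for m
    using a[OF that] by (simp add: \<alpha>_def)
  \<comment> \<open>the generic result needs a nonzero nome\<close>
  define P where "P r = (if p = 0 then of_real (1 / real (r + 2)) else p)" for r
  have P: "theta_lattice (P r)" for r
  proof
    have "(of_real (1 / real (r + 2)) :: complex) \<noteq> 0" "norm (of_real (1 / real (r + 2)) :: complex) < 1"
      by (simp_all only: of_real_eq_0_iff norm_of_real) simp_all
    then show "P r \<noteq> 0" "norm (P r) < 1"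
      using p by (simp_all only: P_def split: if_split) auto
  qed
  have limP: "P \<longlonglongrightarrow> p"
  proof (cases "p = 0")
    case True
    have "(\<lambda>r. 1 / real (r + 2)) \<longlonglongrightarrow> 0"
      by (rule LIMSEQ_ignore_initial_segment[OF lim_1_over_n])
    then have "(\<lambda>r. of_real (1 / real (r + 2)) :: complex) \<longlonglongrightarrow> of_real 0"
      by (rule tendsto_of_real)
    with True show ?thesis by (simp add: P_def[abs_def])
  qed (simp add: P_def[abs_def])
  have "\<exists>\<eta>' \<tau>' \<alpha>'. theta_lattice.independent (P r) \<eta>' \<tau>' \<alpha>' \<and> dist \<eta>' \<eta> < 1 / real (Suc r) \<and>
      dist \<tau>' \<tau> < 1 / real (Suc r) \<and> (\<forall>m\<in>{1, 2, 3, 4}. dist (\<alpha>' m) (\<alpha> m) < 1 / real (Suc r))" for r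
    using theta_lattice.independent_dense[OF P[of r], of "1 / real (Suc r)" \<eta> \<tau> \<alpha>]
    by (metis of_nat_0_less_iff zero_less_Suc zero_less_divide_1_iff)
  then obtain H T B where ind: "\<And>r. theta_lattice.independent (P r) (H r) (T r) (B r)"
    and near: "\<And>r. dist (H r) \<eta> < 1 / real (Suc r)" "\<And>r. dist (T r) \<tau> < 1 / real (Suc r)"
      "\<And>r m. m \<in> {1, 2, 3, 4} \<Longrightarrow> dist (B r m) (\<alpha> m) < 1 / real (Suc r)"
    by metis
  have near_lim: "f \<longlonglongrightarrow> l" if "\<And>r. dist (f r) l < 1 / real (Suc r)" for f :: "nat \<Rightarrow> complex" and l
  proof (rule metric_tendsto_imp_tendsto[OF LIMSEQ_inverse_real_of_nat])
    show "\<forall>\<^sub>F r in sequentially. dist (f r) l \<le> dist (inverse (real (Suc r))) 0"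
      using that by (intro always_eventually allI less_imp_le) (simp add: dist_real_def inverse_eq_divide)
  qed
  have limH: "H \<longlonglongrightarrow> \<eta>" and limT: "T \<longlonglongrightarrow> \<tau>"
    and limB: "(\<lambda>r. B r 1) \<longlonglongrightarrow> \<alpha> 1" "(\<lambda>r. B r 2) \<longlonglongrightarrow> \<alpha> 2" "(\<lambda>r. B r 3) \<longlonglongrightarrow> \<alpha> 3" "(\<lambda>r. B r 4) \<longlonglongrightarrow> \<alpha> 4"
    using near by (auto intro!: near_lim)
  define A where "A r = (B r)(5 := 2 * (of_nat N + 1) * H r + (1 - of_nat n) * T r - B r 2 - B r 3 - B r 4,
      6 := - 2 * of_nat N * H r + (1 - of_nat n) * T r - B r 1)" for r
  have indA: "theta_lattice.independent (P r) (H r) (T r) (A r)" for r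
    using ind[of r] unfolding theta_lattice.independent_def[OF P] by (simp add: A_def)
  have balA: "theta_lattice.balanced n N (H r) (T r) (A r)" for r
    unfolding theta_lattice.balanced_def[OF P] by (simp add: A_def)
  let ?Q = "\<lambda>r. exp (2 * H r)" and ?T = "\<lambda>r. exp (T r)" and ?A = "\<lambda>r m. exp (A r m)"
    and ?X = "\<lambda>r i. exp (theta_lattice.site n (T r) (A r 1) i)"
  have limQ: "?Q \<longlonglongrightarrow> q" and limt: "?T \<longlonglongrightarrow> t"
    unfolding exps[symmetric] by (intro tendsto_intros limH limT)+
  have tn: "exp ((1 - of_nat n) * \<tau>) = inverse (t ^ (n - 1))"
  proof -
    have "(1 - of_nat n) * \<tau> = - (of_nat (n - 1) * \<tau>)" using n by (simp add: of_nat_diff algebra_simps)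
    then show ?thesis by (simp only: exp_minus exp_of_nat_mult exps)
  qed
  have qN: "exp (2 * of_nat k * \<eta>) = q ^ k" for k
    unfolding exps(1)[symmetric] exp_of_nat_mult[symmetric] by (simp add: mult_ac)
  have a6: "a 6 = exp (- 2 * of_nat N * \<eta> + (1 - of_nat n) * \<tau> - \<alpha> 1)"
  proof -
    have "exp (- 2 * of_nat N * \<eta> + (1 - of_nat n) * \<tau> - \<alpha> 1) = inverse (q ^ N) * inverse (t ^ (n - 1)) / a 1"
      using qN[of N] by (simp add: exp_diff exp_add exp_minus tn exp_\<alpha>) (simp add: divide_inverse mult_ac)
    moreover have "a 1 * a 6 * t ^ (n - 1) = inverse (q ^ N)"
      using truncation by (simp add: power_int_minus)
    moreover have "a 6 = (a 1 * a 6 * t ^ (n - 1)) * inverse (t ^ (n - 1)) / a 1"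
      using a0 t by simp
    ultimately show ?thesis by simp
  qed
  have a5: "a 5 = exp (2 * (of_nat N + 1) * \<eta> + (1 - of_nat n) * \<tau> - \<alpha> 2 - \<alpha> 3 - \<alpha> 4)"
  proof -
    have "exp (2 * (of_nat N + 1) * \<eta> + (1 - of_nat n) * \<tau> - \<alpha> 2 - \<alpha> 3 - \<alpha> 4) =
        q ^ Suc N * inverse (t ^ (n - 1)) / (a 2 * a 3 * a 4)"
      using qN[of "Suc N"] by (simp add: exp_diff exp_add tn exp_\<alpha> add.commute)
    moreover have "a 2 * a 3 * a 4 * a 5 * t ^ (n - 1) = q ^ Suc N"
    proof -
      have "2 * n - 2 = (n - 1) + (n - 1)" using n by simp
      then have "(a 1 * a 6 * t ^ (n - 1)) * (a 2 * a 3 * a 4 * a 5 * t ^ (n - 1)) = q"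
        using balancing by (simp only: power_add mult_ac)
      then show ?thesis
        unfolding truncation using q by (simp add: power_int_minus field_simps)
    qed
    moreover from this have "a 5 = q ^ Suc N * inverse (t ^ (n - 1)) / (a 2 * a 3 * a 4)"
      using a0 t by (simp add: field_simps)
    ultimately show ?thesis by (simp only:)
  qed
  have limA: "(\<lambda>r. ?A r m) \<longlonglongrightarrow> a m" if "m \<in> {1..6}" for m
  proof -
    have "m \<in> {1, 2, 3, 4, 5, 6}" using that by auto
    then show ?thesis
    proof (elim insertE emptyE)
      assume m: "m = 5"
      show ?thesis unfolding m a5 A_def by (simp del: One_nat_def, intro tendsto_intros limH limT limB)
    next
      assume m: "m = 6"
      show ?thesis unfolding m a6 A_def by (simp del: One_nat_def, intro tendsto_intros limH limT limB)
    qed (use limB[THEN tendsto_exp] in \<open>simp_all add: A_def exp_\<alpha>\<close>)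
  qed
  have limX: "(\<lambda>r. ?X r i) \<longlonglongrightarrow> \<xi> i" if i: "i \<in> {1..n}" for i
  proof -
    have "(\<lambda>r. exp (A r 1 + of_nat (n - i) * T r)) \<longlonglongrightarrow> exp (\<alpha> 1 + of_nat (n - i) * \<tau>)"
      unfolding A_def by (simp del: One_nat_def, intro tendsto_intros limT limB)
    also have "exp (\<alpha> 1 + of_nat (n - i) * \<tau>) = \<xi> i"
      using xi[OF i] by (simp add: exp_add exp_of_nat_mult exp_\<alpha> exps)
    finally show ?thesis by (simp add: theta_lattice.site_def[OF P])
  qed
  have "(\<lambda>r. \<Sum>\<nu>\<in>partition_tuples n N. theta_term n (P r) (?Q r) (?T r) (?A r) (?X r) \<nu>)
      \<longlonglongrightarrow> (\<Sum>\<nu>\<in>partition_tuples n N. theta_term n p q t a \<xi> \<nu>)"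
  proof (rule tendsto_sum, rule tendsto_theta_term[OF limP limQ limt limA limX p q t a])
    show "\<xi> i \<noteq> 0" if "i \<in> {1..n}" for i
      using xi[OF that] a0 t by simp
  qed (use generic_lhs_1 generic_lhs_2 generic_lhs_3 generic_lhs_4 in blast)+
  moreover have "(\<Sum>\<nu>\<in>partition_tuples n N. theta_term n (P r) (?Q r) (?T r) (?A r) (?X r) \<nu>) =
      theta_product n N (P r) (?Q r) (?T r) (?A r)" for r
    by (rule theta_lattice.theta_jackson_generic[OF P indA balA n])
  moreover have "(\<lambda>r. theta_product n N (P r) (?Q r) (?T r) (?A r)) \<longlonglongrightarrow> theta_product n N p q t a"
    by (rule tendsto_theta_product[OF limP limQ limt limA p q t a]) (use generic_rhs_1 generic_rhs_2 in auto)
  ultimately have "(\<Sum>\<nu>\<in>partition_tuples n N. theta_term n p q t a \<xi> \<nu>) = theta_product n N p q t a"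
    using LIMSEQ_unique by (simp only:)
  then show ?thesis
    unfolding theta_term_def theta_product_def .
qed

end
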